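(* Let $(G,C)$ be a measured groupoid, let $L$ be a representation of $(G,C)$ in a (real or complex) Hilbert bundle $\mathcal{H}$ over $G^{(0)}$, and let $b$ be an $L$-cocycle. Consider the following conditions: (i) $b$ is an $L$-coboundary; (ii) there exists a Borel subset $E$ of $G^{(0)}$, of positive measure, such that $\sup\{\|b(\gamma)\| : \gamma\in G|_E\}<+\infty$; (iii) there exists a Borel subset $E$ of $G^{(0)}$, of positive measure, such that for every $x\in E$ we have $\sup\{\|b(\gamma)\| : \gamma\in G^x_E\}<+\infty$. Then (i) $\Rightarrow$ (ii) $\Rightarrow$ (iii). Moreover, when $(G,C)$ is an ergodic $r$-discrete measured groupoid, the three conditions are equivalent.
   Context: Conventions: Borel spaces are standard, Hilbert spaces are separable. For a groupoid $G$: $G^{(0)}$ is the unit space, $r,s:G\to G^{(0)}$ the range and source maps, $G^{(2)}=\{(\gamma_1,\gamma_2): s(\gamma_1)=r(\gamma_2)\}$, $G^x=r^{-1}(x)$; for $A\subset G^{(0)}$, $G|_A=\{\gamma: r(\gamma)\in A,\ s(\gamma)\in A\}$, $G^x_A=\{\gamma: r(\gamma)=x,\ s(\gamma)\in A\}$, and $A$ is invariant if $s(r^{-1}(A))=A$. A Borel groupoid is a groupoid with a Borel structure for which all operations are Borel. A measure class $C$ on $G$ is symmetric if each $\nu\in C$ is equivalent to its image under $\gamma\mapsto\gamma^{-1}$; it is invariant if some probability measure $\nu\in C$ has a disintegration $(\nu^x)$ along $r$ with $\gamma\nu^{s(\gamma)}$ equivalent to $\nu^{r(\gamma)}$ for almost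 every $\gamma$. A measured groupoid is a pair $(G,C)$ with $G$ a Borel groupoid and $C$ a symmetric invariant measure class; $r(C)$ is the class of $r_*\nu$, $\nu\in C$ a probability measure. "Null, conull, positive measure" in $G^{(0)}$ refer to $r(C)$. An inessential reduction is $(G|_U,C|_U)$ with $U\subset G^{(0)}$ conull Borel. $(G,C)$ is ergodic if every invariant Borel subset of $G^{(0)}$ is null or conull. It is $r$-discrete if for some inessential reduction all fibres $G^x$ are countable. Properties are considered up to null sets; a measured groupoid may be replaced by an inessential reduction. A Hilbert bundle over a Borel space is a Borel field of separable Hilbert spaces; sections are Borel. A representation of $(G,C)$ in a Hilbert bundle $\mathcal{H}$ over $G^{(0)}$ is a Borel map $\gamma\mapsto L(\gamma)$, with $L(\gamma):\mathcal{H}(s(\gamma))\to\mathcal{H}(r(\gamma))$ a Hilbert space isomorphism, such that on some inessential reduction $L(\gamma_1\gamma_2)=L(\gamma_1)L(\gamma_2)$ for all composable pairs. An $L$-cocycle is a Borel map $b$ with $b(\gamma)\in\mathcal{H}(r(\gamma))$ such that on some inessential reduction $b(\gamma_1\gamma_2)=b(\gamma_1)+L(\gamma_1)b(\gamma_2)$ for all composable pairs. It is an $L$-coboundary if there is a Borel section $\xi$ of $\mathcal{H}$ with $b(\gamma)=\xi(r(\gamma))-L(\gamma)\xi(s(\gamma))$ for $C$-almost every $\gamma$.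
   Formalization: Invariance of C is required for all γ in G|_U, for some conull Borel U, instead of for almost every γ; with the latter, (i)⇒(ii) fails for G = ℤ, C = [δ_0], the trivial representation on ℝ, b(n) = n. *)

theory Defs
  imports "HOL-Algebra.Module" "HOL-Probability.Probability"
begin

section \<open>Standard Borel spaces, groupoids\<close>

text \<open>A measurable space is given, as usual, by a measure of which only the \<open>space\<close> and the
  \<open>sets\<close> matter.\<close>

definition standard_borel :: "'a measure \<Rightarrow> bool" where
  "standard_borel M \<longleftrightarrow>
     (\<exists>T. completely_metrizable_space T \<and> second_countable T \<and> topspace T = space M \<and>
          sets M = sigma_sets (topspace T) {U. openin T U})"

text \<open>The units are themselves arrows: \<open>rng\<close> and \<open>src\<close> send an arrow to the identity arrow
  at its range and at its source. The product \<open>mul G \<gamma>1 \<gamma>2\<close> is meaningful for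
  \<open>src G \<gamma>1 = rng G \<gamma>2\<close> only.\<close>

record 'g groupoid =
  arr :: "'g measure"
  rng :: "'g \<Rightarrow> 'g"
  src :: "'g \<Rightarrow> 'g"
  mul :: "'g \<Rightarrow> 'g \<Rightarrow> 'g"
  ginv :: "'g \<Rightarrow> 'g"

definition arrows :: "'g groupoid \<Rightarrow> 'g set" where
  "arrows G = space (arr G)"

definition units :: "'g groupoid \<Rightarrow> 'g set" where
  "units G = rng G ` arrows G"

definition unit_space :: "'g groupoid \<Rightarrow> 'g measure" where
  "unit_space G = restrict_space (arr G) (units G)"

definition composable :: "'g groupoid \<Rightarrow> ('g \<times> 'g) set" where
  "composable G = {(\<gamma>1, \<gamma>2). \<gamma>1 \<in> arrows G \<and> \<gamma>2 \<in> arrows G \<and> src G \<gamma>1 = rng G \<gamma>2}"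

definition fibre :: "'g groupoid \<Rightarrow> 'g \<Rightarrow> 'g set" where
  "fibre G x = {\<gamma> \<in> arrows G. rng G \<gamma> = x}"

definition reduction :: "'g groupoid \<Rightarrow> 'g set \<Rightarrow> 'g set" where
  "reduction G A = {\<gamma> \<in> arrows G. rng G \<gamma> \<in> A \<and> src G \<gamma> \<in> A}"

definition fibre_into :: "'g groupoid \<Rightarrow> 'g \<Rightarrow> 'g set \<Rightarrow> 'g set" where
  "fibre_into G x A = {\<gamma> \<in> arrows G. rng G \<gamma> = x \<and> src G \<gamma> \<in> A}"

definition invariant_set :: "'g groupoid \<Rightarrow> 'g set \<Rightarrow> bool" where
  "invariant_set G A \<longleftrightarrow> src G ` {\<gamma> \<in> arrows G. rng G \<gamma> \<in> A} = A"

locale groupoid =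
  fixes G :: "'g groupoid"
  assumes rng_closed: "\<gamma> \<in> arrows G \<Longrightarrow> rng G \<gamma> \<in> arrows G"
    and src_closed: "\<gamma> \<in> arrows G \<Longrightarrow> src G \<gamma> \<in> arrows G"
    and rng_rng: "\<gamma> \<in> arrows G \<Longrightarrow> rng G (rng G \<gamma>) = rng G \<gamma>"
    and src_rng: "\<gamma> \<in> arrows G \<Longrightarrow> src G (rng G \<gamma>) = rng G \<gamma>"
    and rng_src: "\<gamma> \<in> arrows G \<Longrightarrow> rng G (src G \<gamma>) = src G \<gamma>"
    and src_src: "\<gamma> \<in> arrows G \<Longrightarrow> src G (src G \<gamma>) = src G \<gamma>"
    and mul_closed: "(\<gamma>1, \<gamma>2) \<in> composable G \<Longrightarrow> mul G \<gamma>1 \<gamma>2 \<in> arrows G"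
    and rng_mul: "(\<gamma>1, \<gamma>2) \<in> composable G \<Longrightarrow> rng G (mul G \<gamma>1 \<gamma>2) = rng G \<gamma>1"
    and src_mul: "(\<gamma>1, \<gamma>2) \<in> composable G \<Longrightarrow> src G (mul G \<gamma>1 \<gamma>2) = src G \<gamma>2"
    and mul_assoc: "(\<gamma>1, \<gamma>2) \<in> composable G \<Longrightarrow> (\<gamma>2, \<gamma>3) \<in> composable G \<Longrightarrow>
          mul G (mul G \<gamma>1 \<gamma>2) \<gamma>3 = mul G \<gamma>1 (mul G \<gamma>2 \<gamma>3)"
    and unit_left: "\<gamma> \<in> arrows G \<Longrightarrow> mul G (rng G \<gamma>) \<gamma> = \<gamma>"
    and unit_right: "\<gamma> \<in> arrows G \<Longrightarrow> mul G \<gamma> (src G \<gamma>) = \<gamma>"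
    and ginv_closed: "\<gamma> \<in> arrows G \<Longrightarrow> ginv G \<gamma> \<in> arrows G"
    and rng_ginv: "\<gamma> \<in> arrows G \<Longrightarrow> rng G (ginv G \<gamma>) = src G \<gamma>"
    and src_ginv: "\<gamma> \<in> arrows G \<Longrightarrow> src G (ginv G \<gamma>) = rng G \<gamma>"
    and mul_ginv_right: "\<gamma> \<in> arrows G \<Longrightarrow> mul G \<gamma> (ginv G \<gamma>) = rng G \<gamma>"
    and mul_ginv_left: "\<gamma> \<in> arrows G \<Longrightarrow> mul G (ginv G \<gamma>) \<gamma> = src G \<gamma>"

locale borel_groupoid = groupoid G for G :: "'g groupoid" +
  assumes standard: "standard_borel (arr G)"
    and rng_borel: "rng G \<in> arr G \<rightarrow>\<^sub>M arr G"
    and src_borel: "src G \<in> arr G \<rightarrow>\<^sub>M arr G"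
    and ginv_borel: "ginv G \<in> arr G \<rightarrow>\<^sub>M arr G"
    and mul_borel: "(\<lambda>(\<gamma>1, \<gamma>2). mul G \<gamma>1 \<gamma>2)
          \<in> restrict_space (arr G \<Otimes>\<^sub>M arr G) (composable G) \<rightarrow>\<^sub>M arr G"

section \<open>Measured groupoids\<close>

definition measure_equiv :: "'a measure \<Rightarrow> 'a measure \<Rightarrow> bool" where
  "measure_equiv \<mu> \<nu> \<longleftrightarrow>
     sets \<mu> = sets \<nu> \<and> absolutely_continuous \<mu> \<nu> \<and> absolutely_continuous \<nu> \<mu>"

definition measure_class_of :: "'a measure \<Rightarrow> 'a measure set" where
  "measure_class_of \<nu> = {\<mu>. sigma_finite_measure \<mu> \<and> measure_equiv \<mu> \<nu>}"

definition measure_class_on :: "'a measure \<Rightarrow> 'a measure set \<Rightarrow> bool" where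
  "measure_class_on M C \<longleftrightarrow>
     (\<exists>\<nu>. sigma_finite_measure \<nu> \<and> sets \<nu> = sets M \<and> C = measure_class_of \<nu>)"

definition range_class :: "'g groupoid \<Rightarrow> 'g measure set \<Rightarrow> 'g measure set" where
  "range_class G C =
     (\<Union>\<nu>\<in>{\<nu>\<in>C. prob_space \<nu>}. measure_class_of (distr \<nu> (unit_space G) (rng G)))"

definition null_units :: "'g groupoid \<Rightarrow> 'g measure set \<Rightarrow> 'g set \<Rightarrow> bool" where
  "null_units G C A \<longleftrightarrow>
     A \<in> sets (unit_space G) \<and> (\<forall>\<mu>\<in>range_class G C. emeasure \<mu> A = 0)"

definition conull_units :: "'g groupoid \<Rightarrow> 'g measure set \<Rightarrow> 'g set \<Rightarrow> bool" where
  "conull_units G C A \<longleftrightarrow> A \<in> sets (unit_space G) \<and> null_units G C (units G - A)"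

definition positive_units :: "'g groupoid \<Rightarrow> 'g measure set \<Rightarrow> 'g set \<Rightarrow> bool" where
  "positive_units G C A \<longleftrightarrow> A \<in> sets (unit_space G) \<and> \<not> null_units G C A"

definition symmetric_class :: "'g groupoid \<Rightarrow> 'g measure set \<Rightarrow> bool" where
  "symmetric_class G C \<longleftrightarrow> (\<forall>\<nu>\<in>C. measure_equiv \<nu> (distr \<nu> (arr G) (ginv G)))"

definition disintegration_along_rng ::
    "'g groupoid \<Rightarrow> 'g measure \<Rightarrow> ('g \<Rightarrow> 'g measure) \<Rightarrow> bool" where
  "disintegration_along_rng G \<nu> \<kappa> \<longleftrightarrow>
     \<kappa> \<in> unit_space G \<rightarrow>\<^sub>M prob_algebra (arr G) \<and>
     (\<forall>x\<in>units G. emeasure (\<kappa> x) (fibre G x) = 1) \<and>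
     (\<forall>A\<in>sets (arr G).
        emeasure \<nu> A = (\<integral>\<^sup>+ x. emeasure (\<kappa> x) A \<partial>distr \<nu> (unit_space G) (rng G)))"

text \<open>The measure \<open>\<gamma> \<mu>\<close>, for \<open>\<mu>\<close> carried by the fibre over \<open>src G \<gamma>\<close>. The restriction is there
  because left multiplication by \<open>\<gamma>\<close> is defined, and measurable, on that fibre only.\<close>

definition translate :: "'g groupoid \<Rightarrow> 'g \<Rightarrow> 'g measure \<Rightarrow> 'g measure" where
  "translate G \<gamma> \<mu> = distr (restrict_space \<mu> (fibre G (src G \<gamma>))) (arr G) (mul G \<gamma>)"

text \<open>The equivalence of \<open>\<gamma> \<nu>\<^sup>s\<close> and \<open>\<nu>\<^sup>r\<close> is required for all arrows of an inessential reduction;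
  this is how ``for almost every \<open>\<gamma>\<close>'' has to be understood here. Being required only off a
  \<open>C\<close>-null set of arrows would be too weak: the class of the point mass at the neutral element of
  the group of integers would qualify, although it ignores all other arrows. For that class the
  cocycle \<open>b n = n\<close> would almost everywhere coincide with the coboundary \<open>0\<close>, without being
  bounded.\<close>

definition invariant_class :: "'g groupoid \<Rightarrow> 'g measure set \<Rightarrow> bool" where
  "invariant_class G C \<longleftrightarrow>
     (\<exists>\<nu>\<in>C. prob_space \<nu> \<and>
        (\<exists>\<kappa>. disintegration_along_rng G \<nu> \<kappa> \<and>
           (\<exists>U. conull_units G C U \<and>
              (\<forall>\<gamma>\<in>reduction G U.
                 measure_equiv (translate G \<gamma> (\<kappa> (src G \<gamma>))) (\<kappa> (rng G \<gamma>))))))"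

locale measured_groupoid = borel_groupoid G for G :: "'g groupoid" +
  fixes C :: "'g measure set"
  assumes measure_class: "measure_class_on (arr G) C"
    and symmetric: "symmetric_class G C"
    and invariant: "invariant_class G C"

definition ergodic_groupoid :: "'g groupoid \<Rightarrow> 'g measure set \<Rightarrow> bool" where
  "ergodic_groupoid G C \<longleftrightarrow>
     (\<forall>A\<in>sets (unit_space G). invariant_set G A \<longrightarrow> null_units G C A \<or> conull_units G C A)"

definition r_discrete :: "'g groupoid \<Rightarrow> 'g measure set \<Rightarrow> bool" where
  "r_discrete G C \<longleftrightarrow> (\<exists>U. conull_units G C U \<and> (\<forall>x\<in>U. countable (fibre_into G x U)))"

section \<open>Hilbert bundles\<close>

text \<open>Real and complex Hilbert spaces are treated at the same time: the field of scalars is a set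
  \<open>K\<close> of complex numbers, either \<open>\<real>\<close> or \<open>UNIV\<close>, and the inner product takes its values in \<open>K\<close>.
  For \<open>K = \<real>\<close> the conjugation in \<open>ip_commute\<close> does nothing, and multiplication by scalars outside
  \<open>\<real>\<close> is unspecified. Of the record fields inherited from rings, only the additive ones are
  used.\<close>

definition scalar_ring :: "complex set \<Rightarrow> complex ring" where
  "scalar_ring K = \<lparr>carrier = K, monoid.mult = (*), one = 1, zero = 0, add = (+)\<rparr>"

record 'h hilbert = "(complex, 'h) module" +
  ip :: "'h \<Rightarrow> 'h \<Rightarrow> complex"

definition hnorm :: "('h, 'z) hilbert_scheme \<Rightarrow> 'h \<Rightarrow> real" where
  "hnorm V v = sqrt (Re (ip V v v))"

locale hilbert_space = Module.module "scalar_ring K" V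
  for K :: "complex set" and V :: "'h hilbert" +
  assumes scalars: "K = \<real> \<or> K = UNIV"
    and ip_closed: "v \<in> carrier V \<Longrightarrow> w \<in> carrier V \<Longrightarrow> ip V v w \<in> K"
    and ip_add: "u \<in> carrier V \<Longrightarrow> v \<in> carrier V \<Longrightarrow> w \<in> carrier V \<Longrightarrow>
          ip V (u \<oplus>\<^bsub>V\<^esub> v) w = ip V u w + ip V v w"
    and ip_smult: "a \<in> K \<Longrightarrow> v \<in> carrier V \<Longrightarrow> w \<in> carrier V \<Longrightarrow>
          ip V (a \<odot>\<^bsub>V\<^esub> v) w = a * ip V v w"
    and ip_commute: "v \<in> carrier V \<Longrightarrow> w \<in> carrier V \<Longrightarrow> ip V v w = cnj (ip V w v)"
    and ip_pos: "v \<in> carrier V \<Longrightarrow> v \<noteq> \<zero>\<^bsub>V\<^esub> \<Longrightarrow> Re (ip V v v) > 0"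
    and complete: "(\<And>n. \<sigma> n \<in> carrier V) \<Longrightarrow>
          (\<And>\<epsilon>. \<epsilon> > 0 \<Longrightarrow>
             \<exists>N. \<forall>m\<ge>N. \<forall>n\<ge>N. hnorm V ((\<sigma> :: nat \<Rightarrow> 'h) m \<ominus>\<^bsub>V\<^esub> \<sigma> n) < \<epsilon>) \<Longrightarrow>
          \<exists>v\<in>carrier V. (\<lambda>n. hnorm V (\<sigma> n \<ominus>\<^bsub>V\<^esub> v)) \<longlonglongrightarrow> 0"
    and separable: "\<exists>D. countable D \<and> D \<subseteq> carrier V \<and>
          (\<forall>v\<in>carrier V. \<forall>\<epsilon>>0. \<exists>d\<in>D. hnorm V (v \<ominus>\<^bsub>V\<^esub> d) < \<epsilon>)"

definition hilbert_iso :: "complex set \<Rightarrow> 'h hilbert \<Rightarrow> 'h hilbert \<Rightarrow> ('h \<Rightarrow> 'h) \<Rightarrow> bool" where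
  "hilbert_iso K V W T \<longleftrightarrow>
     bij_betw T (carrier V) (carrier W) \<and>
     (\<forall>v\<in>carrier V. \<forall>w\<in>carrier V. T (v \<oplus>\<^bsub>V\<^esub> w) = T v \<oplus>\<^bsub>W\<^esub> T w) \<and>
     (\<forall>a\<in>K. \<forall>v\<in>carrier V. T (a \<odot>\<^bsub>V\<^esub> v) = a \<odot>\<^bsub>W\<^esub> T v) \<and>
     (\<forall>v\<in>carrier V. \<forall>w\<in>carrier V. ip W (T v) (T w) = ip V v w)"

text \<open>A Borel field of Hilbert spaces is a family \<open>H\<close> of Hilbert spaces with a fundamental sequence
  \<open>e\<close> of sections: their mutual inner products are Borel, and in each fibre they are total, i.e.
  their linear combinations are dense. The Borel sections are those having Borel inner products
  with all \<open>e n\<close>. The pullback of a bundle by \<open>f\<close> is given by \<open>H \<circ> f\<close> and \<open>\<lambda>n. e n \<circ> f\<close>.\<close>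

definition borel_section ::
    "'x measure \<Rightarrow> ('x \<Rightarrow> 'h hilbert) \<Rightarrow> (nat \<Rightarrow> 'x \<Rightarrow> 'h) \<Rightarrow> ('x \<Rightarrow> 'h) \<Rightarrow> bool" where
  "borel_section X H e \<xi> \<longleftrightarrow>
     (\<forall>x\<in>space X. \<xi> x \<in> carrier (H x)) \<and>
     (\<forall>n. (\<lambda>x. ip (H x) (\<xi> x) (e n x)) \<in> borel_measurable X)"

definition total_sequence :: "complex set \<Rightarrow> 'h hilbert \<Rightarrow> (nat \<Rightarrow> 'h) \<Rightarrow> bool" where
  "total_sequence K V a \<longleftrightarrow>
     (\<forall>v\<in>carrier V. \<forall>\<epsilon>>0. \<exists>N c. (\<forall>i<N. c i \<in> K) \<and>
        hnorm V (v \<ominus>\<^bsub>V\<^esub> (\<Oplus>\<^bsub>V\<^esub> i\<in>{..<N::nat}. c i \<odot>\<^bsub>V\<^esub> a i)) < \<epsilon>)"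

locale hilbert_bundle =
  fixes K :: "complex set" and X :: "'x measure"
    and H :: "'x \<Rightarrow> 'h hilbert" and e :: "nat \<Rightarrow> 'x \<Rightarrow> 'h"
  assumes fibre_hilbert: "x \<in> space X \<Longrightarrow> hilbert_space K (H x)"
    and fundamental_borel: "borel_section X H e (e n)"
    and fundamental_total: "x \<in> space X \<Longrightarrow> total_sequence K (H x) (\<lambda>n. e n x)"

section \<open>Representations and cocycles\<close>

text \<open>\<open>L\<close> is Borel iff it maps Borel sections to Borel sections; more precisely, for every Borel
  section \<open>\<xi>\<close> of the bundle, \<open>\<gamma> \<mapsto> L \<gamma> (\<xi> (src \<gamma>))\<close> is a Borel section of the pullback by the
  range map.\<close>

definition groupoid_representation ::
    "complex set \<Rightarrow> 'g groupoid \<Rightarrow> 'g measure set \<Rightarrow> ('g \<Rightarrow> 'h hilbert) \<Rightarrow> (nat \<Rightarrow> 'g \<Rightarrow> 'h)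
       \<Rightarrow> ('g \<Rightarrow> 'h \<Rightarrow> 'h) \<Rightarrow> bool" where
  "groupoid_representation K G C H e L \<longleftrightarrow>
     (\<forall>\<gamma>\<in>arrows G. hilbert_iso K (H (src G \<gamma>)) (H (rng G \<gamma>)) (L \<gamma>)) \<and>
     (\<forall>\<xi>. borel_section (unit_space G) H e \<xi> \<longrightarrow>
        borel_section (arr G) (H \<circ> rng G) (\<lambda>n. e n \<circ> rng G) (\<lambda>\<gamma>. L \<gamma> (\<xi> (src G \<gamma>)))) \<and>
     (\<exists>U. conull_units G C U \<and>
        (\<forall>\<gamma>1\<in>reduction G U. \<forall>\<gamma>2\<in>reduction G U. src G \<gamma>1 = rng G \<gamma>2 \<longrightarrow>
           (\<forall>v\<in>carrier (H (src G \<gamma>2)). L (mul G \<gamma>1 \<gamma>2) v = L \<gamma>1 (L \<gamma>2 v))))"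

definition cocycle ::
    "'g groupoid \<Rightarrow> 'g measure set \<Rightarrow> ('g \<Rightarrow> 'h hilbert) \<Rightarrow> (nat \<Rightarrow> 'g \<Rightarrow> 'h)
       \<Rightarrow> ('g \<Rightarrow> 'h \<Rightarrow> 'h) \<Rightarrow> ('g \<Rightarrow> 'h) \<Rightarrow> bool" where
  "cocycle G C H e L b \<longleftrightarrow>
     borel_section (arr G) (H \<circ> rng G) (\<lambda>n. e n \<circ> rng G) b \<and>
     (\<exists>U. conull_units G C U \<and>
        (\<forall>\<gamma>1\<in>reduction G U. \<forall>\<gamma>2\<in>reduction G U. src G \<gamma>1 = rng G \<gamma>2 \<longrightarrow>
           b (mul G \<gamma>1 \<gamma>2) = b \<gamma>1 \<oplus>\<^bsub>H (rng G \<gamma>1)\<^esub> L \<gamma>1 (b \<gamma>2)))"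

definition coboundary ::
    "'g groupoid \<Rightarrow> 'g measure set \<Rightarrow> ('g \<Rightarrow> 'h hilbert) \<Rightarrow> (nat \<Rightarrow> 'g \<Rightarrow> 'h)
       \<Rightarrow> ('g \<Rightarrow> 'h \<Rightarrow> 'h) \<Rightarrow> ('g \<Rightarrow> 'h) \<Rightarrow> bool" where
  "coboundary G C H e L b \<longleftrightarrow>
     (\<exists>\<xi>. borel_section (unit_space G) H e \<xi> \<and>
        (\<forall>\<nu>\<in>C. AE \<gamma> in \<nu>. b \<gamma> = \<xi> (rng G \<gamma>) \<ominus>\<^bsub>H (rng G \<gamma>)\<^esub> L \<gamma> (\<xi> (src G \<gamma>))))"

end

theory Submission
  imports Defs
begin

text \<open>If \<open>b\<close> is the coboundary of \<open>\<xi>\<close> almost everywhere, then it is so on a conull reduction, and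
  \<open>b\<close> is bounded on the reduction to a set on which \<open>\<parallel>\<xi>\<parallel>\<close> is bounded. Conversely, let \<open>b\<close> be bounded
  on each \<open>G\<^sup>x\<^sub>E\<close>, \<open>x \<in> E\<close>. By the cocycle identity, \<open>b\<close> is then bounded on \<open>G\<^sup>x\<^sub>E\<close> for every \<open>x\<close> that is
  joined to \<open>E\<close> by an arrow, and \<open>\<gamma>\<close> carries \<open>b (G\<^sup>s\<^sub>E)\<close> onto \<open>b (G\<^sup>r\<^sub>E)\<close> by the affine isometry
  \<open>v \<mapsto> b \<gamma> + L \<gamma> v\<close>. Hence the Chebyshev centers \<open>\<xi> x\<close> of \<open>b (G\<^sup>x\<^sub>E)\<close> satisfy
  \<open>\<xi> (rng \<gamma>) = b \<gamma> + L \<gamma> (\<xi> (src \<gamma>))\<close>. The units having a center form a set which is invariant only up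
  to an inessential reduction; Lusin's separation theorem supplies a strictly invariant Borel set, to
  which ergodicity applies.\<close>

section \<open>Presentations of standard Borel spaces and Lusin separation\<close>

text \<open>Ergodicity speaks of Borel sets invariant under every arrow, while everything here is
  known only on a conull set \<open>U\<close>: an arrow may leave \<open>U\<close>, and units of
  \<open>U\<close> may be linked through such arrows. Invariance modulo null sets is therefore not
  enough, and the saturation of a Borel set, an image under \<open>src G\<close>, need not be Borel.
  The way out is that the units of \<open>U\<close> from which arrows into \<open>E\<close> have
  positive measure and the remaining units of \<open>U\<close> are not joined by any arrow, since
  both its ends would lie in \<open>U\<close>; an invariant Borel set separating the two parts
  agrees on \<open>U\<close> with the first. The separation codes arrows by sequences of natural
  numbers, so that finitely many coordinates decide membership in each Borel set involved.

  The second obstacle is that the center has to be a Borel function of the unit, although it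
  minimizes over uncountably many vectors. Candidates and radii are restricted to countable
  families; near-minimizers still converge to the center, because the parallelogram identity forces
  them together.\<close>

definition agree :: "nat \<Rightarrow> (nat \<Rightarrow> nat) \<Rightarrow> (nat \<Rightarrow> nat) \<Rightarrow> bool" where
  "agree n z w \<longleftrightarrow> (\<forall>i<n. z i = w i)"

lemma agree_refl: "agree n z z"
  and agree_sym: "agree n z w \<Longrightarrow> agree n w z"
  and agree_trans: "agree n z w \<Longrightarrow> agree n w u \<Longrightarrow> agree n z u"
  and agree_mono: "agree n z w \<Longrightarrow> m \<le> n \<Longrightarrow> agree m z w"
  and agreeD: "agree n z w \<Longrightarrow> i < n \<Longrightarrow> z i = w i"
  by (auto simp: agree_def)

text \<open>Closedness in Baire space: the sets \<open>{w. agree n z w}\<close> are the basic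
  neighbourhoods of \<open>z\<close>.\<close>

definition baire_closed :: "(nat \<Rightarrow> nat) set \<Rightarrow> bool" where
  "baire_closed D \<longleftrightarrow> (\<forall>z. (\<forall>n. \<exists>w\<in>D. agree n z w) \<longrightarrow> z \<in> D)"

text \<open>Relative openness in \<open>D\<close> of the part of \<open>D\<close> that
  \<open>h\<close> maps into \<open>W\<close>; required for all open \<open>W\<close>, it is
  continuity of \<open>h\<close> on \<open>D\<close>.\<close>

definition open_preimage :: "(nat \<Rightarrow> nat) set \<Rightarrow> ((nat \<Rightarrow> nat) \<Rightarrow> 'a) \<Rightarrow> 'a set \<Rightarrow> bool" where
  "open_preimage D h W \<longleftrightarrow> (\<forall>z\<in>D. h z \<in> W \<longrightarrow> (\<exists>n. \<forall>w\<in>D. agree n z w \<longrightarrow> h w \<in> W))"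

definition clopen_preimage :: "(nat \<Rightarrow> nat) set \<Rightarrow> ((nat \<Rightarrow> nat) \<Rightarrow> 'a) \<Rightarrow> 'a set \<Rightarrow> bool" where
  "clopen_preimage D h W \<longleftrightarrow> open_preimage D h W \<and> open_preimage D h (- W)"

definition presentation :: "'a topology \<Rightarrow> (nat \<Rightarrow> nat) set \<Rightarrow> ((nat \<Rightarrow> nat) \<Rightarrow> 'a) \<Rightarrow> bool" where
  "presentation T D h \<longleftrightarrow> baire_closed D \<and> h ` D = topspace T \<and>
     (\<forall>V. openin T V \<longrightarrow> open_preimage D h V)"

lemma open_preimageD:
  "open_preimage D h W \<Longrightarrow> z \<in> D \<Longrightarrow> h z \<in> W \<Longrightarrow> \<exists>n. \<forall>w\<in>D. agree n z w \<longrightarrow> h w \<in> W"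
  by (auto simp: open_preimage_def)

lemma clopen_preimageD:
  assumes "clopen_preimage D h W" "z \<in> D"
  shows "\<exists>n. \<forall>w\<in>D. agree n z w \<longrightarrow> (h w \<in> W \<longleftrightarrow> h z \<in> W)"
proof (cases "h z \<in> W")
  case True
  then show ?thesis
    using open_preimageD[of D h W z] assms by (auto simp: clopen_preimage_def)
next
  case False
  then show ?thesis
    using open_preimageD[of D h "- W" z] assms by (auto simp: clopen_preimage_def)
qed

lemma open_preimage_comp:
  assumes W: "open_preimage D h W" and g: "\<And>z. z \<in> D' \<Longrightarrow> g z \<in> D"
    and cont: "\<And>n. \<exists>m. \<forall>z w. agree m z w \<longrightarrow> agree n (g z) (g w)"
  shows "open_preimage D' (\<lambda>z. h (g z)) W"
  unfolding open_preimage_def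
proof (intro ballI impI)
  fix z assume "z \<in> D'" "h (g z) \<in> W"
  then obtain n where n: "\<forall>w\<in>D. agree n (g z) w \<longrightarrow> h w \<in> W"
    using open_preimageD[OF W g] by blast
  obtain m where "\<forall>z w. agree m z w \<longrightarrow> agree n (g z) (g w)" using cont by blast
  then show "\<exists>n. \<forall>w\<in>D'. agree n z w \<longrightarrow> h (g w) \<in> W" using n g by blast
qed

lemma open_preimage_cong:
  assumes "open_preimage D h W" "\<And>z. z \<in> D \<Longrightarrow> h' z = h z"
  shows "open_preimage D h' W"
  using assms by (auto simp: open_preimage_def)

text \<open>A point is coded by a sequence of indices into a dense sequence along which the
  distances decay like powers of 1/2. Coordinate \<open>m\<close> alone then fixes the point up to
  \<open>2 * (1/2)^m\<close>, which gives continuity; every point has a code by density.\<close>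

lemma (in Metric_space) ex_presentation:
  assumes compl: mcomplete and sep: "separable_space mtopology"
  shows "\<exists>D h. presentation mtopology D h"
proof (cases "M = {}")
  case True
  have "topspace mtopology = {}" using True topspace_mtopology by metis
  then have "presentation mtopology {} h" for h
    unfolding presentation_def baire_closed_def open_preimage_def by blast
  then show ?thesis by blast
next
  case False
  obtain S where S: "countable S" "S \<subseteq> M" "mtopology closure_of S = M"
    using sep by (auto simp: separable_space_def)
  have dense: "\<exists>s\<in>S. d s p < r" if "p \<in> M" "r > 0" for p r
  proof -
    have "p \<in> mtopology closure_of S" using that S by simp
    moreover have "p \<in> mball p r" "openin mtopology (mball p r)" using that by auto
    ultimately obtain s where "s \<in> S" "s \<in> mball p r"
      unfolding in_closure_of by blast
    then show ?thesis using commute by auto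
  qed
  have "S \<noteq> {}" using False dense[of _ 1] by fastforce
  define x where "x = from_nat_into S"
  have xS: "range x = S" using S(1) \<open>S \<noteq> {}\<close> by (simp add: x_def range_from_nat_into)
  then have xM: "x i \<in> M" for i using S(2) by auto
  define D where "D = {z. \<forall>m n. d (x (z m)) (x (z n)) \<le> (1/2)^m + (1/2)^n}"
  have lim: "\<exists>p\<in>M. \<forall>m. d (x (z m)) p \<le> (1/2)^m" if z: "z \<in> D" for z
  proof -
    have half: "\<exists>N. \<forall>n\<ge>N. (1/2::real)^n < e" if e: "e > 0" for e
    proof -
      obtain N where N: "(1/2::real)^N < e"
        using real_arch_pow_inv[OF e, of "1/2"] by auto
      have "(1/2::real)^n \<le> (1/2)^N" if "n \<ge> N" for n
        using that by (intro power_decreasing) auto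
      then show ?thesis using N by (meson order.strict_trans1)
    qed
    have "MCauchy (\<lambda>n. x (z n))"
      unfolding MCauchy_def
    proof (intro conjI allI impI)
      show "range (\<lambda>n. x (z n)) \<subseteq> M" using xM by auto
      fix e :: real assume "e > 0"
      then obtain N where N: "\<And>n. n \<ge> N \<Longrightarrow> (1/2::real)^n < e/2" using half[of "e/2"] by auto
      have "d (x (z n)) (x (z m)) < e" if "N \<le> n" "N \<le> m" for n m
        using N[OF that(1)] N[OF that(2)] z unfolding D_def
        by (smt (verit) field_sum_of_halves mem_Collect_eq)
      then show "\<exists>N. \<forall>n n'. N \<le> n \<longrightarrow> N \<le> n' \<longrightarrow> d (x (z n)) (x (z n')) < e" by blast
    qed
    then obtain p where p: "limitin mtopology (\<lambda>n. x (z n)) p sequentially"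
      using compl by (auto simp: mcomplete_def)
    then have pM: "p \<in> M" by (simp add: limitin_metric)
    have "d (x (z m)) p \<le> (1/2)^m" for m
    proof (rule field_le_epsilon)
      fix e :: real assume e: "e > 0"
      obtain N where N: "\<And>n. n \<ge> N \<Longrightarrow> (1/2::real)^n < e/2"
        using half[of "e/2"] e by auto
      obtain N' where N': "\<And>n. n \<ge> N' \<Longrightarrow> d (x (z n)) p < e/2"
        using p e unfolding limit_metric_sequentially by (meson half_gt_zero)
      define n where "n = max N N'"
      have "d (x (z m)) p \<le> d (x (z m)) (x (z n)) + d (x (z n)) p"
        by (rule triangle[OF xM xM pM])
      also have "\<dots> \<le> ((1/2)^m + (1/2)^n) + e/2"
        using z N'[of n] by (intro add_mono) (auto simp: D_def n_def)
      also have "\<dots> \<le> (1/2)^m + e" using N[of n] by (simp add: n_def)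
      finally show "d (x (z m)) p \<le> (1/2)^m + e" .
    qed
    then show ?thesis using pM by blast
  qed
  define h where "h z = (SOME p. p \<in> M \<and> (\<forall>m. d (x (z m)) p \<le> (1/2)^m))" for z
  have h: "h z \<in> M" "d (x (z m)) (h z) \<le> (1/2)^m" if "z \<in> D" for z m
    using someI_ex[of "\<lambda>p. p \<in> M \<and> (\<forall>m. d (x (z m)) p \<le> (1/2)^m)"] lim[OF that]
    unfolding h_def[symmetric] by auto
  have close: "d (h z) (h w) \<le> 2 * (1/2)^m" if "z \<in> D" "w \<in> D" "z m = w m" for z w m
  proof -
    have "d (h z) (h w) \<le> d (h z) (x (z m)) + d (x (z m)) (h w)"
      by (intro triangle h that xM)
    then show ?thesis using h(2)[OF that(1), of m] h(2)[OF that(2), of m] that(3)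
      by (simp add: commute)
  qed
  have small: "\<exists>m. 2 * (1/2::real)^m < r" if "r > 0" for r
    using real_arch_pow_inv[of "r/2" "1/2"] that by (auto simp: field_simps)
  have "baire_closed D"
    unfolding baire_closed_def
  proof (intro allI impI)
    fix z assume *: "\<forall>n. \<exists>w\<in>D. agree n z w"
    have "d (x (z m)) (x (z n)) \<le> (1/2)^m + (1/2)^n" for m n
    proof -
      obtain w where "w \<in> D" "agree (Suc (max m n)) z w" using * by blast
      then show ?thesis using agreeD[of "Suc (max m n)" z w m] agreeD[of "Suc (max m n)" z w n]
        by (auto simp: D_def)
    qed
    then show "z \<in> D" by (simp add: D_def)
  qed
  moreover have "h ` D = M"
  proof
    show "h ` D \<subseteq> M" using h by auto
    show "M \<subseteq> h ` D"
    proof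
      fix p assume p: "p \<in> M"
      have "\<exists>i. d (x i) p < (1/2)^n" for n
        using dense[OF p, of "(1/2)^n"] xS by force
      then obtain z where z: "\<And>n. d (x (z n)) p < (1/2)^n" by metis
      have zD: "z \<in> D"
        unfolding D_def
      proof (intro CollectI allI)
        fix m n
        have "d (x (z m)) (x (z n)) \<le> d (x (z m)) p + d p (x (z n))"
          by (intro triangle xM p)
        then show "d (x (z m)) (x (z n)) \<le> (1/2)^m + (1/2)^n"
          using z[of m] z[of n] by (simp add: commute)
      qed
      have "d (h z) p \<le> 0"
      proof (rule field_le_epsilon)
        fix r :: real assume "r > 0"
        then obtain m where m: "2 * (1/2::real)^m < r" using small by blast
        have "d (h z) p \<le> d (h z) (x (z m)) + d (x (z m)) p" by (intro triangle xM p h zD)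
        then show "d (h z) p \<le> 0 + r" using h(2)[OF zD, of m] z[of m] m by (simp add: commute)
      qed
      then have "h z = p" using h(1)[OF zD] p nonneg[of "h z" p] by auto
      then show "p \<in> h ` D" using zD by blast
    qed
  qed
  moreover have "open_preimage D h V" if V: "openin mtopology V" for V
    unfolding open_preimage_def
  proof (intro ballI impI)
    fix z assume zD: "z \<in> D" and "h z \<in> V"
    then obtain r where r: "r > 0" "mball (h z) r \<subseteq> V"
      using V by (meson openin_mtopology)
    obtain m where m: "2 * (1/2::real)^m < r" using small[OF r(1)] by blast
    have "h w \<in> V" if "w \<in> D" "agree (Suc m) z w" for w
    proof -
      have "d (h z) (h w) < r"
        using close[OF zD that(1), of m] agreeD[OF that(2)] m by force
      then show ?thesis using r(2) h(1) zD that(1) by (auto simp: subset_iff)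
    qed
    then show "\<exists>n. \<forall>w\<in>D. agree n z w \<longrightarrow> h w \<in> V" by blast
  qed
  ultimately show ?thesis by (auto simp: presentation_def)
qed

text \<open>An open preimage becomes clopen when the modulus of continuity is recorded in a new first
  coordinate.\<close>

lemma presentation_refine:
  assumes pres: "presentation T D h" and W: "open_preimage D h W"
  shows "\<exists>D' h'. presentation T D' h' \<and> clopen_preimage D' h' W"
proof -
  define P where "P n z \<longleftrightarrow> (\<forall>u\<in>D. agree n z u \<longrightarrow> h u \<in> W)" for n z
  have P_cong: "P m z \<longleftrightarrow> P m w" if "agree n z w" "m \<le> n" for m n z w
    using that unfolding P_def by (meson agree_mono agree_sym agree_trans)
  \<comment> \<open>\<open>Suc\<close> keeps the value 0 free for codes of points outside
    \<open>W\<close>. The least modulus is recorded because its being equal to a given number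
    depends on finitely many coordinates only.\<close>
  define code where "code z = (if h z \<in> W then Suc (LEAST n. P n z) else 0)" for z
  define tl where "tl z = (\<lambda>n. z (Suc n))" for z :: "nat \<Rightarrow> nat"
  have tl_agree: "agree n (tl z) (tl w)" if "agree (Suc n) z w" for n z w
    using that by (auto simp: agree_def tl_def)
  define D' where "D' = {z. tl z \<in> D \<and> z 0 = code (tl z)}"
  have closed: "baire_closed D" and hD: "h ` D = topspace T"
    and hV: "openin T V \<Longrightarrow> open_preimage D h V" for V
    using pres by (auto simp: presentation_def)
  have ex_P: "\<exists>n. P n z" if "z \<in> D" "h z \<in> W" for z
    using open_preimageD[OF W that] by (simp add: P_def)
  have "baire_closed D'"
    unfolding baire_closed_def
  proof (intro allI impI)
    fix z assume *: "\<forall>n. \<exists>w\<in>D'. agree n z w"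
    have "\<exists>w\<in>D. agree n (tl z) w" for n
      using * tl_agree unfolding D'_def by (metis (mono_tags, lifting) mem_Collect_eq)
    then have zD: "tl z \<in> D" using closed by (auto simp: baire_closed_def)
    have "z 0 = code (tl z)"
    proof (cases "z 0")
      case 0
      have "h (tl z) \<notin> W"
      proof
        assume "h (tl z) \<in> W"
        then obtain n where n: "P n (tl z)" using ex_P zD by blast
        obtain w where w: "w \<in> D'" "agree (Suc n) z w" using * by blast
        then have "h (tl w) \<in> W" using n tl_agree unfolding P_def D'_def by blast
        then show False using w 0 agreeD[OF w(2), of 0] by (auto simp: D'_def code_def)
      qed
      then show ?thesis using 0 by (simp add: code_def)
    next
      case (Suc m)
      \<comment> \<open>The \<open>Suc m\<close> coordinates are the new one and the first
        \<open>m\<close> of the tail. The latter decide \<open>P k\<close> for all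
        \<open>k \<le> m\<close>, hence also that \<open>m\<close> is the least such number.\<close>
      obtain w where w: "w \<in> D'" "agree (Suc m) z w" using * by blast
      then have w0: "code (tl w) = Suc m" using Suc agreeD[OF w(2), of 0] by (auto simp: D'_def)
      have twD: "tl w \<in> D" using w by (simp add: D'_def)
      have tw: "h (tl w) \<in> W" "(LEAST n. P n (tl w)) = m"
        using w0 by (auto simp: code_def split: if_splits)
      have Pc: "P k (tl z) \<longleftrightarrow> P k (tl w)" if "k \<le> m" for k
        using P_cong[OF tl_agree[OF w(2)] that] .
      have Pm: "P m (tl w)" using LeastI_ex[OF ex_P[OF twD tw(1)]] tw(2) by simp
      then have Pz: "P m (tl z)" using Pc by simp
      then have "h (tl z) \<in> W" using zD agree_refl unfolding P_def by blast
      moreover have "(LEAST n. P n (tl z)) = m"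
      proof (rule Least_equality)
        show "P m (tl z)" by (rule Pz)
      next
        fix k assume k: "P k (tl z)"
        show "m \<le> k"
        proof (rule ccontr)
          assume "\<not> m \<le> k"
          then have "P k (tl w)" using Pc k by simp
          then show False using tw(2) \<open>\<not> m \<le> k\<close> Least_le[of "\<lambda>n. P n (tl w)" k] by simp
        qed
      qed
      ultimately show ?thesis using Suc by (simp add: code_def)
    qed
    then show "z \<in> D'" using zD by (simp add: D'_def)
  qed
  moreover have "(\<lambda>z. h (tl z)) ` D' = topspace T"
  proof -
    have "h z \<in> (\<lambda>z. h (tl z)) ` D'" if "z \<in> D" for z
    proof (rule image_eqI)
      show "h z = h (tl (case_nat (code z) z))" by (simp add: tl_def)
      show "case_nat (code z) z \<in> D'" using that by (simp add: D'_def tl_def)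
    qed
    then have "h ` D \<subseteq> (\<lambda>z. h (tl z)) ` D'" by blast
    then show ?thesis using hD by (auto simp: D'_def)
  qed
  moreover have "open_preimage D' (\<lambda>z. h (tl z)) V" if "openin T V" for V
    by (rule open_preimage_comp[OF hV[OF that]]) (use tl_agree in \<open>auto simp: D'_def\<close>)
  moreover have "clopen_preimage D' (\<lambda>z. h (tl z)) W"
  proof -
    have *: "h (tl z) \<in> W \<longleftrightarrow> z 0 \<noteq> 0" if "z \<in> D'" for z
      using that by (auto simp: D'_def code_def split: if_splits)
    have "(h (tl w) \<in> W) = (h (tl z) \<in> W)" if "z \<in> D'" "w \<in> D'" "agree (Suc 0) z w" for z w
      using *[OF that(1)] *[OF that(2)] agreeD[OF that(3), of 0] by simp
    then show ?thesis unfolding clopen_preimage_def open_preimage_def by blast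
  qed
  ultimately show ?thesis unfolding presentation_def by blast
qed

text \<open>A code is a double sequence whose rows are codes of one common point, row
  \<open>k\<close> in presentation number \<open>k\<close>. Looking at row \<open>k\<close> shows
  that \<open>B k\<close> is clopen; that equality of the coded points is a closed condition is due
  to the Hausdorff property.\<close>

lemma presentation_joint:
  assumes haus: "Hausdorff_space T"
    and pres: "\<And>k. presentation T (Dk k) (hk k)"
    and B: "\<And>k. clopen_preimage (Dk k) (hk k) (B k)"
  shows "\<exists>D h. presentation T D h \<and> (\<forall>k::nat. clopen_preimage D h (B k))"
proof -
  define row where "row k z = (\<lambda>n. z (prod_encode (k, n)))" for k and z :: "nat \<Rightarrow> nat"
  have row_agree: "\<exists>m. \<forall>z w. agree m z w \<longrightarrow> agree n (row k z) (row k w)" for k n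
  proof -
    have "\<exists>m. \<forall>i<n. prod_encode (k, i) < m"
      using finite_nat_set_iff_bounded[of "(\<lambda>i. prod_encode (k, i)) ` {..<n}"] by auto
    then obtain m where "\<forall>i<n. prod_encode (k, i) < m" ..
    then show ?thesis by (intro exI[of _ m]) (auto simp: agree_def row_def)
  qed
  have closed: "baire_closed (Dk k)" and hD: "hk k ` Dk k = topspace T"
    and hV: "openin T V \<Longrightarrow> open_preimage (Dk k) (hk k) V" for k V
    using pres[of k] by (auto simp: presentation_def)
  define D where "D = {z. \<forall>k. row k z \<in> Dk k \<and> hk k (row k z) = hk 0 (row 0 z)}"
  define h where "h z = hk 0 (row 0 z)" for z
  have "baire_closed D"
    unfolding baire_closed_def
  proof (intro allI impI)
    fix z assume *: "\<forall>n. \<exists>w\<in>D. agree n z w"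
    have zD: "row k z \<in> Dk k" for k
    proof -
      have "\<exists>w\<in>Dk k. agree n (row k z) w" for n
      proof -
        obtain m where "\<forall>z w. agree m z w \<longrightarrow> agree n (row k z) (row k w)"
          using row_agree by blast
        moreover obtain w where "w \<in> D" "agree m z w" using * by blast
        ultimately show ?thesis unfolding D_def by blast
      qed
      then show ?thesis using closed by (auto simp: baire_closed_def)
    qed
    have "hk k (row k z) = hk 0 (row 0 z)" for k
    proof (rule ccontr)
      \<comment> \<open>Disjoint neighbourhoods of the two values would serve for all nearby codes
        as well, but a nearby code in \<open>D\<close> has equal values in both rows.\<close>
      assume neq: "hk k (row k z) \<noteq> hk 0 (row 0 z)"
      have "hk k (row k z) \<in> topspace T" "hk 0 (row 0 z) \<in> topspace T"
        using zD hD by blast+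
      then obtain U V where UV: "openin T U" "openin T V" "hk k (row k z) \<in> U"
        "hk 0 (row 0 z) \<in> V" "disjnt U V"
        using haus neq unfolding Hausdorff_space_def by metis
      obtain n1 where n1: "\<forall>w\<in>Dk k. agree n1 (row k z) w \<longrightarrow> hk k w \<in> U"
        using open_preimageD[of "Dk k" "hk k" U "row k z"] hV[OF UV(1)] zD UV(3) by blast
      obtain n2 where n2: "\<forall>w\<in>Dk 0. agree n2 (row 0 z) w \<longrightarrow> hk 0 w \<in> V"
        using open_preimageD[of "Dk 0" "hk 0" V "row 0 z"] hV[OF UV(2)] zD UV(4) by blast
      obtain m1 where m1: "\<forall>z w. agree m1 z w \<longrightarrow> agree n1 (row k z) (row k w)"
        using row_agree by blast
      obtain m2 where m2: "\<forall>z w. agree m2 z w \<longrightarrow> agree n2 (row 0 z) (row 0 w)"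
        using row_agree by blast
      obtain w where w: "w \<in> D" "agree (max m1 m2) z w" using * by blast
      then have "agree m1 z w" "agree m2 z w" by (auto intro: agree_mono)
      then have "hk k (row k w) \<in> U" "hk 0 (row 0 w) \<in> V"
        using n1 n2 m1 m2 w(1) unfolding D_def by blast+
      moreover have "hk k (row k w) = hk 0 (row 0 w)" using w(1) unfolding D_def by blast
      ultimately show False using UV(5) unfolding disjnt_iff by metis
    qed
    then show "z \<in> D" using zD by (simp add: D_def)
  qed
  moreover have "h ` D = topspace T"
  proof
    show "h ` D \<subseteq> topspace T" using hD[of 0] by (auto simp: D_def h_def)
    show "topspace T \<subseteq> h ` D"
    proof
      fix p assume p: "p \<in> topspace T"
      then have "\<forall>k. \<exists>z\<in>Dk k. hk k z = p" using hD by (metis imageE)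
      then obtain zk where zk: "\<And>k. zk k \<in> Dk k \<and> hk k (zk k) = p" by metis
      define z where "z i = (case prod_decode i of (k, n) \<Rightarrow> zk k n)" for i
      have "row k z = zk k" for k by (auto simp: row_def z_def)
      then show "p \<in> h ` D" using zk by (auto simp: D_def h_def intro!: image_eqI[of _ _ z])
    qed
  qed
  moreover have lift: "open_preimage D h V" if "open_preimage (Dk k) (hk k) V" for k V
  proof (rule open_preimage_cong)
    show "open_preimage D (\<lambda>z. hk k (row k z)) V"
      by (rule open_preimage_comp[OF that _ row_agree]) (simp add: D_def)
    show "h z = hk k (row k z)" if "z \<in> D" for z using that unfolding D_def h_def by (metis (mono_tags, lifting) mem_Collect_eq)
  qed
  moreover have "clopen_preimage D h (B k)" for k
    using B[of k] lift by (auto simp: clopen_preimage_def)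
  ultimately show ?thesis using hV[of _ 0] unfolding presentation_def by blast
qed

text \<open>The sets that become clopen in some presentation form a sigma-algebra: for a countable
  union, one presentation serves all its members, the union is then open, and refining makes it
  clopen.\<close>

lemma borel_presentable:
  assumes haus: "Hausdorff_space T" and base: "presentation T D0 h0"
    and "B \<in> sigma_sets (topspace T) {U. openin T U}"
  shows "\<exists>D h. presentation T D h \<and> clopen_preimage D h B"
  using assms(3)
proof induction
  case (Basic a)
  then show ?case using presentation_refine[OF base, of a] base by (auto simp: presentation_def)
next
  case Empty
  then show ?case using base by (auto simp: clopen_preimage_def open_preimage_def)
next
  case (Compl a)
  then obtain D h where Dh: "presentation T D h" "clopen_preimage D h a" by blast
  have "h z \<in> topspace T" if "z \<in> D" for z using that Dh(1) by (auto simp: presentation_def)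
  then have "clopen_preimage D h (topspace T - a)"
    using Dh(2) by (auto simp: clopen_preimage_def open_preimage_def)
  then show ?case using Dh(1) by blast
next
  case (Union a)
  then obtain Dk hk where
    "\<And>i. presentation T (Dk i) (hk i) \<and> clopen_preimage (Dk i) (hk i) (a i)" by metis
  then obtain D h where Dh: "presentation T D h" "\<And>k. clopen_preimage D h (a k)"
    using presentation_joint[OF haus, of Dk hk a] by blast
  have "open_preimage D h (\<Union>k. a k)"
    unfolding open_preimage_def
  proof (intro ballI impI)
    fix z assume z: "z \<in> D" "h z \<in> (\<Union>k. a k)"
    then obtain k where k: "h z \<in> a k" by blast
    then obtain n where "\<forall>w\<in>D. agree n z w \<longrightarrow> h w \<in> a k"
      using clopen_preimageD[OF Dh(2)[of k] z(1)] by blast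
    then show "\<exists>n. \<forall>w\<in>D. agree n z w \<longrightarrow> h w \<in> (\<Union>k. a k)" by blast
  qed
  then show ?case using presentation_refine[OF Dh(1)] by blast
qed

text \<open>A whole sequence is served at once, so any countable amount of Borel data may be assumed
  clopen.\<close>

lemma standard_borel_presentation:
  assumes "standard_borel M" and "\<And>k::nat. B k \<in> sets M"
  shows "\<exists>D h. baire_closed D \<and> h ` D = space M \<and> (\<forall>k. clopen_preimage D h (B k))"
proof -
  obtain T where T: "completely_metrizable_space T" "second_countable T" "topspace T = space M"
      "sets M = sigma_sets (topspace T) {U. openin T U}"
    using assms(1) by (auto simp: standard_borel_def)
  then obtain X d where X: "Metric_space X d" "Metric_space.mcomplete X d"
      "T = Metric_space.mtopology X d"
    by (auto simp: completely_metrizable_space_def)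
  obtain D0 h0 where base: "presentation T D0 h0"
    using Metric_space.ex_presentation[OF X(1,2)] X(3) second_countable_imp_separable_space[OF T(2)]
    by blast
  have haus: "Hausdorff_space T" using Metric_space.Hausdorff_space_mtopology X by blast
  have "\<forall>k. \<exists>D h. presentation T D h \<and> clopen_preimage D h (B k)"
    using borel_presentable[OF haus base] assms(2) T(4) by blast
  then obtain Dk hk where
    "\<And>i. presentation T (Dk i) (hk i) \<and> clopen_preimage (Dk i) (hk i) (B i)" by metis
  then obtain D h where "presentation T D h" "\<And>k. clopen_preimage D h (B k)"
    using presentation_joint[OF haus, of Dk hk B] by blast
  then show ?thesis using T(3) by (auto simp: presentation_def)
qed

section \<open>Separating sequences of Borel sets and Borel equalizers\<close>

lemma standard_borel_separating:
  assumes "standard_borel M"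
  shows "\<exists>V::nat \<Rightarrow> 'a set. (\<forall>k. V k \<in> sets M) \<and>
           (\<forall>x\<in>space M. \<forall>y\<in>space M. x \<noteq> y \<longrightarrow> (\<exists>k. x \<in> V k \<longleftrightarrow> y \<notin> V k))"
proof -
  obtain T where T: "completely_metrizable_space T" "second_countable T" "topspace T = space M"
      "sets M = sigma_sets (topspace T) {U. openin T U}"
    using assms(1) by (auto simp: standard_borel_def)
  then have haus: "Hausdorff_space T"
    using completely_metrizable_imp_metrizable_space metrizable_imp_Hausdorff_space by blast
  obtain \<B> where \<B>: "countable \<B>" "\<forall>V\<in>\<B>. openin T V"
      "\<forall>U x. openin T U \<and> x \<in> U \<longrightarrow> (\<exists>V\<in>\<B>. x \<in> V \<and> V \<subseteq> U)"
    using T(2) by (auto simp: second_countable_def)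
  \<comment> \<open>\<open>insert {}\<close> makes the enumerated set nonempty, which its
    enumeration by \<open>from_nat_into\<close> requires.\<close>
  define V where "V = from_nat_into (insert {} \<B>)"
  have rV: "range V = insert {} \<B>" using \<B>(1) by (simp add: V_def range_from_nat_into)
  then have "openin T (V k)" for k using \<B>(2) by (metis insertE openin_empty rangeI)
  then have "V k \<in> sets M" for k unfolding T(4) by (blast intro: sigma_sets.Basic)
  moreover have "\<exists>k. x \<in> V k \<longleftrightarrow> y \<notin> V k" if xy: "x \<in> space M" "y \<in> space M" "x \<noteq> y" for x y
  proof -
    obtain U1 U2 where U: "openin T U1" "openin T U2" "x \<in> U1" "y \<in> U2" "disjnt U1 U2"
      using haus xy unfolding Hausdorff_space_def T(3) by metis
    obtain W where W: "W \<in> \<B>" "x \<in> W" "W \<subseteq> U1" using \<B>(3) U(1,3) by blast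
    have "y \<notin> W" using W U by (auto simp: disjnt_iff)
    moreover obtain k where "W = V k" using rV W(1) by (metis imageE insertI2)
    ultimately show ?thesis using W(2) by blast
  qed
  ultimately show ?thesis by blast
qed

text \<open>Countably many Borel sets decide whether two points are equal. This is why the unit
  space and the fibres of the range map are Borel.\<close>

lemma standard_borel_equalizer:
  assumes N: "standard_borel N" and f: "f \<in> M \<rightarrow>\<^sub>M N" and g: "g \<in> M \<rightarrow>\<^sub>M N"
  shows "{x \<in> space M. f x = g x} \<in> sets M"
proof -
  obtain V where V: "\<And>k::nat. V k \<in> sets N"
    "\<And>x y. x \<in> space N \<Longrightarrow> y \<in> space N \<Longrightarrow> x \<noteq> y \<Longrightarrow> \<exists>k. x \<in> V k \<longleftrightarrow> y \<notin> V k"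
    using standard_borel_separating[OF N] by blast
  have "f x = g x \<longleftrightarrow> (\<forall>k. f x \<in> V k \<longleftrightarrow> g x \<in> V k)" if "x \<in> space M" for x
    using V(2) measurable_space[OF f that] measurable_space[OF g that] by metis
  then have "{x \<in> space M. f x = g x} = {x \<in> space M. \<forall>k. f x \<in> V k \<longleftrightarrow> g x \<in> V k}" by blast
  also have "\<dots> \<in> sets M" using f g V(1) by measurable
  finally show ?thesis .
qed

section \<open>Lusin's separation theorem\<close>

definition separable_in :: "'b measure \<Rightarrow> 'b set \<Rightarrow> 'b set \<Rightarrow> bool" where
  "separable_in N A B \<longleftrightarrow> (\<exists>W\<in>sets N. A \<subseteq> W \<and> W \<inter> B = {})"

text \<open>With \<open>W i j\<close> separating \<open>A i\<close> from \<open>B j\<close>, the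
  union over \<open>i\<close> of the intersections over \<open>j\<close> separates the unions. It is
  applied in contraposition: inseparable unions contain an inseparable pair of pieces.\<close>

lemma separable_in_UN:
  assumes "\<And>i j. separable_in N (A i) (B j)"
  shows "separable_in N (\<Union>i::nat. A i) (\<Union>j::nat. B j)"
proof -
  obtain W where W: "\<And>i j. W i j \<in> sets N" "\<And>i j. A i \<subseteq> W i j" "\<And>i j. W i j \<inter> B j = {}"
    using assms unfolding separable_in_def by metis
  show ?thesis unfolding separable_in_def
  proof (intro bexI conjI)
    show "(\<Union>i. \<Inter>j. W i j) \<in> sets N" using W(1) by (intro sets.countable_UN sets.countable_INT) auto
    show "(\<Union>i. A i) \<subseteq> (\<Union>i. \<Inter>j. W i j)" using W(2) by blast
    show "(\<Union>i. \<Inter>j. W i j) \<inter> (\<Union>j. B j) = {}" using W(3) by blast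
  qed
qed

text \<open>Inseparability is passed down to ever smaller cylinders of codes, ending at one code of
  a point of \<open>P\<close> and one of a point of \<open>Q\<close>. Their images under
  \<open>f\<close> differ, hence are told apart by a Borel set with clopen preimage, so that finite
  cylinders around the two codes are separable after all.\<close>

theorem Lusin_separation:
  assumes M: "standard_borel M" and N: "standard_borel N"
    and f: "f \<in> M \<rightarrow>\<^sub>M N" and P: "P \<in> sets M" and Q: "Q \<in> sets M"
    and disj: "f ` P \<inter> f ` Q = {}"
  shows "\<exists>W\<in>sets N. f ` P \<subseteq> W \<and> W \<inter> f ` Q = {}"
proof (rule ccontr)
  assume "\<not> ?thesis"
  then have unsep: "\<not> separable_in N (f ` P) (f ` Q)" by (simp add: separable_in_def)
  obtain V where V: "\<And>k. V k \<in> sets N"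
    "\<And>x y. x \<in> space N \<Longrightarrow> y \<in> space N \<Longrightarrow> x \<noteq> y \<Longrightarrow> \<exists>k::nat. x \<in> V k \<longleftrightarrow> y \<notin> V k"
    using standard_borel_separating[OF N] by blast
  \<comment> \<open>\<open>P\<close> and \<open>Q\<close> become clopen to keep membership in the
    limit, the preimages of the separating sets to make \<open>f\<close> continuous with respect to
    them.\<close>
  define B where "B k = (case k of 0 \<Rightarrow> P | Suc 0 \<Rightarrow> Q | Suc (Suc k) \<Rightarrow> f -` V k \<inter> space M)" for k
  have "B k \<in> sets M" for k
    using P Q measurable_sets[OF f V(1)] by (auto simp: B_def split: nat.split)
  then obtain D h where D: "baire_closed D" and hD: "h ` D = space M"
      and B: "\<And>k. clopen_preimage D h (B k)"
    using standard_borel_presentation[OF M, of B] by blast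
  have hP: "clopen_preimage D h P" and hQ: "clopen_preimage D h Q"
    using B[of 0] B[of "Suc 0"] by (auto simp: B_def)
  have hM: "h z \<in> space M" if "z \<in> D" for z using that hD by blast
  define S where "S X n z = f ` (h ` {w \<in> D. agree n z w} \<inter> X)" for X n z
  have S_split: "S X n z = (\<Union>i. S X (Suc n) (z(n := i)))" for X n z
  proof -
    have "agree n z w \<longleftrightarrow> (\<exists>i. agree (Suc n) (z(n := i)) w)" for w
      by (auto simp: agree_def less_Suc_eq)
    then show ?thesis by (fastforce simp: S_def)
  qed
  define U where "U n p \<longleftrightarrow> \<not> separable_in N (S P n (fst p)) (S Q n (snd p))"
    for n and p :: "(nat \<Rightarrow> nat) \<times> (nat \<Rightarrow> nat)"
  have S0: "S X 0 z = f ` X" if "X \<subseteq> space M" for X z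
    using that hD by (auto simp: S_def agree_def)
  have "U 0 p" for p
    using unsep S0[OF sets.sets_into_space[OF P]] S0[OF sets.sets_into_space[OF Q]]
    by (simp add: U_def)
  moreover have "\<exists>q. U (Suc n) q \<and> agree n (fst p) (fst q) \<and> agree n (snd p) (snd q)"
    if "U n p" for n p
  proof -
    have "\<exists>i j. \<not> separable_in N (S P (Suc n) ((fst p)(n := i))) (S Q (Suc n) ((snd p)(n := j)))"
      using that separable_in_UN[of N "\<lambda>i. S P (Suc n) ((fst p)(n := i))"
          "\<lambda>j. S Q (Suc n) ((snd p)(n := j))"]
      unfolding U_def S_split[of _ n] by blast
    then obtain i j where
      "\<not> separable_in N (S P (Suc n) ((fst p)(n := i))) (S Q (Suc n) ((snd p)(n := j)))" by blast
    then show ?thesis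
      by (intro exI[of _ "((fst p)(n := i), (snd p)(n := j))"]) (auto simp: U_def agree_def)
  qed
  ultimately have "\<exists>p. \<forall>n. U n (p n) \<and>
      (agree n (fst (p n)) (fst (p (Suc n))) \<and> agree n (snd (p n)) (snd (p (Suc n))))"
    by (intro dependent_nat_choice[where P = U and Q = "\<lambda>n p q. agree n (fst p) (fst q) \<and>
      agree n (snd p) (snd q)"]) auto
  then obtain p where p: "\<And>n. U n (p n)" "\<And>n. agree n (fst (p n)) (fst (p (Suc n)))"
      "\<And>n. agree n (snd (p n)) (snd (p (Suc n)))" by blast
  have limit: "agree n (\<lambda>i. q (Suc i) i) (q n)"
    if q: "\<And>n. agree n (q n) (q (Suc n))" for n and q :: "nat \<Rightarrow> nat \<Rightarrow> nat"
  proof (induction n)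
    case (Suc n)
    then show ?case using q[of n] by (auto simp: agree_def less_Suc_eq)
  qed (simp add: agree_def)
  \<comment> \<open>Stage \<open>Suc i\<close> is the one that fixes coordinate \<open>i\<close>,
    and later stages keep it; the diagonal thus agrees with stage \<open>n\<close> on the first
    \<open>n\<close> coordinates.\<close>
  define z where "z i = fst (p (Suc i)) i" for i
  define w where "w i = snd (p (Suc i)) i" for i
  have agree_z: "agree n z (fst (p n))" and agree_w: "agree n w (snd (p n))" for n
    using limit[of "\<lambda>n. fst (p n)" n] limit[of "\<lambda>n. snd (p n)" n] p(2,3)
    by (simp_all add: z_def[abs_def] w_def[abs_def])
  have S_cong: "S X n y = S X n y'" if "agree n y y'" for X n y y'
    using that unfolding S_def by (metis agree_sym agree_trans)
  have unsep_n: "\<not> separable_in N (S P n z) (S Q n w)" for n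
    using p(1)[of n] S_cong[OF agree_z[of n]] S_cong[OF agree_w[of n]] by (simp add: U_def)
  \<comment> \<open>An empty piece is separated from every other, by the empty set or by the whole
    space.\<close>
  have ne: "S P n z \<noteq> {} \<and> S Q n w \<noteq> {}" for n
  proof -
    have "\<forall>x\<in>S P n z. x \<in> space N"
      using measurable_space[OF f] hM by (auto simp: S_def)
    then have "separable_in N (S P n z) (S Q n w)" if "S P n z = {} \<or> S Q n w = {}"
      using that unfolding separable_in_def by (metis Int_empty_left Int_empty_right empty_subsetI
          sets.empty_sets sets.top subsetI)
    then show ?thesis using unsep_n by blast
  qed
  \<comment> \<open>The nonempty pieces provide codes in \<open>D\<close> near \<open>y\<close> with
    values in \<open>X\<close>; closedness of \<open>D\<close> and clopenness of \<open>X\<close>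
    carry this over to \<open>y\<close> itself.\<close>
  have point: "y \<in> D \<and> h y \<in> X" if ne: "\<And>n. S X n y \<noteq> {}" and X: "clopen_preimage D h X" for X y
  proof -
    have near: "\<exists>u\<in>D. agree n y u \<and> h u \<in> X" for n using ne[of n] by (auto simp: S_def)
    then have yD: "y \<in> D" using D unfolding baire_closed_def by blast
    then show ?thesis using clopen_preimageD[OF X] near by blast
  qed
  have z: "z \<in> D \<and> h z \<in> P" and w: "w \<in> D \<and> h w \<in> Q"
    using point[of P z] point[of Q w] ne hP hQ by blast+
  then have "f (h z) \<noteq> f (h w)" using disj by blast
  moreover have "f (h z) \<in> space N" "f (h w) \<in> space N"
    using z w hM measurable_space[OF f] by blast+
  ultimately obtain k where k: "f (h z) \<in> V k \<longleftrightarrow> f (h w) \<notin> V k" using V(2) by blast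
  have mem: "h y \<in> B (Suc (Suc k)) \<longleftrightarrow> f (h y) \<in> V k" if "y \<in> D" for y
    using hM[OF that] by (auto simp: B_def)
  obtain n1 where n1: "\<And>u. u \<in> D \<Longrightarrow> agree n1 z u \<Longrightarrow> f (h u) \<in> V k \<longleftrightarrow> f (h z) \<in> V k"
    using clopen_preimageD[OF B[of "Suc (Suc k)"]] z mem by metis
  obtain n2 where n2: "\<And>u. u \<in> D \<Longrightarrow> agree n2 w u \<Longrightarrow> f (h u) \<in> V k \<longleftrightarrow> f (h w) \<in> V k"
    using clopen_preimageD[OF B[of "Suc (Suc k)"]] w mem by metis
  define n where "n = max n1 n2"
  have zn: "f (h u) \<in> V k \<longleftrightarrow> f (h z) \<in> V k" if "u \<in> D" "agree n z u" for u
    using that n1 agree_mono[of n z u n1] by (auto simp: n_def)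
  have wn: "f (h u) \<in> V k \<longleftrightarrow> f (h w) \<in> V k" if "u \<in> D" "agree n w u" for u
    using that n2 agree_mono[of n w u n2] by (auto simp: n_def)
  have "separable_in N (S P n z) (S Q n w)"
  proof (cases "f (h z) \<in> V k")
    case True
    then show ?thesis unfolding separable_in_def S_def
      by (intro bexI[of _ "V k"]) (use zn wn k V(1) in auto)
  next
    case False
    then show ?thesis unfolding separable_in_def S_def
      by (intro bexI[of _ "space N - V k"])
         (use zn wn k V(1) hM measurable_space[OF f] in auto)
  qed
  then show False using unsep_n by blast
qed

section \<open>Hilbert spaces and Chebyshev centers along a filter\<close>

context hilbert_space
begin

lemma scalar_ring_simps [simp]:
  "carrier (scalar_ring K) = K" "\<one>\<^bsub>scalar_ring K\<^esub> = 1" "\<zero>\<^bsub>scalar_ring K\<^esub> = 0"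
  "a \<oplus>\<^bsub>scalar_ring K\<^esub> b = a + b" "a \<otimes>\<^bsub>scalar_ring K\<^esub> b = a * b"
  by (simp_all add: scalar_ring_def)

lemma of_real_scalar [simp]: "of_real r \<in> K"
  using scalars by auto

lemma cnj_scalar: "a \<in> K \<Longrightarrow> cnj a \<in> K"
  using scalars by (auto simp: Reals_cnj_iff)

lemma diff_scalar: "a \<in> K \<Longrightarrow> b \<in> K \<Longrightarrow> a - b \<in> K"
  using scalars by auto

lemma smult_closed_K [simp]: "a \<in> K \<Longrightarrow> v \<in> carrier V \<Longrightarrow> a \<odot>\<^bsub>V\<^esub> v \<in> carrier V"
  using smult_closed by simp

lemma ip_zero_left [simp]: "w \<in> carrier V \<Longrightarrow> ip V \<zero>\<^bsub>V\<^esub> w = 0"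
  using ip_add[of "\<zero>\<^bsub>V\<^esub>" "\<zero>\<^bsub>V\<^esub>" w] by simp

lemma ip_minus_left: "v \<in> carrier V \<Longrightarrow> w \<in> carrier V \<Longrightarrow> ip V (\<ominus>\<^bsub>V\<^esub> v) w = - ip V v w"
  using ip_add[of v "\<ominus>\<^bsub>V\<^esub> v" w] by (simp add: M.r_neg eq_neg_iff_add_eq_0 add.commute)

lemma ip_diff_left:
  "u \<in> carrier V \<Longrightarrow> v \<in> carrier V \<Longrightarrow> w \<in> carrier V \<Longrightarrow>
    ip V (u \<ominus>\<^bsub>V\<^esub> v) w = ip V u w - ip V v w"
  by (simp add: a_minus_def ip_add ip_minus_left)

lemma ip_add_right:
  "u \<in> carrier V \<Longrightarrow> v \<in> carrier V \<Longrightarrow> w \<in> carrier V \<Longrightarrow>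
    ip V u (v \<oplus>\<^bsub>V\<^esub> w) = ip V u v + ip V u w"
  using ip_commute[of u "v \<oplus>\<^bsub>V\<^esub> w"] ip_commute[of u v] ip_commute[of u w]
  by (simp add: ip_add)

lemma ip_diff_right:
  "u \<in> carrier V \<Longrightarrow> v \<in> carrier V \<Longrightarrow> w \<in> carrier V \<Longrightarrow>
    ip V u (v \<ominus>\<^bsub>V\<^esub> w) = ip V u v - ip V u w"
  using ip_commute[of u "v \<ominus>\<^bsub>V\<^esub> w"] ip_commute[of u v] ip_commute[of u w]
  by (simp add: ip_diff_left)

lemma ip_smult_right:
  "a \<in> K \<Longrightarrow> v \<in> carrier V \<Longrightarrow> w \<in> carrier V \<Longrightarrow> ip V v (a \<odot>\<^bsub>V\<^esub> w) = cnj a * ip V v w"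
  using ip_commute[of v "a \<odot>\<^bsub>V\<^esub> w"] ip_commute[of v w] by (simp add: ip_smult)

lemma Re_ip_commute: "v \<in> carrier V \<Longrightarrow> w \<in> carrier V \<Longrightarrow> Re (ip V w v) = Re (ip V v w)"
  using ip_commute[of v w] by simp

lemma Re_ip_self: "v \<in> carrier V \<Longrightarrow> Re (ip V v v) = (hnorm V v)\<^sup>2"
  using ip_pos[of v] by (cases "v = \<zero>\<^bsub>V\<^esub>") (auto simp: hnorm_def)

lemma hnorm_nonneg: "v \<in> carrier V \<Longrightarrow> 0 \<le> hnorm V v"
  using ip_pos[of v] by (cases "v = \<zero>\<^bsub>V\<^esub>") (auto simp: hnorm_def)

lemma hnorm_zero [simp]: "hnorm V \<zero>\<^bsub>V\<^esub> = 0"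
  by (simp add: hnorm_def)

lemma hnorm_eq_0D: "v \<in> carrier V \<Longrightarrow> hnorm V v = 0 \<Longrightarrow> v = \<zero>\<^bsub>V\<^esub>"
  using ip_pos[of v] Re_ip_self[of v] by fastforce

lemma hnorm_smult:
  assumes "a \<in> K" "v \<in> carrier V"
  shows "hnorm V (a \<odot>\<^bsub>V\<^esub> v) = cmod a * hnorm V v"
proof -
  have "ip V (a \<odot>\<^bsub>V\<^esub> v) (a \<odot>\<^bsub>V\<^esub> v) = (a * cnj a) * ip V v v"
    using assms by (simp add: ip_smult ip_smult_right)
  then have "Re (ip V (a \<odot>\<^bsub>V\<^esub> v) (a \<odot>\<^bsub>V\<^esub> v)) = (cmod a)\<^sup>2 * (hnorm V v)\<^sup>2"
    using assms by (simp add: complex_mult_cnj cmod_power2 Re_ip_self[symmetric])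
  then show ?thesis
    using assms hnorm_nonneg[of v] by (simp add: hnorm_def[of V "a \<odot>\<^bsub>V\<^esub> v"] real_sqrt_mult)
qed

lemma hnorm_diff_sq:
  assumes "v \<in> carrier V" "w \<in> carrier V"
  shows "(hnorm V (v \<ominus>\<^bsub>V\<^esub> w))\<^sup>2 = (hnorm V v)\<^sup>2 + (hnorm V w)\<^sup>2 - 2 * Re (ip V v w)"
proof -
  have "Re (ip V (v \<ominus>\<^bsub>V\<^esub> w) (v \<ominus>\<^bsub>V\<^esub> w)) =
      Re (ip V v v) + Re (ip V w w) - Re (ip V v w) - Re (ip V w v)"
    using assms by (simp add: ip_diff_left ip_diff_right)
  then show ?thesis
    using assms Re_ip_commute[of v w] by (simp add: Re_ip_self[symmetric])
qed

lemma hnorm_add_sq: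
  assumes "v \<in> carrier V" "w \<in> carrier V"
  shows "(hnorm V (v \<oplus>\<^bsub>V\<^esub> w))\<^sup>2 = (hnorm V v)\<^sup>2 + (hnorm V w)\<^sup>2 + 2 * Re (ip V v w)"
proof -
  have "Re (ip V (v \<oplus>\<^bsub>V\<^esub> w) (v \<oplus>\<^bsub>V\<^esub> w)) =
      Re (ip V v v) + Re (ip V w w) + Re (ip V v w) + Re (ip V w v)"
    using assms by (simp add: ip_add ip_add_right)
  then show ?thesis
    using assms Re_ip_commute[of v w] by (simp add: Re_ip_self[symmetric])
qed

text \<open>Scaling \<open>v\<close> by the norm of \<open>w\<close> and \<open>w\<close> by the
  norm of \<open>v\<close> equalizes the lengths; the squared norm of the difference is then
  expanded.\<close>

lemma Re_Cauchy_Schwarz: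
  assumes v: "v \<in> carrier V" and w: "w \<in> carrier V"
  shows "Re (ip V v w) \<le> hnorm V v * hnorm V w"
proof (cases "hnorm V v = 0 \<or> hnorm V w = 0")
  case True
  then have "v = \<zero>\<^bsub>V\<^esub> \<or> w = \<zero>\<^bsub>V\<^esub>" using hnorm_eq_0D v w by blast
  then have "ip V v w = 0 \<or> ip V w v = 0" using v w by auto
  then have "Re (ip V v w) = 0" using Re_ip_commute[OF v w] by auto
  then show ?thesis using hnorm_nonneg v w by simp
next
  case False
  define a where "a = hnorm V w"
  define c where "c = hnorm V v"
  have pos: "a > 0" "c > 0" using False hnorm_nonneg v w by (auto simp: a_def c_def less_le)
  have "0 \<le> (hnorm V (of_real a \<odot>\<^bsub>V\<^esub> v \<ominus>\<^bsub>V\<^esub> of_real c \<odot>\<^bsub>V\<^esub> w))\<^sup>2" by simp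
  also have "\<dots> = 2 * (a * c) * (a * c) - 2 * (a * c) * Re (ip V v w)"
  proof -
    have "hnorm V (of_real a \<odot>\<^bsub>V\<^esub> v) = a * c" "hnorm V (of_real c \<odot>\<^bsub>V\<^esub> w) = a * c"
      using v w pos by (simp_all add: hnorm_smult a_def[symmetric] c_def[symmetric] mult.commute)
    moreover have "Re (ip V (of_real a \<odot>\<^bsub>V\<^esub> v) (of_real c \<odot>\<^bsub>V\<^esub> w)) = (a * c) * Re (ip V v w)"
      using v w by (simp add: ip_smult ip_smult_right mult.assoc)
    ultimately show ?thesis
      using v w hnorm_diff_sq[of "of_real a \<odot>\<^bsub>V\<^esub> v" "of_real c \<odot>\<^bsub>V\<^esub> w"]
      by (simp add: power2_eq_square algebra_simps)
  qed
  finally have "2 * (a * c) * Re (ip V v w) \<le> 2 * (a * c) * (a * c)" by simp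
  then have "Re (ip V v w) \<le> a * c" using pos by (simp add: mult_le_cancel_left)
  then show ?thesis by (simp add: a_def c_def mult.commute)
qed

lemma Cauchy_Schwarz:
  assumes v: "v \<in> carrier V" and w: "w \<in> carrier V"
  shows "cmod (ip V v w) \<le> hnorm V v * hnorm V w"
proof -
  define z where "z = ip V v w"
  have "z \<in> K" using ip_closed v w by (simp add: z_def)
  \<comment> \<open>\<open>c * z\<close> is the modulus of \<open>z\<close>. Over the reals
    \<open>c\<close> is a sign or 0, so it remains in \<open>K\<close>.\<close>
  define c where "c = cnj (sgn z)"
  have "cnj z / of_real (cmod z) \<in> K"
    using scalars cnj_scalar[OF \<open>z \<in> K\<close>] by auto
  then have c: "c \<in> K" by (simp add: c_def sgn_eq)
  have "c * z = of_real (cmod z)"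
    using complex_norm_square[of z]
    by (cases "z = 0") (simp_all add: c_def sgn_eq field_simps power2_eq_square)
  then have "cmod z = Re (ip V (c \<odot>\<^bsub>V\<^esub> v) w)"
    using c v w by (simp add: ip_smult z_def)
  also have "\<dots> \<le> hnorm V (c \<odot>\<^bsub>V\<^esub> v) * hnorm V w"
    using c v w by (intro Re_Cauchy_Schwarz) auto
  also have "\<dots> \<le> hnorm V v * hnorm V w"
  proof -
    have "cmod c \<le> 1" by (simp add: c_def norm_sgn)
    then have "cmod c * hnorm V v \<le> 1 * hnorm V v"
      by (intro mult_right_mono hnorm_nonneg v)
    then show ?thesis using c v w hnorm_nonneg[OF w] by (simp add: hnorm_smult mult_right_mono)
  qed
  finally show ?thesis by (simp add: z_def)
qed

lemma hnorm_triangle: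
  assumes v: "v \<in> carrier V" and w: "w \<in> carrier V"
  shows "hnorm V (v \<oplus>\<^bsub>V\<^esub> w) \<le> hnorm V v + hnorm V w"
proof (rule power2_le_imp_le)
  show "(hnorm V (v \<oplus>\<^bsub>V\<^esub> w))\<^sup>2 \<le> (hnorm V v + hnorm V w)\<^sup>2"
    using Re_Cauchy_Schwarz[OF v w] hnorm_add_sq[OF v w] by (simp add: power2_sum)
  show "0 \<le> hnorm V v + hnorm V w" using hnorm_nonneg v w by simp
qed

lemma hnorm_minus_commute:
  assumes "v \<in> carrier V" "w \<in> carrier V"
  shows "hnorm V (v \<ominus>\<^bsub>V\<^esub> w) = hnorm V (w \<ominus>\<^bsub>V\<^esub> v)"
proof -
  have "(hnorm V (v \<ominus>\<^bsub>V\<^esub> w))\<^sup>2 = (hnorm V (w \<ominus>\<^bsub>V\<^esub> v))\<^sup>2"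
    using assms Re_ip_commute[of v w] by (simp add: hnorm_diff_sq)
  then show ?thesis using assms by (simp add: power2_eq_iff_nonneg hnorm_nonneg)
qed

lemma diff_add_diff:
  assumes "u \<in> carrier V" "v \<in> carrier V" "w \<in> carrier V"
  shows "(u \<ominus>\<^bsub>V\<^esub> v) \<oplus>\<^bsub>V\<^esub> (v \<ominus>\<^bsub>V\<^esub> w) = u \<ominus>\<^bsub>V\<^esub> w"
proof -
  have "(\<ominus>\<^bsub>V\<^esub> v) \<oplus>\<^bsub>V\<^esub> (v \<oplus>\<^bsub>V\<^esub> \<ominus>\<^bsub>V\<^esub> w) = \<ominus>\<^bsub>V\<^esub> w"
    using assms by (simp add: M.a_assoc[symmetric] M.l_neg)
  then show ?thesis using assms by (simp add: a_minus_def M.a_assoc)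
qed

lemma hdist_triangle:
  assumes "u \<in> carrier V" "v \<in> carrier V" "w \<in> carrier V"
  shows "hnorm V (u \<ominus>\<^bsub>V\<^esub> w) \<le> hnorm V (u \<ominus>\<^bsub>V\<^esub> v) + hnorm V (v \<ominus>\<^bsub>V\<^esub> w)"
  using hnorm_triangle[of "u \<ominus>\<^bsub>V\<^esub> v" "v \<ominus>\<^bsub>V\<^esub> w"] diff_add_diff[OF assms] assms by simp

lemma hnorm_diff_le:
  assumes "v \<in> carrier V" "w \<in> carrier V"
  shows "hnorm V (v \<ominus>\<^bsub>V\<^esub> w) \<le> hnorm V v + hnorm V w"
proof -
  have "hnorm V (\<ominus>\<^bsub>V\<^esub> w) = hnorm V w"
    using assms ip_commute[of w "\<ominus>\<^bsub>V\<^esub> w"] by (simp add: hnorm_def ip_minus_left)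
  then show ?thesis using hnorm_triangle[of v "\<ominus>\<^bsub>V\<^esub> w"] assms by (simp add: a_minus_def)
qed

lemma eq_of_hdist_small:
  assumes "u \<in> carrier V" "v \<in> carrier V" "\<And>\<epsilon>. \<epsilon> > 0 \<Longrightarrow> hnorm V (u \<ominus>\<^bsub>V\<^esub> v) < \<epsilon>"
  shows "u = v"
proof -
  have "hnorm V (u \<ominus>\<^bsub>V\<^esub> v) = 0"
    using assms hnorm_nonneg[of "u \<ominus>\<^bsub>V\<^esub> v"] by (metis M.minus_closed less_le less_irrefl)
  then show ?thesis using hnorm_eq_0D[of "u \<ominus>\<^bsub>V\<^esub> v"] assms M.minus_equality[of u "\<ominus>\<^bsub>V\<^esub> v"] by (simp add: a_minus_def)
qed

lemma tendsto_ip: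
  assumes "\<And>n. u n \<in> carrier V" "v \<in> carrier V" "w \<in> carrier V"
    and lim: "(\<lambda>n. hnorm V (u n \<ominus>\<^bsub>V\<^esub> v)) \<longlonglongrightarrow> 0"
  shows "(\<lambda>n. ip V (u n) w) \<longlonglongrightarrow> ip V v w"
proof (rule LIM_zero_cancel, rule Lim_null_comparison)
  show "\<forall>\<^sub>F n in sequentially. norm (ip V (u n) w - ip V v w) \<le> hnorm V (u n \<ominus>\<^bsub>V\<^esub> v) * hnorm V w"
    using Cauchy_Schwarz[of "u _ \<ominus>\<^bsub>V\<^esub> v" w] assms by (simp add: ip_diff_left)
  show "(\<lambda>n. hnorm V (u n \<ominus>\<^bsub>V\<^esub> v) * hnorm V w) \<longlonglongrightarrow> 0"
    using tendsto_mult_left_zero[OF lim] by simp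
qed

text \<open>The parallelogram identity for the differences of \<open>f\<close> with \<open>v\<close>
  and with \<open>w\<close>. The last term is the gain in radius on passing to the midpoint of two
  candidates.\<close>

lemma midpoint_sq:
  assumes f: "f \<in> carrier V" and v: "v \<in> carrier V" and w: "w \<in> carrier V"
  shows "(hnorm V (f \<ominus>\<^bsub>V\<^esub> of_real (1/2) \<odot>\<^bsub>V\<^esub> (v \<oplus>\<^bsub>V\<^esub> w)))\<^sup>2 =
    ((hnorm V (f \<ominus>\<^bsub>V\<^esub> v))\<^sup>2 + (hnorm V (f \<ominus>\<^bsub>V\<^esub> w))\<^sup>2) / 2 - (hnorm V (v \<ominus>\<^bsub>V\<^esub> w))\<^sup>2 / 4"
proof -
  have half: "of_real (1/2) \<in> K" by (rule of_real_scalar)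
  have "Re (ip V f (of_real (1/2) \<odot>\<^bsub>V\<^esub> (v \<oplus>\<^bsub>V\<^esub> w))) = (Re (ip V f v) + Re (ip V f w)) / 2"
  proof -
    have "ip V f (of_real (1/2) \<odot>\<^bsub>V\<^esub> (v \<oplus>\<^bsub>V\<^esub> w)) = of_real (1/2) * (ip V f v + ip V f w)"
      using f v w ip_smult_right[OF half, of f "v \<oplus>\<^bsub>V\<^esub> w"]
      by (simp add: ip_add_right del: of_real_divide)
    then show ?thesis by (simp del: of_real_divide)
  qed
  moreover have "(hnorm V (of_real (1/2) \<odot>\<^bsub>V\<^esub> (v \<oplus>\<^bsub>V\<^esub> w)))\<^sup>2 =
      ((hnorm V v)\<^sup>2 + (hnorm V w)\<^sup>2 + 2 * Re (ip V v w)) / 4"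
  proof -
    have "hnorm V (of_real (1/2) \<odot>\<^bsub>V\<^esub> (v \<oplus>\<^bsub>V\<^esub> w)) = 1/2 * hnorm V (v \<oplus>\<^bsub>V\<^esub> w)"
      using v w hnorm_smult[OF half, of "v \<oplus>\<^bsub>V\<^esub> w"] by simp
    then have "(hnorm V (of_real (1/2) \<odot>\<^bsub>V\<^esub> (v \<oplus>\<^bsub>V\<^esub> w)))\<^sup>2 = 1/4 * (hnorm V (v \<oplus>\<^bsub>V\<^esub> w))\<^sup>2"
      by (simp only: power_mult_distrib) (simp add: power2_eq_square)
    then show ?thesis using hnorm_add_sq[OF v w] by simp
  qed
  moreover have "of_real (1/2) \<odot>\<^bsub>V\<^esub> (v \<oplus>\<^bsub>V\<^esub> w) \<in> carrier V" using v w half by (intro smult_closed_K) auto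
  ultimately show ?thesis
    using hnorm_diff_sq[OF f, of "of_real (1/2) \<odot>\<^bsub>V\<^esub> (v \<oplus>\<^bsub>V\<^esub> w)"]
      hnorm_diff_sq[OF f v] hnorm_diff_sq[OF f w] hnorm_diff_sq[OF v w]
    by argo
qed

end

section \<open>Chebyshev centers along a filter\<close>

definition enclosed :: "('h, 'z) hilbert_scheme \<Rightarrow> 'i filter \<Rightarrow> ('i \<Rightarrow> 'h) \<Rightarrow> 'h \<Rightarrow> real \<Rightarrow> bool" where
  "enclosed V F f v c \<longleftrightarrow> (\<forall>\<^sub>F i in F. hnorm V (f i \<ominus>\<^bsub>V\<^esub> v) \<le> c)"

text \<open>The radius of \<open>v\<close> exceeds the infimum of all radii by at most
  \<open>\<delta>\<close>, said without naming an infimum: \<open>c\<close> bounds the former from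
  above, \<open>c - \<delta>\<close> the latter from below.\<close>

definition nearly_minimal ::
    "('h, 'z) hilbert_scheme \<Rightarrow> 'i filter \<Rightarrow> ('i \<Rightarrow> 'h) \<Rightarrow> real \<Rightarrow> 'h \<Rightarrow> bool" where
  "nearly_minimal V F f \<delta> v \<longleftrightarrow>
     (\<exists>c. enclosed V F f v c \<and> (\<forall>u\<in>carrier V. \<not> enclosed V F f u (c - \<delta>)))"

text \<open>The Chebyshev center minimizes the essential radius \<open>v \<mapsto> inf {c. enclosed V F f v c}\<close>; it is
  defined here as the common limit of all minimizing sequences.\<close>

definition chebyshev_center ::
    "('h, 'z) hilbert_scheme \<Rightarrow> 'i filter \<Rightarrow> ('i \<Rightarrow> 'h) \<Rightarrow> 'h \<Rightarrow> bool" where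
  "chebyshev_center V F f v \<longleftrightarrow> v \<in> carrier V \<and>
     (\<forall>\<epsilon>>0. \<exists>\<delta>>0. \<forall>w\<in>carrier V. nearly_minimal V F f \<delta> w \<longrightarrow> hnorm V (w \<ominus>\<^bsub>V\<^esub> v) < \<epsilon>)"

lemma enclosed_mono: "enclosed V F f v c \<Longrightarrow> c \<le> c' \<Longrightarrow> enclosed V F f v c'"
  unfolding enclosed_def by (erule eventually_mono) simp

lemma nearly_minimal_mono:
  "nearly_minimal V F f \<delta> v \<Longrightarrow> \<delta> \<le> \<delta>' \<Longrightarrow> nearly_minimal V F f \<delta>' v"
  unfolding nearly_minimal_def by (meson diff_left_mono enclosed_mono)

text \<open>A center depends on distances and enclosing radii only. Surjectivity of \<open>T\<close>
  matters because minimality is tested against all vectors of \<open>W\<close>.\<close>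

lemma chebyshev_center_transport:
  assumes T: "T ` carrier V = carrier W"
    and dist: "\<And>v w. v \<in> carrier V \<Longrightarrow> w \<in> carrier V \<Longrightarrow>
      hnorm W (T v \<ominus>\<^bsub>W\<^esub> T w) = hnorm V (v \<ominus>\<^bsub>V\<^esub> w)"
    and encl: "\<And>v c. v \<in> carrier V \<Longrightarrow> enclosed W F' g (T v) c \<longleftrightarrow> enclosed V F f v c"
    and c: "chebyshev_center V F f v"
  shows "chebyshev_center W F' g (T v)"
proof -
  have nm: "nearly_minimal W F' g \<delta> (T w) \<longleftrightarrow> nearly_minimal V F f \<delta> w" if "w \<in> carrier V" for w \<delta>
    using that encl unfolding nearly_minimal_def T[symmetric] by auto
  have v: "v \<in> carrier V" using c by (simp add: chebyshev_center_def)
  show ?thesis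
    unfolding chebyshev_center_def
  proof (intro conjI allI impI)
    show "T v \<in> carrier W" using v T by blast
    fix \<epsilon> :: real assume "\<epsilon> > 0"
    then obtain \<delta> where "\<delta> > 0"
        "\<forall>w\<in>carrier V. nearly_minimal V F f \<delta> w \<longrightarrow> hnorm V (w \<ominus>\<^bsub>V\<^esub> v) < \<epsilon>"
      using c unfolding chebyshev_center_def by blast
    then show "\<exists>\<delta>>0. \<forall>w\<in>carrier W. nearly_minimal W F' g \<delta> w \<longrightarrow> hnorm W (w \<ominus>\<^bsub>W\<^esub> T v) < \<epsilon>"
      using nm dist v unfolding T[symmetric] by (intro exI[of _ \<delta>]) auto
  qed
qed

context hilbert_space
begin

lemma enclosed_nonneg:
  assumes "enclosed V F f v c" "v \<in> carrier V" "\<forall>\<^sub>F i in F. f i \<in> carrier V" "F \<noteq> bot"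
  shows "0 \<le> c"
proof -
  have "\<forall>\<^sub>F i in F. hnorm V (f i \<ominus>\<^bsub>V\<^esub> v) \<le> c \<and> f i \<in> carrier V"
    using assms by (auto simp: enclosed_def eventually_conj)
  then obtain i where "hnorm V (f i \<ominus>\<^bsub>V\<^esub> v) \<le> c" "f i \<in> carrier V"
    using eventually_happens'[OF assms(4)] by blast
  then show ?thesis using hnorm_nonneg[of "f i \<ominus>\<^bsub>V\<^esub> v"] assms(2) by force
qed

lemma enclosed_shift:
  assumes "enclosed V F f v c" "v \<in> carrier V" "w \<in> carrier V" "\<forall>\<^sub>F i in F. f i \<in> carrier V"
    and "hnorm V (v \<ominus>\<^bsub>V\<^esub> w) \<le> r"
  shows "enclosed V F f w (c + r)"
proof -
  have "\<forall>\<^sub>F i in F. hnorm V (f i \<ominus>\<^bsub>V\<^esub> v) \<le> c \<and> f i \<in> carrier V"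
    using assms by (auto simp: enclosed_def eventually_conj)
  then show ?thesis
    unfolding enclosed_def
  proof (rule eventually_mono)
    fix i assume "hnorm V (f i \<ominus>\<^bsub>V\<^esub> v) \<le> c \<and> f i \<in> carrier V"
    then show "hnorm V (f i \<ominus>\<^bsub>V\<^esub> w) \<le> c + r"
      using hdist_triangle[of "f i" v w] assms by simp
  qed
qed

text \<open>The descending radii stay in the coset of \<open>c0\<close> modulo \<open>\<delta>\<close>, so that they are rational when
  \<open>c0\<close> and \<open>\<delta>\<close> are.\<close>

lemma ex_nearly_minimal_in:
  assumes c0: "v0 \<in> D" "enclosed V F f v0 c0" and D: "D \<subseteq> carrier V"
    and "\<forall>\<^sub>F i in F. f i \<in> carrier V" "F \<noteq> bot" "\<delta> > 0"
  shows "\<exists>w\<in>D. \<exists>i::nat. enclosed V F f w (c0 - real i * \<delta>) \<and>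
    (\<forall>u\<in>D. \<not> enclosed V F f u (c0 - real i * \<delta> - \<delta>))"
proof -
  define Q where "Q i \<longleftrightarrow> (\<exists>w\<in>D. enclosed V F f w (c0 - real i * \<delta>))" for i :: nat
  have "Q 0" using c0 by (auto simp: Q_def)
  \<comment> \<open>After enough descents the radius would be negative, which a proper filter
    excludes; hence some descent is the last successful one.\<close>
  obtain m where m: "real m * \<delta> > c0" using reals_Archimedean3[OF \<open>\<delta> > 0\<close>] by blast
  have "\<not> Q m" unfolding Q_def using m enclosed_nonneg assms by force
  have "\<exists>i. Q i \<and> \<not> Q (Suc i)"
    using \<open>Q 0\<close> \<open>\<not> Q m\<close> by (metis nat_induct)
  then obtain i where "Q i" "\<not> Q (Suc i)" by blast
  moreover have "c0 - real (Suc i) * \<delta> = c0 - real i * \<delta> - \<delta>" by (simp add: algebra_simps)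
  ultimately show ?thesis unfolding Q_def by metis
qed

lemma ex_nearly_minimal:
  assumes "v0 \<in> carrier V" "enclosed V F f v0 c0"
    and "\<forall>\<^sub>F i in F. f i \<in> carrier V" "F \<noteq> bot" "\<delta> > 0"
  shows "\<exists>w\<in>carrier V. nearly_minimal V F f \<delta> w"
  using ex_nearly_minimal_in[of v0 "carrier V" F f c0 \<delta>] assms
  unfolding nearly_minimal_def by blast

text \<open>If \<open>w\<close> and \<open>w'\<close> were far apart, their midpoint would have a smaller radius, by the
  parallelogram identity.\<close>

lemma nearly_minimal_close:
  assumes v0: "v0 \<in> carrier V" "enclosed V F f v0 c0"
    and f: "\<forall>\<^sub>F i in F. f i \<in> carrier V" and F: "F \<noteq> bot" and \<delta>: "0 < \<delta>" "\<delta> \<le> 1"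
    and w: "w \<in> carrier V" "nearly_minimal V F f \<delta> w"
    and w': "w' \<in> carrier V" "nearly_minimal V F f \<delta> w'"
  shows "(hnorm V (w \<ominus>\<^bsub>V\<^esub> w'))\<^sup>2 \<le> 8 * (c0 + 1) * \<delta>"
proof -
  have *: "(hnorm V (w \<ominus>\<^bsub>V\<^esub> w'))\<^sup>2 \<le> 8 * (c0 + 1) * \<delta>"
    if w: "w \<in> carrier V" "enclosed V F f w c" and w': "w' \<in> carrier V" "enclosed V F f w' c"
      and min: "\<And>u. u \<in> carrier V \<Longrightarrow> \<not> enclosed V F f u (c - \<delta>)" for w w' c
  proof -
    define m where "m = of_real (1/2) \<odot>\<^bsub>V\<^esub> (w \<oplus>\<^bsub>V\<^esub> w')"
    have "of_real (1/2) \<in> K" by (rule of_real_scalar)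
    then have m: "m \<in> carrier V" using w w' unfolding m_def by (intro smult_closed_K) auto
    define r where "r = hnorm V (w \<ominus>\<^bsub>V\<^esub> w')"
    have c: "c \<ge> 0" using enclosed_nonneg w f F by blast
    \<comment> \<open>\<open>v0\<close> has radius at most \<open>c0\<close>, so
      \<open>c < c0 + \<delta> \<le> c0 + 1\<close>. This is the origin of the constant:
      \<open>r\<^sup>2 > 8 * (c0 + 1) * \<delta>\<close> gives \<open>c\<^sup>2 - r\<^sup>2 / 4 <
      c\<^sup>2 - 2 * c * \<delta> \<le> (c - \<delta>)\<^sup>2\<close>.\<close>
    have cc0: "c - \<delta> < c0"
      using min[OF v0(1)] enclosed_mono[OF v0(2), of "c - \<delta>"] by linarith
    show ?thesis
    proof (rule ccontr)
      assume far: "\<not> ?thesis"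
      have "enclosed V F f m (c - \<delta>)"
      proof -
        have "\<forall>\<^sub>F i in F. (f i \<in> carrier V \<and> hnorm V (f i \<ominus>\<^bsub>V\<^esub> w) \<le> c) \<and> hnorm V (f i \<ominus>\<^bsub>V\<^esub> w') \<le> c"
          using w w' f unfolding enclosed_def by (intro eventually_conj)
        then show ?thesis
          unfolding enclosed_def
        proof (rule eventually_mono)
          fix i assume i: "(f i \<in> carrier V \<and> hnorm V (f i \<ominus>\<^bsub>V\<^esub> w) \<le> c) \<and> hnorm V (f i \<ominus>\<^bsub>V\<^esub> w') \<le> c"
          have "(hnorm V (f i \<ominus>\<^bsub>V\<^esub> w))\<^sup>2 \<le> c\<^sup>2" "(hnorm V (f i \<ominus>\<^bsub>V\<^esub> w'))\<^sup>2 \<le> c\<^sup>2"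
            using i w(1) w'(1) by (auto intro!: power_mono hnorm_nonneg)
          then have sq: "(hnorm V (f i \<ominus>\<^bsub>V\<^esub> m))\<^sup>2 \<le> c\<^sup>2 - r\<^sup>2 / 4"
            using midpoint_sq[of "f i" w w'] i w(1) w'(1) by (simp add: m_def r_def field_simps)
          have far': "8 * (c0 + 1) * \<delta> < r\<^sup>2" using far by (simp add: r_def)
          have "c * \<delta> \<le> (c0 + 1) * \<delta>" using cc0 \<delta> by (intro mult_right_mono) auto
          then have lt: "c\<^sup>2 - r\<^sup>2 / 4 < c\<^sup>2 - 2 * (c * \<delta>)" using far' by linarith
          \<comment> \<open>Needed to take square roots. Otherwise
            \<open>c\<^sup>2 \<le> c * \<delta>\<close> would make the right-hand side of
            \<open>sq\<close> negative.\<close>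
          have "c \<ge> \<delta>"
          proof (rule ccontr)
            assume "\<not> c \<ge> \<delta>"
            then have "c * c \<le> c * \<delta>" using c by (intro mult_left_mono) auto
            moreover have "0 \<le> c * \<delta>" using c \<delta> by simp
            ultimately have "c\<^sup>2 - r\<^sup>2/4 < 0"
              using lt unfolding power2_eq_square by linarith
            then show False using sq zero_le_power2[of "hnorm V (f i \<ominus>\<^bsub>V\<^esub> m)"] by linarith
          qed
          moreover have "(c - \<delta>)\<^sup>2 = c\<^sup>2 - 2 * (c * \<delta>) + \<delta>\<^sup>2"
            by (simp add: power2_eq_square algebra_simps)
          ultimately have "(hnorm V (f i \<ominus>\<^bsub>V\<^esub> m))\<^sup>2 \<le> (c - \<delta>)\<^sup>2" "0 \<le> c - \<delta>"
            using sq lt zero_le_power2[of \<delta>] by linarith+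
          then show "hnorm V (f i \<ominus>\<^bsub>V\<^esub> m) \<le> c - \<delta>" by (rule power2_le_imp_le)
        qed
      qed
      then show False using min m by blast
    qed
  qed
  obtain c where c: "enclosed V F f w c" "\<And>u. u \<in> carrier V \<Longrightarrow> \<not> enclosed V F f u (c - \<delta>)"
    using w by (auto simp: nearly_minimal_def)
  obtain c' where c': "enclosed V F f w' c'" "\<And>u. u \<in> carrier V \<Longrightarrow> \<not> enclosed V F f u (c' - \<delta>)"
    using w' by (auto simp: nearly_minimal_def)
  show ?thesis
  \<comment> \<open>The larger of the two radii encloses from both points and comes with its own
    minimality, so it can play the part of the common radius.\<close>
  proof (cases "c \<le> c'")
    case True
    then show ?thesis using *[of w c' w'] enclosed_mono[OF c(1) True] c' w w' by blast
  next
    case False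
    then show ?thesis using *[of w c w'] enclosed_mono[OF c'(1), of c] c w w' by force
  qed
qed

text \<open>A vector that is nearly minimal at a small enough scale is close to both centers, and
  such vectors exist.\<close>

lemma chebyshev_center_unique:
  assumes "chebyshev_center V F f v" "chebyshev_center V F f v'"
    and "v0 \<in> carrier V" "enclosed V F f v0 c0" "\<forall>\<^sub>F i in F. f i \<in> carrier V" "F \<noteq> bot"
  shows "v = v'"
proof (rule eq_of_hdist_small)
  show v: "v \<in> carrier V" and v': "v' \<in> carrier V"
    using assms by (auto simp: chebyshev_center_def)
  fix \<epsilon> :: real assume \<epsilon>: "\<epsilon> > 0"
  obtain \<delta> where \<delta>: "\<delta> > 0"
      "\<forall>w\<in>carrier V. nearly_minimal V F f \<delta> w \<longrightarrow> hnorm V (w \<ominus>\<^bsub>V\<^esub> v) < \<epsilon> / 2"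
    using assms(1) half_gt_zero[OF \<epsilon>] unfolding chebyshev_center_def by blast
  obtain \<delta>' where \<delta>': "\<delta>' > 0"
      "\<forall>w\<in>carrier V. nearly_minimal V F f \<delta>' w \<longrightarrow> hnorm V (w \<ominus>\<^bsub>V\<^esub> v') < \<epsilon> / 2"
    using assms(2) half_gt_zero[OF \<epsilon>] unfolding chebyshev_center_def by blast
  obtain w where w: "w \<in> carrier V" "nearly_minimal V F f (min \<delta> \<delta>') w"
    using ex_nearly_minimal[OF assms(3-6), of "min \<delta> \<delta>'"] \<delta> \<delta>' by auto
  then have "hnorm V (w \<ominus>\<^bsub>V\<^esub> v) < \<epsilon> / 2" "hnorm V (w \<ominus>\<^bsub>V\<^esub> v') < \<epsilon> / 2"
    using \<delta>(2) \<delta>'(2) nearly_minimal_mono[OF w(2), of \<delta>] nearly_minimal_mono[OF w(2), of \<delta>']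
    by auto
  then show "hnorm V (v \<ominus>\<^bsub>V\<^esub> v') < \<epsilon>"
    using hdist_triangle[of v w v'] hnorm_minus_commute[of v w] v v' w(1) by simp
qed

text \<open>Near-minimizers at the scales \<open>1 / real (Suc n)\<close> form a Cauchy sequence, by
  the bound on their mutual distances; its limit then attracts all near-minimizers.\<close>

lemma ex_chebyshev_center:
  assumes v0: "v0 \<in> carrier V" "enclosed V F f v0 c0"
    and f: "\<forall>\<^sub>F i in F. f i \<in> carrier V" and F: "F \<noteq> bot"
  shows "\<exists>v. chebyshev_center V F f v"
proof -
  define M where "M = 8 * (c0 + 1)"
  have M: "M > 0" using enclosed_nonneg[OF v0(2,1) f F] by (simp add: M_def)
  have close: "hnorm V (w \<ominus>\<^bsub>V\<^esub> w') < \<epsilon>"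
    if "w \<in> carrier V" "nearly_minimal V F f \<delta> w" "w' \<in> carrier V" "nearly_minimal V F f \<delta> w'"
      "0 < \<delta>" "\<delta> \<le> 1" "\<delta> < \<epsilon>\<^sup>2 / M" "\<epsilon> > 0" for w w' \<delta> \<epsilon>
  proof -
    have "(hnorm V (w \<ominus>\<^bsub>V\<^esub> w'))\<^sup>2 \<le> M * \<delta>"
      using nearly_minimal_close[OF v0 f F] that by (simp add: M_def)
    also have "\<dots> < \<epsilon>\<^sup>2" using that M by (simp add: field_simps)
    finally show ?thesis using that by (simp add: power2_less_imp_less)
  qed
  have "\<forall>n. \<exists>w\<in>carrier V. nearly_minimal V F f (1 / real (Suc n)) w"
    using ex_nearly_minimal[OF v0 f F] by simp
  then obtain \<sigma> where \<sigma>: "\<And>n. \<sigma> n \<in> carrier V" "\<And>n. nearly_minimal V F f (1 / real (Suc n)) (\<sigma> n)"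
    by metis
  have \<sigma>': "nearly_minimal V F f (1 / real (Suc N)) (\<sigma> n)" if "n \<ge> N" for n N
    by (rule nearly_minimal_mono[OF \<sigma>(2)]) (use that in \<open>auto simp: field_simps\<close>)
  have ex: "\<exists>N. 1 / real (Suc N) < \<epsilon>\<^sup>2 / M" if "\<epsilon> > 0" for \<epsilon>
    using nat_approx_posE[of "\<epsilon>\<^sup>2 / M"] that M by (metis zero_less_divide_iff zero_less_power)
  have "\<exists>v\<in>carrier V. (\<lambda>n. hnorm V (\<sigma> n \<ominus>\<^bsub>V\<^esub> v)) \<longlonglongrightarrow> 0"
  proof (rule complete[OF \<sigma>(1)])
    fix \<epsilon> :: real assume \<epsilon>: "\<epsilon> > 0"
    then obtain N where "1 / real (Suc N) < \<epsilon>\<^sup>2 / M" using ex by blast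
    then have "\<forall>m\<ge>N. \<forall>n\<ge>N. hnorm V (\<sigma> m \<ominus>\<^bsub>V\<^esub> \<sigma> n) < \<epsilon>"
      using close[OF \<sigma>(1) \<sigma>' \<sigma>(1) \<sigma>' _ _ _ \<epsilon>] by auto
    then show "\<exists>N. \<forall>m\<ge>N. \<forall>n\<ge>N. hnorm V (\<sigma> m \<ominus>\<^bsub>V\<^esub> \<sigma> n) < \<epsilon>" by blast
  qed
  then obtain v where v: "v \<in> carrier V" "(\<lambda>n. hnorm V (\<sigma> n \<ominus>\<^bsub>V\<^esub> v)) \<longlonglongrightarrow> 0" by blast
  have "chebyshev_center V F f v"
    unfolding chebyshev_center_def
  proof (intro conjI allI impI v(1))
    fix \<epsilon> :: real assume \<epsilon>: "\<epsilon> > 0"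
    obtain N where N: "1 / real (Suc N) < (\<epsilon>/2)\<^sup>2 / M" using ex[of "\<epsilon>/2"] \<epsilon> by auto
    obtain N' where "\<forall>n\<ge>N'. norm (hnorm V (\<sigma> n \<ominus>\<^bsub>V\<^esub> v) - 0) < \<epsilon>/2"
      using LIMSEQ_D[OF v(2) half_gt_zero[OF \<epsilon>]] by blast
    then have "\<bar>hnorm V (\<sigma> (max N N') \<ominus>\<^bsub>V\<^esub> v)\<bar> < \<epsilon>/2" by simp
    then have N': "hnorm V (\<sigma> (max N N') \<ominus>\<^bsub>V\<^esub> v) < \<epsilon>/2" by linarith
    have "hnorm V (w \<ominus>\<^bsub>V\<^esub> v) < \<epsilon>"
      if "w \<in> carrier V" "nearly_minimal V F f (1 / real (Suc N)) w" for w
    proof -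
      have "hnorm V (w \<ominus>\<^bsub>V\<^esub> \<sigma> (max N N')) < \<epsilon>/2"
        using close[OF that \<sigma>(1) \<sigma>' _ _ N] \<epsilon> by auto
      then show ?thesis using hdist_triangle[of w "\<sigma> (max N N')" v] N' that v(1) \<sigma>(1) by fastforce
    qed
    then show "\<exists>\<delta>>0. \<forall>w\<in>carrier V. nearly_minimal V F f \<delta> w \<longrightarrow> hnorm V (w \<ominus>\<^bsub>V\<^esub> v) < \<epsilon>"
      by (intro exI[of _ "1 / real (Suc N)"]) auto
  qed
  then show ?thesis by blast
qed

text \<open>The rate comes from selecting within a dense sequence: \<open>1 / real (Suc n)\<close>
  for minimality among its members, and as much again for replacing an arbitrary competitor by a
  member.\<close>

lemma chebyshev_center_tendsto:
  assumes "chebyshev_center V F f v" "\<And>n. w n \<in> carrier V"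
    and near: "\<And>n. nearly_minimal V F f (2 / real (Suc n)) (w n)"
  shows "(\<lambda>n. hnorm V (w n \<ominus>\<^bsub>V\<^esub> v)) \<longlonglongrightarrow> 0"
proof (rule LIMSEQ_I)
  fix \<epsilon> :: real assume "\<epsilon> > 0"
  then obtain \<delta> where \<delta>: "\<delta> > 0"
      "\<forall>w\<in>carrier V. nearly_minimal V F f \<delta> w \<longrightarrow> hnorm V (w \<ominus>\<^bsub>V\<^esub> v) < \<epsilon>"
    using assms(1) unfolding chebyshev_center_def by blast
  obtain N where N: "1 / real (Suc N) < \<delta> / 2" using nat_approx_posE[of "\<delta>/2"] \<delta>(1) by auto
  have v: "v \<in> carrier V" using assms(1) by (simp add: chebyshev_center_def)
  have "norm (hnorm V (w n \<ominus>\<^bsub>V\<^esub> v) - 0) < \<epsilon>" if "n \<ge> N" for n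
  proof -
    have "1 / real (Suc n) \<le> 1 / real (Suc N)" using that by (auto simp: field_simps)
    then have "2 / real (Suc n) \<le> \<delta>" using N by linarith
    then have "hnorm V (w n \<ominus>\<^bsub>V\<^esub> v) < \<epsilon>" using \<delta>(2) nearly_minimal_mono[OF near] assms(2) by blast
    then show ?thesis using hnorm_nonneg[of "w n \<ominus>\<^bsub>V\<^esub> v"] v assms(2) by simp
  qed
  then show "\<exists>N. \<forall>n\<ge>N. norm (hnorm V (w n \<ominus>\<^bsub>V\<^esub> v) - 0) < \<epsilon>" by blast
qed

end

section \<open>Borel sections of Hilbert bundles\<close>

text \<open>Coefficients come as a list, so that the combinations with rational coefficients are
  indexed by a countable set.\<close>

definition lincomb :: "'h hilbert \<Rightarrow> (nat \<Rightarrow> 'h) \<Rightarrow> complex list \<Rightarrow> 'h" where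
  "lincomb V a cs = (\<Oplus>\<^bsub>V\<^esub> i\<in>{..<length cs}. cs ! i \<odot>\<^bsub>V\<^esub> a i)"

definition rational_scalars :: "complex set \<Rightarrow> complex set" where
  "rational_scalars K = {Complex p q | p q. p \<in> \<rat> \<and> q \<in> \<rat>} \<inter> K"

lemma countable_rational_scalars: "countable (rational_scalars K)"
proof -
  have "{Complex p q | p q. p \<in> \<rat> \<and> q \<in> \<rat>} = (\<lambda>(p, q). Complex p q) ` (\<rat> \<times> \<rat>)" by auto
  then show ?thesis by (simp add: rational_scalars_def countable_rat)
qed

section \<open>Rational linear combinations of a total sequence\<close>

context hilbert_space
begin

lemma rational_scalars_subset: "rational_scalars K \<subseteq> K"
  by (simp add: rational_scalars_def)

lemma rational_scalars_dense:
  assumes "z \<in> K" "\<epsilon> > 0"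
  shows "\<exists>q\<in>rational_scalars K. cmod (z - q) < \<epsilon>"
proof -
  have "\<exists>q\<in>\<rat>. \<bar>x - q\<bar> < \<epsilon>/2" for x :: real
  proof -
    obtain q where "q \<in> \<rat>" "x - \<epsilon>/2 < q" "q < x" using Rats_dense_in_real[of "x - \<epsilon>/2" x] assms by auto
    then show ?thesis by (intro bexI[of _ q]) auto
  qed
  then obtain p q where pq: "p \<in> \<rat>" "\<bar>Re z - p\<bar> < \<epsilon>/2" "q \<in> \<rat>" "\<bar>Im z - q\<bar> < \<epsilon>/2" by meson
  show ?thesis
  proof (cases "K = UNIV")
    case True
    have "cmod (z - Complex p q) \<le> \<bar>Re z - p\<bar> + \<bar>Im z - q\<bar>"
      using cmod_le[of "z - Complex p q"] by simp
    then show ?thesis using pq True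
      by (intro bexI[of _ "Complex p q"]) (auto simp: rational_scalars_def)
  next
    case False
    then have K: "K = \<real>" using scalars by blast
    then have "z = of_real (Re z)" using assms by (simp add: complex_is_Real_iff complex_eq_iff)
    then have "cmod (z - of_real p) = \<bar>Re z - p\<bar>" by (metis norm_of_real of_real_diff)
    moreover have "of_real p \<in> rational_scalars K"
      using pq K by (auto simp: rational_scalars_def complex_of_real_def complex_is_Real_iff)
    ultimately show ?thesis using pq assms by (intro bexI[of _ "of_real p"]) auto
  qed
qed

lemma finsum_smult_Suc:
  assumes "\<And>i. a i \<in> carrier V" "\<And>i. i < Suc n \<Longrightarrow> c i \<in> K"
  shows "(\<Oplus>\<^bsub>V\<^esub> i\<in>{..<Suc n}. c i \<odot>\<^bsub>V\<^esub> a i) = (\<Oplus>\<^bsub>V\<^esub> i\<in>{..<n}. c i \<odot>\<^bsub>V\<^esub> a i) \<oplus>\<^bsub>V\<^esub> c n \<odot>\<^bsub>V\<^esub> a n"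
    and "(\<Oplus>\<^bsub>V\<^esub> i\<in>{..<n}. c i \<odot>\<^bsub>V\<^esub> a i) \<in> carrier V"
proof -
  show closed: "(\<Oplus>\<^bsub>V\<^esub> i\<in>{..<n}. c i \<odot>\<^bsub>V\<^esub> a i) \<in> carrier V"
    using assms by (intro M.finsum_closed) auto
  have "(\<Oplus>\<^bsub>V\<^esub> i\<in>insert n {..<n}. c i \<odot>\<^bsub>V\<^esub> a i) =
      c n \<odot>\<^bsub>V\<^esub> a n \<oplus>\<^bsub>V\<^esub> (\<Oplus>\<^bsub>V\<^esub> i\<in>{..<n}. c i \<odot>\<^bsub>V\<^esub> a i)"
    using assms by (intro M.finsum_insert) auto
  then show "(\<Oplus>\<^bsub>V\<^esub> i\<in>{..<Suc n}. c i \<odot>\<^bsub>V\<^esub> a i) =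
      (\<Oplus>\<^bsub>V\<^esub> i\<in>{..<n}. c i \<odot>\<^bsub>V\<^esub> a i) \<oplus>\<^bsub>V\<^esub> c n \<odot>\<^bsub>V\<^esub> a n"
    using M.a_comm[of "c n \<odot>\<^bsub>V\<^esub> a n" "\<Oplus>\<^bsub>V\<^esub> i\<in>{..<n}. c i \<odot>\<^bsub>V\<^esub> a i"] assms closed
    by (simp add: lessThan_Suc)
qed

lemma ip_finsum:
  fixes n :: nat
  assumes "\<And>i. a i \<in> carrier V" "\<And>i. i < n \<Longrightarrow> c i \<in> K" "w \<in> carrier V"
  shows "ip V (\<Oplus>\<^bsub>V\<^esub> i\<in>{..<n}. c i \<odot>\<^bsub>V\<^esub> a i) w = (\<Sum>i<n. c i * ip V (a i) w)"
  using assms(2)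
proof (induction n)
  case 0
  then show ?case using assms(3) by simp
next
  case (Suc n)
  then show ?case
    using assms(1,3) finsum_smult_Suc[of a n c] by (simp add: ip_add ip_smult)
qed

lemma lincomb_closed:
  "(\<And>i. a i \<in> carrier V) \<Longrightarrow> set cs \<subseteq> K \<Longrightarrow> lincomb V a cs \<in> carrier V"
  unfolding lincomb_def by (intro M.finsum_closed) (auto simp: subset_iff)

lemma ip_lincomb:
  assumes "\<And>i. a i \<in> carrier V" "set cs \<subseteq> K" "w \<in> carrier V"
  shows "ip V (lincomb V a cs) w = (\<Sum>i<length cs. cs ! i * ip V (a i) w)"
  unfolding lincomb_def using assms by (intro ip_finsum) (auto simp: subset_iff)

lemma ip_lincomb_right:
  assumes "\<And>i. a i \<in> carrier V" "set cs \<subseteq> K" "w \<in> carrier V"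
  shows "ip V w (lincomb V a cs) = (\<Sum>i<length cs. cnj (cs ! i) * ip V w (a i))"
  using ip_commute[of w "lincomb V a cs"] ip_lincomb[OF assms] lincomb_closed[OF assms(1,2)] assms
    ip_commute[of w "a _"] by (simp add: cnj_sum)

text \<open>Induction on the number of terms, half of \<open>\<epsilon>\<close> being spent on the
  last one.\<close>

lemma finsum_approx_rational:
  fixes n :: nat
  assumes a: "\<And>i. a i \<in> carrier V" and c: "\<And>i. i < n \<Longrightarrow> c i \<in> K" and "\<epsilon> > 0"
  shows "\<exists>q. (\<forall>i. q i \<in> rational_scalars K) \<and>
    hnorm V ((\<Oplus>\<^bsub>V\<^esub> i\<in>{..<n}. c i \<odot>\<^bsub>V\<^esub> a i) \<ominus>\<^bsub>V\<^esub> (\<Oplus>\<^bsub>V\<^esub> i\<in>{..<n}. q i \<odot>\<^bsub>V\<^esub> a i)) < \<epsilon>"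
  using c \<open>\<epsilon> > 0\<close>
proof (induction n arbitrary: \<epsilon>)
  case 0
  have "0 \<in> K" using of_real_scalar[of 0] by simp
  then have "0 \<in> rational_scalars K"
    by (auto simp: rational_scalars_def zero_complex.code intro!: exI[of _ 0])
  then show ?case using 0 by (intro exI[of _ "\<lambda>_. 0"]) (simp add: a_minus_def M.r_neg)
next
  case (Suc n)
  define S where "S c = (\<Oplus>\<^bsub>V\<^esub> i\<in>{..<n}. c i \<odot>\<^bsub>V\<^esub> a i)" for c :: "nat \<Rightarrow> complex"
  obtain q where q: "\<And>i. q i \<in> rational_scalars K" "hnorm V (S c \<ominus>\<^bsub>V\<^esub> S q) < \<epsilon>/2"
    using Suc.IH[of "\<epsilon>/2"] Suc.prems unfolding S_def by auto
  \<comment> \<open>The summand 1 prevents a division by zero when \<open>a n\<close> is the zero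
    vector.\<close>
  define d where "d = \<epsilon> / 2 / (hnorm V (a n) + 1)"
  have pos: "hnorm V (a n) + 1 > 0" using hnorm_nonneg[OF a] by (simp add: add_nonneg_pos)
  then have "d > 0" using Suc.prems by (simp add: d_def)
  then obtain r where r: "r \<in> rational_scalars K" "cmod (c n - r) < d"
    using rational_scalars_dense[of "c n" d] Suc.prems by auto
  define q' where "q' = q(n := r)"
  have q': "q' i \<in> rational_scalars K" for i using q r by (simp add: q'_def)
  then have q'K: "q' i \<in> K" "q i \<in> K" for i using q(1) rational_scalars_subset by blast+
  have cK: "c i \<in> K" if "i < Suc n" for i using Suc.prems that by blast
  have Sq: "S q' = S q"
    unfolding S_def by (rule M.finsum_cong') (auto simp: q'_def a q'K)
  have car: "S c \<in> carrier V" "S q \<in> carrier V"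
    unfolding S_def using a cK q'K by (auto intro!: M.finsum_closed)
  have rK: "r \<in> K" using q'K(1)[of n] by (simp add: q'_def)
  have last: "hnorm V (c n \<odot>\<^bsub>V\<^esub> a n \<ominus>\<^bsub>V\<^esub> r \<odot>\<^bsub>V\<^esub> a n) < \<epsilon> / 2"
  proof -
    have "(c n - r) \<odot>\<^bsub>V\<^esub> a n \<oplus>\<^bsub>V\<^esub> r \<odot>\<^bsub>V\<^esub> a n = c n \<odot>\<^bsub>V\<^esub> a n"
      using smult_l_distr[of "c n - r" r "a n"] diff_scalar[of "c n" r] cK rK a by simp
    then have "c n \<odot>\<^bsub>V\<^esub> a n \<ominus>\<^bsub>V\<^esub> r \<odot>\<^bsub>V\<^esub> a n = (c n - r) \<odot>\<^bsub>V\<^esub> a n"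
      using a cK rK diff_scalar[of "c n" r]
      by (metis M.a_assoc M.a_inv_closed M.r_neg M.r_zero a_minus_def lessI smult_closed_K)
    then have "hnorm V (c n \<odot>\<^bsub>V\<^esub> a n \<ominus>\<^bsub>V\<^esub> r \<odot>\<^bsub>V\<^esub> a n) = cmod (c n - r) * hnorm V (a n)"
      using a cK rK diff_scalar[of "c n" r] by (simp add: hnorm_smult)
    also have "\<dots> \<le> cmod (c n - r) * (hnorm V (a n) + 1)" by (simp add: mult_left_mono)
    also have "\<dots> < d * (hnorm V (a n) + 1)" using r pos by (intro mult_strict_right_mono)
    also have "\<dots> = \<epsilon> / 2" unfolding d_def using pos by (metis nonzero_eq_divide_eq less_irrefl)
    finally show ?thesis .
  qed
  have "(\<Oplus>\<^bsub>V\<^esub> i\<in>{..<Suc n}. c i \<odot>\<^bsub>V\<^esub> a i) \<ominus>\<^bsub>V\<^esub> (\<Oplus>\<^bsub>V\<^esub> i\<in>{..<Suc n}. q' i \<odot>\<^bsub>V\<^esub> a i) =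
      (S c \<oplus>\<^bsub>V\<^esub> c n \<odot>\<^bsub>V\<^esub> a n) \<ominus>\<^bsub>V\<^esub> (S q \<oplus>\<^bsub>V\<^esub> r \<odot>\<^bsub>V\<^esub> a n)"
    using finsum_smult_Suc(1)[of a n c] finsum_smult_Suc(1)[of a n q'] a cK q'K Sq
    by (simp add: S_def q'_def)
  also have "\<dots> = (S c \<ominus>\<^bsub>V\<^esub> S q) \<oplus>\<^bsub>V\<^esub> (c n \<odot>\<^bsub>V\<^esub> a n \<ominus>\<^bsub>V\<^esub> r \<odot>\<^bsub>V\<^esub> a n)"
    using car a cK rK by (simp add: a_minus_def M.minus_add M.a_ac)
  finally have "hnorm V ((\<Oplus>\<^bsub>V\<^esub> i\<in>{..<Suc n}. c i \<odot>\<^bsub>V\<^esub> a i) \<ominus>\<^bsub>V\<^esub> (\<Oplus>\<^bsub>V\<^esub> i\<in>{..<Suc n}. q' i \<odot>\<^bsub>V\<^esub> a i))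
      \<le> hnorm V (S c \<ominus>\<^bsub>V\<^esub> S q) + hnorm V (c n \<odot>\<^bsub>V\<^esub> a n \<ominus>\<^bsub>V\<^esub> r \<odot>\<^bsub>V\<^esub> a n)"
    using hnorm_triangle[of "S c \<ominus>\<^bsub>V\<^esub> S q" "c n \<odot>\<^bsub>V\<^esub> a n \<ominus>\<^bsub>V\<^esub> r \<odot>\<^bsub>V\<^esub> a n"] car a cK rK by simp
  then show ?case using q(2) last q' by (intro exI[of _ q']) auto
qed

lemma rational_lincomb_dense:
  assumes a: "\<And>i. a i \<in> carrier V" and tot: "total_sequence K V a" and v: "v \<in> carrier V" and \<epsilon>: "\<epsilon> > 0"
  shows "\<exists>cs\<in>lists (rational_scalars K). hnorm V (v \<ominus>\<^bsub>V\<^esub> lincomb V a cs) < \<epsilon>"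
proof -
  obtain N c where c: "\<forall>i<N. c i \<in> K" "hnorm V (v \<ominus>\<^bsub>V\<^esub> (\<Oplus>\<^bsub>V\<^esub> i\<in>{..<N}. c i \<odot>\<^bsub>V\<^esub> a i)) < \<epsilon>/2"
    using tot v half_gt_zero[OF \<epsilon>] unfolding total_sequence_def by meson
  obtain q where q: "\<And>i. q i \<in> rational_scalars K"
    "hnorm V ((\<Oplus>\<^bsub>V\<^esub> i\<in>{..<N}. c i \<odot>\<^bsub>V\<^esub> a i) \<ominus>\<^bsub>V\<^esub> (\<Oplus>\<^bsub>V\<^esub> i\<in>{..<N}. q i \<odot>\<^bsub>V\<^esub> a i)) < \<epsilon>/2"
    using finsum_approx_rational[of a N c "\<epsilon>/2"] a c \<epsilon> by auto
  have qK: "q i \<in> K" for i using q(1) rational_scalars_subset by blast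
  have "lincomb V a (map q [0..<N]) = (\<Oplus>\<^bsub>V\<^esub> i\<in>{..<N}. q i \<odot>\<^bsub>V\<^esub> a i)"
    unfolding lincomb_def by (rule M.finsum_cong') (auto simp: a qK)
  moreover have "(\<Oplus>\<^bsub>V\<^esub> i\<in>{..<N}. c i \<odot>\<^bsub>V\<^esub> a i) \<in> carrier V" "(\<Oplus>\<^bsub>V\<^esub> i\<in>{..<N}. q i \<odot>\<^bsub>V\<^esub> a i) \<in> carrier V"
    using a c qK by (auto intro!: M.finsum_closed)
  ultimately have "hnorm V (v \<ominus>\<^bsub>V\<^esub> lincomb V a (map q [0..<N])) < \<epsilon>"
    using hdist_triangle[OF v, of "\<Oplus>\<^bsub>V\<^esub> i\<in>{..<N}. c i \<odot>\<^bsub>V\<^esub> a i" "\<Oplus>\<^bsub>V\<^esub> i\<in>{..<N}. q i \<odot>\<^bsub>V\<^esub> a i"] c(2) q(2)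
    by simp
  moreover have "map q [0..<N] \<in> lists (rational_scalars K)" using q(1) by auto
  ultimately show ?thesis by blast
qed

end

section \<open>Borel sections, their norms and countable selections\<close>

context hilbert_bundle
begin

lemma e_closed: "x \<in> space X \<Longrightarrow> e i x \<in> carrier (H x)"
  using fundamental_borel[of i] by (simp add: borel_section_def)

lemma borel_section_lincomb:
  assumes "set cs \<subseteq> K"
  shows "borel_section X H e (\<lambda>x. lincomb (H x) (\<lambda>i. e i x) cs)"
  unfolding borel_section_def
proof (intro conjI ballI allI)
  fix x assume "x \<in> space X"
  then show "lincomb (H x) (\<lambda>i. e i x) cs \<in> carrier (H x)"
    by (intro hilbert_space.lincomb_closed[OF fibre_hilbert] e_closed assms)
next
  fix n
  have "(\<lambda>x. \<Sum>i<length cs. cs ! i * ip (H x) (e i x) (e n x)) \<in> borel_measurable X"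
    using fundamental_borel unfolding borel_section_def
    by (intro borel_measurable_sum borel_measurable_times) auto
  also have "?this \<longleftrightarrow> (\<lambda>x. ip (H x) (lincomb (H x) (\<lambda>i. e i x) cs) (e n x)) \<in> borel_measurable X"
    using hilbert_space.ip_lincomb[OF fibre_hilbert] e_closed assms
    by (intro measurable_cong) auto
  finally show "(\<lambda>x. ip (H x) (lincomb (H x) (\<lambda>i. e i x) cs) (e n x)) \<in> borel_measurable X" .
qed

lemma borel_section_diff:
  assumes "borel_section X H e \<xi>" "borel_section X H e \<eta>"
  shows "borel_section X H e (\<lambda>x. \<xi> x \<ominus>\<^bsub>H x\<^esub> \<eta> x)"
  unfolding borel_section_def
proof (intro conjI ballI allI)
  fix x assume x: "x \<in> space X"
  interpret hilbert_space K "H x" using x by (rule fibre_hilbert)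
  show "\<xi> x \<ominus>\<^bsub>H x\<^esub> \<eta> x \<in> carrier (H x)" using assms x by (auto simp: borel_section_def)
next
  fix n
  have "(\<lambda>x. ip (H x) (\<xi> x) (e n x) - ip (H x) (\<eta> x) (e n x)) \<in> borel_measurable X"
    using assms unfolding borel_section_def by (intro borel_measurable_diff) auto
  also have "?this \<longleftrightarrow> (\<lambda>x. ip (H x) (\<xi> x \<ominus>\<^bsub>H x\<^esub> \<eta> x) (e n x)) \<in> borel_measurable X"
    using hilbert_space.ip_diff_left[OF fibre_hilbert] e_closed assms
    by (intro measurable_cong) (auto simp: borel_section_def)
  finally show "(\<lambda>x. ip (H x) (\<xi> x \<ominus>\<^bsub>H x\<^esub> \<eta> x) (e n x)) \<in> borel_measurable X" .
qed

text \<open>The norm is computed as a countable supremum: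
  \<open>\<parallel>\<xi>\<parallel>\<^sup>2 = sup\<^sub>d (2 Re \<langle>\<xi>, d\<rangle> - \<parallel>d\<parallel>\<^sup>2)\<close> over the rational combinations \<open>d\<close> of the fundamental
  sections, as the right-hand side is \<open>\<parallel>\<xi>\<parallel>\<^sup>2 - \<parallel>\<xi> - d\<parallel>\<^sup>2\<close>.\<close>

lemma borel_measurable_hnorm:
  assumes \<xi>: "borel_section X H e \<xi>"
  shows "(\<lambda>x. hnorm (H x) (\<xi> x)) \<in> borel_measurable X"
proof -
  define D where "D = lists (rational_scalars K)"
  have cD: "countable D" unfolding D_def by (intro countable_lists countable_rational_scalars)
  have DK: "set cs \<subseteq> K" if "cs \<in> D" for cs
    using that unfolding D_def rational_scalars_def by auto
  define d where "d cs x = lincomb (H x) (\<lambda>i. e i x) cs" for cs x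
  define g where "g cs x = 2 * Re (ip (H x) (\<xi> x) (d cs x)) - Re (ip (H x) (d cs x) (d cs x))" for cs x
  have \<xi>c: "\<xi> x \<in> carrier (H x)" if "x \<in> space X" for x
    using \<xi> that by (simp add: borel_section_def)
  have ipm: "(\<lambda>x. ip (H x) (\<eta> x) (d cs x)) \<in> borel_measurable X"
    if \<eta>: "borel_section X H e \<eta>" and "cs \<in> D" for \<eta> cs
  proof -
    have "(\<lambda>x. \<Sum>i<length cs. cnj (cs ! i) * ip (H x) (\<eta> x) (e i x)) \<in> borel_measurable X"
      using \<eta> unfolding borel_section_def
      by (intro borel_measurable_sum borel_measurable_times) auto
    also have "?this \<longleftrightarrow> ?thesis"
      using hilbert_space.ip_lincomb_right[OF fibre_hilbert] e_closed DK that
      by (intro measurable_cong) (auto simp: borel_section_def d_def)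
    finally show ?thesis .
  qed
  have dsec: "borel_section X H e (d cs)" if "cs \<in> D" for cs
    unfolding d_def using DK[OF that] by (rule borel_section_lincomb)
  have gm: "g cs \<in> borel_measurable X" if "cs \<in> D" for cs
    unfolding g_def using ipm[OF \<xi> that] ipm[OF dsec that] that by simp
  have eq: "c < (hnorm (H x) (\<xi> x))\<^sup>2 \<longleftrightarrow> (\<exists>cs\<in>D. c < g cs x)" if x: "x \<in> space X" for c x
  proof -
    interpret hilbert_space K "H x" using x by (rule fibre_hilbert)
    have dc: "d cs x \<in> carrier (H x)" if "cs \<in> D" for cs
      using dsec[OF that] x by (simp add: borel_section_def)
    have g: "g cs x = (hnorm (H x) (\<xi> x))\<^sup>2 - (hnorm (H x) (\<xi> x \<ominus>\<^bsub>H x\<^esub> d cs x))\<^sup>2" if "cs \<in> D" for cs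
      using hnorm_diff_sq[OF \<xi>c[OF x] dc[OF that]] Re_ip_self[OF dc[OF that]] by (simp add: g_def)
    show ?thesis
    proof
      assume c: "c < (hnorm (H x) (\<xi> x))\<^sup>2"
      \<comment> \<open>By the identity \<open>g\<close>, the inequality \<open>c < g cs x\<close>
        says that the distance from \<open>\<xi> x\<close> to \<open>d cs x\<close> is less than
        \<open>r\<close>.\<close>
      define r where "r = sqrt ((hnorm (H x) (\<xi> x))\<^sup>2 - c)"
      have r: "r > 0" using c by (simp add: r_def)
      obtain cs where cs: "cs \<in> D" "hnorm (H x) (\<xi> x \<ominus>\<^bsub>H x\<^esub> d cs x) < r"
        using rational_lincomb_dense[of "\<lambda>i. e i x" "\<xi> x" r] e_closed fundamental_total x \<xi>c r
        unfolding D_def d_def by blast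
      have "(hnorm (H x) (\<xi> x \<ominus>\<^bsub>H x\<^esub> d cs x))\<^sup>2 < r\<^sup>2"
        using cs dc \<xi>c[OF x] by (intro power_strict_mono hnorm_nonneg) auto
      also have "r\<^sup>2 = (hnorm (H x) (\<xi> x))\<^sup>2 - c" using c by (simp add: r_def)
      finally have "c < g cs x" using g[OF cs(1)] by simp
      then show "\<exists>cs\<in>D. c < g cs x" using cs(1) by blast
    next
      assume "\<exists>cs\<in>D. c < g cs x"
      then obtain cs where "cs \<in> D" "c < g cs x" by blast
      then show "c < (hnorm (H x) (\<xi> x))\<^sup>2"
        using g[of cs] zero_le_power2[of "hnorm (H x) (\<xi> x \<ominus>\<^bsub>H x\<^esub> d cs x)"] by linarith
    qed
  qed
  have "(\<lambda>x. (hnorm (H x) (\<xi> x))\<^sup>2) \<in> borel_measurable X"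
    unfolding borel_measurable_iff_greater
  proof
    fix c
    have "{x \<in> space X. c < (hnorm (H x) (\<xi> x))\<^sup>2} = (\<Union>cs\<in>D. {x \<in> space X. c < g cs x})"
      using eq by blast
    also have "\<dots> \<in> sets X"
      using gm by (intro sets.countable_UN' cD) (auto simp: borel_measurable_iff_greater)
    finally show "{x \<in> space X. c < (hnorm (H x) (\<xi> x))\<^sup>2} \<in> sets X" .
  qed
  then have "(\<lambda>x. sqrt ((hnorm (H x) (\<xi> x))\<^sup>2)) \<in> borel_measurable X"
    by (rule measurable_compose[OF _ borel_measurable_sqrt])
  also have "?this \<longleftrightarrow> ?thesis"
    using hilbert_space.hnorm_nonneg[OF fibre_hilbert \<xi>c] by (intro measurable_cong) auto
  finally show ?thesis .
qed

lemma borel_section_limit: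
  assumes \<xi>: "\<And>n::nat. borel_section X H e (\<xi> n)" and \<eta>: "\<And>x. x \<in> space X \<Longrightarrow> \<eta> x \<in> carrier (H x)"
    and lim: "\<And>x. x \<in> space X \<Longrightarrow> (\<lambda>n. hnorm (H x) (\<xi> n x \<ominus>\<^bsub>H x\<^esub> \<eta> x)) \<longlonglongrightarrow> 0"
  shows "borel_section X H e \<eta>"
  unfolding borel_section_def
proof (intro conjI ballI allI \<eta>)
  fix i
  show "(\<lambda>x. ip (H x) (\<eta> x) (e i x)) \<in> borel_measurable X"
  proof (rule borel_measurable_LIMSEQ_metric)
    show "(\<lambda>x. ip (H x) (\<xi> n x) (e i x)) \<in> borel_measurable X" for n
      using \<xi> by (simp add: borel_section_def)
    show "(\<lambda>n. ip (H x) (\<xi> n x) (e i x)) \<longlonglongrightarrow> ip (H x) (\<eta> x) (e i x)" if x: "x \<in> space X" for x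
      using \<xi> x \<eta> lim e_closed
      by (intro hilbert_space.tendsto_ip[OF fibre_hilbert]) (auto simp: borel_section_def)
  qed
qed

text \<open>Gluing along the countable Borel partition given by \<open>k\<close>; it serves for
  selection by a first index and for definition by cases.\<close>

lemma borel_section_countable:
  assumes \<xi>: "\<And>n::nat. borel_section X H e (\<xi> n)" and k: "k \<in> X \<rightarrow>\<^sub>M count_space UNIV"
  shows "borel_section X H e (\<lambda>x. \<xi> (k x) x)"
  unfolding borel_section_def
proof (intro conjI ballI allI)
  show "\<xi> (k x) x \<in> carrier (H x)" if "x \<in> space X" for x
    using \<xi> that by (simp add: borel_section_def)
  show "(\<lambda>x. ip (H x) (\<xi> (k x) x) (e i x)) \<in> borel_measurable X" for i
    using \<xi> unfolding borel_section_def
    by (intro measurable_compose_countable[of "\<lambda>n x. ip (H x) (\<xi> n x) (e i x)", OF _ k]) auto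
qed

lemma borel_section_dense_sequence:
  "\<exists>d. (\<forall>k::nat. borel_section X H e (d k)) \<and>
     (\<forall>x\<in>space X. \<forall>v\<in>carrier (H x). \<forall>\<epsilon>>0. \<exists>k. hnorm (H x) (v \<ominus>\<^bsub>H x\<^esub> d k x) < \<epsilon>)"
proof -
  define D where "D = lists (rational_scalars K)"
  have cD: "countable D" unfolding D_def by (intro countable_lists countable_rational_scalars)
  have ne: "D \<noteq> {}" unfolding D_def by auto
  have DK: "set cs \<subseteq> K" if "cs \<in> D" for cs
    using that unfolding D_def rational_scalars_def by auto
  define d where "d k x = lincomb (H x) (\<lambda>i. e i x) (from_nat_into D k)" for k x
  have "borel_section X H e (d k)" for k
    unfolding d_def using DK from_nat_into[OF ne] by (intro borel_section_lincomb) blast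
  moreover have "\<exists>k. hnorm (H x) (v \<ominus>\<^bsub>H x\<^esub> d k x) < \<epsilon>"
    if x: "x \<in> space X" "v \<in> carrier (H x)" "\<epsilon> > 0" for x v \<epsilon>
  proof -
    obtain cs where cs: "cs \<in> D" "hnorm (H x) (v \<ominus>\<^bsub>H x\<^esub> lincomb (H x) (\<lambda>i. e i x) cs) < \<epsilon>"
      using hilbert_space.rational_lincomb_dense[OF fibre_hilbert, of x "\<lambda>i. e i x" v \<epsilon>]
        e_closed fundamental_total x unfolding D_def by blast
    obtain k where "from_nat_into D k = cs" using from_nat_into_surj[OF cD cs(1)] by blast
    then show ?thesis using cs(2) by (auto simp: d_def)
  qed
  ultimately show ?thesis by blast
qed

lemma borel_section_zero: "borel_section X H e (\<lambda>x. \<zero>\<^bsub>H x\<^esub>)"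
proof -
  have "lincomb (H x) (\<lambda>i. e i x) [] = \<zero>\<^bsub>H x\<^esub>" if "x \<in> space X" for x
  proof -
    interpret hilbert_space K "H x" using that by (rule fibre_hilbert)
    show ?thesis by (simp add: lincomb_def)
  qed
  moreover have "borel_section X H e (\<lambda>x. lincomb (H x) (\<lambda>i. e i x) [])"
    by (rule borel_section_lincomb) simp
  ultimately show ?thesis
    unfolding borel_section_def by (simp cong: measurable_cong)
qed

lemma borel_section_if:
  assumes S: "S \<in> sets X" and \<xi>: "borel_section X H e \<xi>"
  shows "borel_section X H e (\<lambda>x. if x \<in> S then \<xi> x else \<zero>\<^bsub>H x\<^esub>)"
proof -
  define s where "s n = (if n = 0 then \<lambda>x. \<zero>\<^bsub>H x\<^esub> else \<xi>)" for n :: nat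
  have "borel_section X H e (\<lambda>x. s (if x \<in> S then 1 else 0) x)"
  proof (rule borel_section_countable)
    show "borel_section X H e (s n)" for n
      using borel_section_zero \<xi> by (cases n) (simp_all add: s_def)
    show "(\<lambda>x. if x \<in> S then 1 else 0) \<in> X \<rightarrow>\<^sub>M count_space (UNIV :: nat set)"
      using S by measurable
  qed
  also have "(\<lambda>x. s (if x \<in> S then 1 else 0) x) = (\<lambda>x. if x \<in> S then \<xi> x else \<zero>\<^bsub>H x\<^esub>)"
    by (auto simp: s_def)
  finally show ?thesis .
qed

text \<open>The center is the limit of Borel sections \<open>\<xi> n\<close>, where
  \<open>\<xi> n\<close> picks the first nearly minimal member of a dense sequence of sections. All
  measurability is thereby reduced to the sets where a given Borel section has radius at most
  \<open>c\<close>.\<close>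

lemma borel_section_chebyshev_center:
  assumes S: "S \<in> sets X"
    and F: "\<And>x. x \<in> S \<Longrightarrow> F x \<noteq> bot" "\<And>x. x \<in> S \<Longrightarrow> \<forall>\<^sub>F i in F x. f i \<in> carrier (H x)"
    and bounded: "\<And>x. x \<in> S \<Longrightarrow> \<exists>v\<in>carrier (H x). \<exists>c. enclosed (H x) (F x) f v c"
    and meas: "\<And>d c. borel_section X H e d \<Longrightarrow> {x \<in> S. enclosed (H x) (F x) f (d x) c} \<in> sets X"
  shows "borel_section X H e
    (\<lambda>x. if x \<in> S then THE v. chebyshev_center (H x) (F x) f v else \<zero>\<^bsub>H x\<^esub>)"
proof -
  obtain d where d: "\<And>k::nat. borel_section X H e (d k)"
    and dense: "\<And>x v \<epsilon>. x \<in> space X \<Longrightarrow> v \<in> carrier (H x) \<Longrightarrow> \<epsilon> > 0 \<Longrightarrow>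
      \<exists>k. hnorm (H x) (v \<ominus>\<^bsub>H x\<^esub> d k x) < \<epsilon>"
    using borel_section_dense_sequence by blast
  have SX: "x \<in> space X" if "x \<in> S" for x using S that sets.sets_into_space by blast
  have dc: "d k x \<in> carrier (H x)" if "x \<in> space X" for k x
    using d that by (simp add: borel_section_def)
  \<comment> \<open>Only rational \<open>c\<close> and competitors from the sequence are allowed, so
    that the condition is a countable combination of Borel ones. The price is a factor 2 in
    near-minimality, paid at \<open>near\<close>.\<close>
  define P where "P n k x \<longleftrightarrow> x \<in> S \<and> (\<exists>c\<in>\<rat>. enclosed (H x) (F x) f (d k x) c \<and>
    (\<forall>j. \<not> enclosed (H x) (F x) f (d j x) (c - 1 / real (Suc n))))" for n k x
  have P_meas: "Measurable.pred X (P n k)" for n k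
  proof -
    have "{x \<in> space X. P n k x} = (\<Union>c\<in>\<rat>. {x \<in> S. enclosed (H x) (F x) f (d k x) c} -
        (\<Union>j. {x \<in> S. enclosed (H x) (F x) f (d j x) (c - 1 / real (Suc n))}))"
      using SX unfolding P_def by blast
    also have "\<dots> \<in> sets X"
      using meas[OF d] by (intro sets.countable_UN' sets.Diff countable_rat) auto
    finally show ?thesis by (simp add: pred_def)
  qed
  have ex_P: "\<exists>k. P n k x" if x: "x \<in> S" for n x
  proof -
    interpret hilbert_space K "H x" using SX[OF x] by (rule fibre_hilbert)
    obtain v c where v: "v \<in> carrier (H x)" "enclosed (H x) (F x) f v c" using bounded x by blast
    obtain k where k: "hnorm (H x) (v \<ominus>\<^bsub>H x\<^esub> d k x) < 1" using dense[OF SX[OF x] v(1), of 1] by auto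
    \<comment> \<open>A section within distance 1 of \<open>v\<close> has radius at most
      \<open>c + 1\<close>; a rational \<open>c0\<close> makes the descending radii rational
      too.\<close>
    obtain c0 where c0: "c0 \<in> \<rat>" "c + 1 < c0" using Rats_dense_in_real[of "c + 1" "c + 2"] by auto
    have "enclosed (H x) (F x) f (d k x) c0"
      using enclosed_shift[OF v(2,1) dc[OF SX[OF x]] F(2)[OF x], of k 1] k c0 enclosed_mono by force
    moreover have "range (\<lambda>k. d k x) \<subseteq> carrier (H x)" using dc[OF SX[OF x]] by blast
    ultimately obtain j i where ji: "enclosed (H x) (F x) f (d j x) (c0 - real i * (1 / real (Suc n)))"
        "\<forall>u\<in>range (\<lambda>k. d k x). \<not> enclosed (H x) (F x) f u (c0 - real i * (1 / real (Suc n)) - 1 / real (Suc n))"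
      using ex_nearly_minimal_in[of "d k x" "range (\<lambda>k. d k x)" "F x" f c0 "1 / real (Suc n)"]
        F(1)[OF x] F(2)[OF x] by (force simp del: of_nat_Suc)
    have "c0 - real i * (1 / real (Suc n)) \<in> \<rat>"
      using c0(1) by (intro Rats_diff Rats_mult Rats_divide Rats_of_nat Rats_1)
    then have "P n j x" unfolding P_def using ji x by blast
    then show ?thesis ..
  qed
  define k where "k n x = (LEAST k. P n k x)" for n x
  have Pk: "P n (k n x) x" if "x \<in> S" for n x
    unfolding k_def using ex_P[OF that] by (rule LeastI_ex)
  define \<xi> where "\<xi> n x = (if x \<in> S then d (k n x) x else \<zero>\<^bsub>H x\<^esub>)" for n x
  have "k n \<in> X \<rightarrow>\<^sub>M count_space UNIV" for n
    unfolding k_def[abs_def] by (intro measurable_Least P_meas)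
  then have "borel_section X H e (\<lambda>x. d (k n x) x)" for n
    by (rule borel_section_countable[OF d])
  then have \<xi>: "borel_section X H e (\<xi> n)" for n
    unfolding \<xi>_def by (rule borel_section_if[OF S])
  define \<eta> where "\<eta> x = (if x \<in> S then THE v. chebyshev_center (H x) (F x) f v else \<zero>\<^bsub>H x\<^esub>)" for x
  have center: "chebyshev_center (H x) (F x) f (\<eta> x)" if x: "x \<in> S" for x
  proof -
    interpret hilbert_space K "H x" using SX[OF x] by (rule fibre_hilbert)
    obtain v c where v: "v \<in> carrier (H x)" "enclosed (H x) (F x) f v c" using bounded x by blast
    have "\<exists>!u. chebyshev_center (H x) (F x) f u"
      using ex_chebyshev_center[OF v F(2,1)[OF x]] chebyshev_center_unique[OF _ _ v F(2,1)[OF x]] by blast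
    then show ?thesis using theI' x unfolding \<eta>_def by simp
  qed
  have near: "nearly_minimal (H x) (F x) f (2 / real (Suc n)) (\<xi> n x)" if x: "x \<in> S" for n x
  proof -
    interpret hilbert_space K "H x" using SX[OF x] by (rule fibre_hilbert)
    obtain c where c: "enclosed (H x) (F x) f (\<xi> n x) c"
        "\<And>j. \<not> enclosed (H x) (F x) f (d j x) (c - 1 / real (Suc n))"
      using Pk[OF x] x unfolding P_def \<xi>_def by auto
    \<comment> \<open>An arbitrary competitor \<open>u\<close> is replaced by a member of the
      sequence within \<open>1 / real (Suc n)\<close>, which costs as much in radius.\<close>
    have "\<not> enclosed (H x) (F x) f u (c - 2 / real (Suc n))" if u: "u \<in> carrier (H x)" for u
    proof
      assume enc: "enclosed (H x) (F x) f u (c - 2 / real (Suc n))"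
      obtain j where "hnorm (H x) (u \<ominus>\<^bsub>H x\<^esub> d j x) < 1 / real (Suc n)"
        using dense[OF SX[OF x] u, of "1 / real (Suc n)"] by auto
      then have "enclosed (H x) (F x) f (d j x) (c - 2 / real (Suc n) + 1 / real (Suc n))"
        by (intro enclosed_shift[OF enc u dc[OF SX[OF x]] F(2)[OF x]]) (rule less_imp_le)
      moreover have "c - 2 / real (Suc n) + 1 / real (Suc n) = c - 1 / real (Suc n)"
        by (simp add: field_simps)
      ultimately show False using c(2) by metis
    qed
    then show ?thesis using c(1) unfolding nearly_minimal_def by blast
  qed
  have "borel_section X H e \<eta>"
  proof (rule borel_section_limit[OF \<xi>])
    fix x assume x: "x \<in> space X"
    interpret hilbert_space K "H x" using x by (rule fibre_hilbert)
    have \<xi>c: "\<xi> n x \<in> carrier (H x)" for n using \<xi> x by (simp add: borel_section_def)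
    show "\<eta> x \<in> carrier (H x)"
      using center[of x] by (cases "x \<in> S") (auto simp: chebyshev_center_def \<eta>_def)
    show "(\<lambda>n. hnorm (H x) (\<xi> n x \<ominus>\<^bsub>H x\<^esub> \<eta> x)) \<longlonglongrightarrow> 0"
    proof (cases "x \<in> S")
      case True
      then show ?thesis using chebyshev_center_tendsto[OF center \<xi>c near] by blast
    next
      case False
      then show ?thesis by (simp add: \<xi>_def \<eta>_def a_minus_def M.r_neg)
    qed
  qed
  then show ?thesis by (simp add: \<eta>_def[abs_def])
qed

end

text \<open>A cocycle is a section over the arrows, in the bundle pulled back by the range map; this
  brings it under the results on Borel sections.\<close>

lemma hilbert_bundle_pullback:
  assumes "hilbert_bundle K X H e" "f \<in> Y \<rightarrow>\<^sub>M X"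
  shows "hilbert_bundle K Y (H \<circ> f) (\<lambda>n. e n \<circ> f)"
proof -
  interpret hilbert_bundle K X H e by fact
  show ?thesis
  proof (rule hilbert_bundle.intro)
    show "hilbert_space K ((H \<circ> f) y)" if "y \<in> space Y" for y
      using fibre_hilbert measurable_space[OF assms(2) that] by simp
    show "total_sequence K ((H \<circ> f) y) (\<lambda>n. (e n \<circ> f) y)" if "y \<in> space Y" for y
      using fundamental_total measurable_space[OF assms(2) that] by simp
    show "borel_section Y (H \<circ> f) (\<lambda>n. e n \<circ> f) (e n \<circ> f)" for n
      using fundamental_borel[of n] measurable_space[OF assms(2)]
        measurable_compose[OF assms(2), of "\<lambda>x. ip (H x) (e n x) (e _ x)"]
      by (auto simp: borel_section_def)
  qed
qed

lemma borel_section_pullback: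
  assumes "borel_section X H e \<xi>" "f \<in> Y \<rightarrow>\<^sub>M X"
  shows "borel_section Y (H \<circ> f) (\<lambda>n. e n \<circ> f) (\<lambda>y. \<xi> (f y))"
  using assms(1) measurable_space[OF assms(2)]
    measurable_compose[OF assms(2), of "\<lambda>x. ip (H x) (\<xi> x) (e _ x)"]
  by (auto simp: borel_section_def)

section \<open>Borel groupoids\<close>

context borel_groupoid
begin

lemma rng_arrows [simp]: "\<gamma> \<in> arrows G \<Longrightarrow> rng G \<gamma> \<in> units G"
  by (simp add: units_def)

lemma src_arrows [simp]: "\<gamma> \<in> arrows G \<Longrightarrow> src G \<gamma> \<in> units G"
  using rng_src src_closed by (metis image_eqI units_def)

lemma units_arrows: "x \<in> units G \<Longrightarrow> x \<in> arrows G \<and> rng G x = x \<and> src G x = x"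
  using rng_closed rng_rng src_rng by (auto simp: units_def)

text \<open>A unit is an arrow equal to its own range, and equality is a Borel condition.\<close>

lemma units_sets: "units G \<in> sets (arr G)"
proof -
  have "units G = {x \<in> space (arr G). rng G x = x}"
    using units_arrows rng_arrows unfolding arrows_def by force
  then show ?thesis using standard_borel_equalizer[OF standard rng_borel, of "\<lambda>x. x"] by simp
qed

lemma space_unit_space [simp]: "space (unit_space G) = units G"
  using units_arrows by (auto simp: unit_space_def space_restrict_space arrows_def)

lemma sets_unit_space: "A \<in> sets (unit_space G) \<longleftrightarrow> A \<subseteq> units G \<and> A \<in> sets (arr G)"
  unfolding unit_space_def by (rule sets_restrict_space_iff) (simp add: units_sets)

lemma sets_unit_space_subset: "A \<in> sets (unit_space G) \<Longrightarrow> A \<subseteq> units G"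
  by (simp add: sets_unit_space)

lemma rng_unit_space [measurable]: "rng G \<in> arr G \<rightarrow>\<^sub>M unit_space G"
  unfolding unit_space_def using rng_borel
  by (intro measurable_restrict_space2) (auto simp: arrows_def[symmetric])

lemma src_unit_space [measurable]: "src G \<in> arr G \<rightarrow>\<^sub>M unit_space G"
  unfolding unit_space_def using src_borel
  by (intro measurable_restrict_space2) (auto simp: arrows_def[symmetric])

lemma rng_vimage_sets: "A \<in> sets (unit_space G) \<Longrightarrow> {\<gamma> \<in> arrows G. rng G \<gamma> \<in> A} \<in> sets (arr G)"
  using measurable_sets[OF rng_unit_space, of A]
  by (simp add: vimage_def Int_def arrows_def conj_commute)

lemma src_vimage_sets: "A \<in> sets (unit_space G) \<Longrightarrow> {\<gamma> \<in> arrows G. src G \<gamma> \<in> A} \<in> sets (arr G)"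
  using measurable_sets[OF src_unit_space, of A]
  by (simp add: vimage_def Int_def arrows_def conj_commute)

section \<open>Saturations and strictly invariant Borel sets\<close>

definition saturation :: "'g set \<Rightarrow> 'g set" where
  "saturation A = src G ` {\<gamma> \<in> arrows G. rng G \<gamma> \<in> A}"

lemma subset_saturation: "A \<subseteq> units G \<Longrightarrow> A \<subseteq> saturation A"
  unfolding saturation_def using units_arrows
  by (auto intro!: image_eqI[of _ "src G"])

lemma saturation_disjoint:
  assumes "\<And>\<gamma>. \<gamma> \<in> arrows G \<Longrightarrow> rng G \<gamma> \<in> A \<Longrightarrow> src G \<gamma> \<notin> saturation B"
  shows "saturation A \<inter> saturation B = {}"
  using assms unfolding saturation_def by blast

lemma saturation_invariant:
  assumes "\<gamma> \<in> arrows G" "src G \<gamma> \<in> saturation B"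
  shows "rng G \<gamma> \<in> saturation B"
proof -
  obtain \<eta> where \<eta>: "\<eta> \<in> arrows G" "rng G \<eta> \<in> B" "src G \<eta> = src G \<gamma>"
    using assms(2) by (auto simp: saturation_def)
  have c: "(\<eta>, ginv G \<gamma>) \<in> composable G"
    using \<eta> assms(1) ginv_closed rng_ginv by (simp add: composable_def)
  have "mul G \<eta> (ginv G \<gamma>) \<in> arrows G" "rng G (mul G \<eta> (ginv G \<gamma>)) \<in> B"
    "src G (mul G \<eta> (ginv G \<gamma>)) = rng G \<gamma>"
    using mul_closed[OF c] rng_mul[OF c] src_mul[OF c] \<eta> src_ginv[OF assms(1)] by simp_all
  then show ?thesis unfolding saturation_def by (auto intro!: image_eqI[of _ _ "mul G \<eta> (ginv G \<gamma>)"])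
qed

text \<open>The saturation of a Borel set is analytic only, but by Lusin's theorem it can be separated from
  the disjoint saturation of \<open>B\<close> by a Borel set. The union of the sets obtained by alternating
  saturation and separation is strictly invariant.\<close>

lemma invariant_separation:
  assumes A: "A \<in> sets (unit_space G)" and B: "B \<in> sets (unit_space G)"
    and noarrow: "\<And>\<gamma>. \<gamma> \<in> arrows G \<Longrightarrow> rng G \<gamma> \<in> A \<Longrightarrow> src G \<gamma> \<notin> B"
  shows "\<exists>A'\<in>sets (unit_space G). invariant_set G A' \<and> A \<subseteq> A' \<and> A' \<inter> B = {}"
proof -
  \<comment> \<open>Avoiding the whole saturation of \<open>B\<close>, rather than \<open>B\<close>,
    is what survives the next saturation: no arrow leads from outside an invariant set into
    it.\<close>
  define P where "P S \<longleftrightarrow> S \<in> sets (unit_space G) \<and> A \<subseteq> S \<and> S \<inter> saturation B = {}" for S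
  have sub: "A \<subseteq> units G" "B \<subseteq> units G" using A B by (simp_all add: sets_unit_space)
  have "\<exists>S. P S"
  proof -
    have "rng G \<gamma> \<notin> A" if "\<gamma> \<in> arrows G" "src G \<gamma> \<in> B" for \<gamma> using noarrow that by blast
    then have "A \<inter> saturation B = {}"
      using noarrow ginv_closed rng_ginv src_ginv unfolding saturation_def by fastforce
    then show ?thesis using A by (auto simp: P_def)
  qed
  moreover have "\<exists>S'. P S' \<and> saturation S \<subseteq> S'" if S: "P S" for S
  proof -
    have S': "S \<in> sets (unit_space G)" using S by (simp add: P_def)
    have disj: "saturation S \<inter> saturation B = {}"
      using S saturation_invariant by (intro saturation_disjoint) (auto simp: P_def)
    \<comment> \<open>Both saturations are images under \<open>src G\<close> of Borel sets of
      arrows.\<close>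
    have "\<exists>W\<in>sets (arr G). saturation S \<subseteq> W \<and> W \<inter> saturation B = {}"
      unfolding saturation_def
      by (rule Lusin_separation[OF standard standard src_borel rng_vimage_sets[OF S']
            rng_vimage_sets[OF B] disj[unfolded saturation_def]])
    then obtain W where W: "W \<in> sets (arr G)" "saturation S \<subseteq> W" "W \<inter> saturation B = {}" by blast
    have Su: "S \<subseteq> units G" using S by (simp add: P_def sets_unit_space)
    have "saturation S \<subseteq> units G" by (auto simp: saturation_def)
    then have "P (W \<inter> units G)" "saturation S \<subseteq> W \<inter> units G"
      using W S subset_saturation[OF Su] units_sets by (auto simp: P_def sets_unit_space)
    then show ?thesis by blast
  qed
  ultimately have "\<exists>S. \<forall>n::nat. P (S n) \<and> saturation (S n) \<subseteq> S (Suc n)"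
    by (intro dependent_nat_choice) auto
  then obtain S where S: "\<And>n::nat. P (S n)" "\<And>n. saturation (S n) \<subseteq> S (Suc n)" by blast
  define A' where "A' = (\<Union>n. S n)"
  have A': "A' \<in> sets (unit_space G)" "A \<subseteq> A'" "A' \<inter> saturation B = {}"
    using S(1) unfolding A'_def P_def by auto
  have "saturation A' \<subseteq> A'"
  proof -
    have "saturation A' = (\<Union>n. saturation (S n))" unfolding A'_def saturation_def by blast
    then show ?thesis using S(2) unfolding A'_def by blast
  qed
  then have "invariant_set G A'"
    using subset_saturation[of A'] A'(1) unfolding invariant_set_def saturation_def sets_unit_space by blast
  then show ?thesis using A' subset_saturation[OF sub(2)] by blast
qed

lemma composableI: "\<gamma> \<in> arrows G \<Longrightarrow> \<eta> \<in> arrows G \<Longrightarrow> src G \<gamma> = rng G \<eta> \<Longrightarrow> (\<gamma>, \<eta>) \<in> composable G"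
  by (simp add: composable_def)

lemma fibre_sets: "x \<in> units G \<Longrightarrow> fibre G x \<in> sets (arr G)"
  using standard_borel_equalizer[OF standard rng_borel, of "\<lambda>_. x"] units_arrows[of x]
  by (simp add: fibre_def arrows_def)

lemma mul_left_measurable:
  assumes "\<gamma> \<in> arrows G"
  shows "mul G \<gamma> \<in> restrict_space (arr G) (fibre G (src G \<gamma>)) \<rightarrow>\<^sub>M arr G"
proof -
  have "(\<lambda>\<eta>. (\<gamma>, \<eta>)) \<in> restrict_space (arr G) (fibre G (src G \<gamma>)) \<rightarrow>\<^sub>M
      restrict_space (arr G \<Otimes>\<^sub>M arr G) (composable G)"
  proof (rule measurable_restrict_space2)
    show "(\<lambda>\<eta>. (\<gamma>, \<eta>)) \<in> space (restrict_space (arr G) (fibre G (src G \<gamma>))) \<rightarrow> composable G"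
      using assms by (auto simp: space_restrict_space fibre_def composable_def)
    show "(\<lambda>\<eta>. (\<gamma>, \<eta>)) \<in> restrict_space (arr G) (fibre G (src G \<gamma>)) \<rightarrow>\<^sub>M arr G \<Otimes>\<^sub>M arr G"
      using assms by (intro measurable_restrict_space1 measurable_Pair1') (simp add: arrows_def)
  qed
  from measurable_compose[OF this mul_borel] show ?thesis by simp
qed

end

section \<open>Quasi-invariant systems of measures\<close>

text \<open>One probability measure stands for the measure class, and conullity of a set of units is
  phrased as an almost sure property of the range. \<open>U\<close> may be replaced by a smaller
  conull Borel set, so that further exceptional sets can be absorbed.\<close>

locale quasi_invariant_system = borel_groupoid G for G :: "'g groupoid" +
  fixes \<nu> :: "'g measure" and \<kappa> :: "'g \<Rightarrow> 'g measure" and U :: "'g set"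
  assumes prob: "prob_space \<nu>" and sets_nu: "sets \<nu> = sets (arr G)"
    and sym: "measure_equiv \<nu> (distr \<nu> (arr G) (ginv G))"
    and dis: "disintegration_along_rng G \<nu> \<kappa>"
    and U_sets: "U \<in> sets (unit_space G)" and AE_U: "AE \<gamma> in \<nu>. rng G \<gamma> \<in> U"
    and quasi_invariant: "\<gamma> \<in> reduction G U \<Longrightarrow>
      measure_equiv (translate G \<gamma> (\<kappa> (src G \<gamma>))) (\<kappa> (rng G \<gamma>))"
begin

sublocale nu: prob_space \<nu> by (rule prob)

lemma space_nu: "space \<nu> = arrows G"
  using sets_eq_imp_space_eq[OF sets_nu] by (simp add: arrows_def)

lemma kernel: "\<kappa> \<in> unit_space G \<rightarrow>\<^sub>M prob_algebra (arr G)"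
  using dis by (simp add: disintegration_along_rng_def)

lemma kappa:
  assumes "x \<in> units G"
  shows prob_kappa: "prob_space (\<kappa> x)" and sets_kappa: "sets (\<kappa> x) = sets (arr G)"
    and space_kappa: "space (\<kappa> x) = arrows G"
  using measurable_space[OF kernel, of x] assms sets_eq_imp_space_eq[of "\<kappa> x" "arr G"]
  by (auto simp: space_prob_algebra arrows_def)

lemma emeasure_kappa_measurable:
  "N \<in> sets (arr G) \<Longrightarrow> (\<lambda>x. emeasure (\<kappa> x) N) \<in> borel_measurable (unit_space G)"
  using measurable_emeasure_kernel[OF measurable_prob_algebraD[OF kernel]] .

lemma AE_kappa_fibre:
  assumes "x \<in> units G"
  shows "AE \<gamma> in \<kappa> x. \<gamma> \<in> arrows G \<and> rng G \<gamma> = x"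
proof -
  interpret prob_space "\<kappa> x" by (rule prob_kappa[OF assms])
  have *: "{\<gamma> \<in> space (\<kappa> x). \<gamma> \<in> arrows G \<and> rng G \<gamma> = x} = fibre G x"
    using space_kappa[OF assms] by (auto simp: fibre_def)
  show ?thesis
  proof (rule AE_I_eq_1)
    show "emeasure (\<kappa> x) {\<gamma> \<in> space (\<kappa> x). \<gamma> \<in> arrows G \<and> rng G \<gamma> = x} = 1"
      using dis assms unfolding * by (simp add: disintegration_along_rng_def)
    show "{\<gamma> \<in> space (\<kappa> x). \<gamma> \<in> arrows G \<and> rng G \<gamma> = x} \<in> events"
      unfolding * using fibre_sets[OF assms] sets_kappa[OF assms] by simp
  qed
qed

lemma rng_nu: "rng G \<in> \<nu> \<rightarrow>\<^sub>M unit_space G"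
  using rng_unit_space measurable_cong_sets[OF sets_nu refl] by blast

lemma null_nu_iff:
  assumes N: "N \<in> sets (arr G)"
  shows "emeasure \<nu> N = 0 \<longleftrightarrow> (AE \<gamma> in \<nu>. emeasure (\<kappa> (rng G \<gamma>)) N = 0)"
proof -
  have m: "(\<lambda>x. emeasure (\<kappa> x) N) \<in> borel_measurable (distr \<nu> (unit_space G) (rng G))"
    using emeasure_kappa_measurable[OF N] by simp
  have "{x \<in> space (unit_space G). emeasure (\<kappa> x) N = 0} \<in> sets (unit_space G)"
    using emeasure_kappa_measurable[OF N] by measurable
  then show ?thesis
    using dis N nn_integral_0_iff_AE[OF m] AE_distr_iff[OF rng_nu]
    unfolding disintegration_along_rng_def by simp
qed

text \<open>Fubini for null sets: a Borel null set containing the exceptions is null for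
  \<open>\<kappa> x\<close> at almost every unit \<open>x\<close>, and these units form a Borel set
  because \<open>\<kappa>\<close> is a kernel.\<close>

lemma AE_disintegration:
  assumes "AE \<gamma> in \<nu>. P \<gamma>"
  shows "\<exists>V\<in>sets (unit_space G). (AE \<gamma> in \<nu>. rng G \<gamma> \<in> V) \<and> (\<forall>x\<in>V. AE \<gamma> in \<kappa> x. P \<gamma>)"
proof -
  obtain N where N: "{\<gamma> \<in> arrows G. \<not> P \<gamma>} \<subseteq> N" "emeasure \<nu> N = 0" "N \<in> sets (arr G)"
    using AE_E[OF assms] space_nu sets_nu by metis
  define V where "V = {x \<in> units G. emeasure (\<kappa> x) N = 0}"
  have "{x \<in> space (unit_space G). emeasure (\<kappa> x) N = 0} \<in> sets (unit_space G)"
    using emeasure_kappa_measurable[OF N(3)] by measurable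
  then have "V \<in> sets (unit_space G)" by (simp add: V_def)
  moreover have "AE \<gamma> in \<nu>. rng G \<gamma> \<in> V"
    using null_nu_iff[OF N(3), THEN iffD1, OF N(2)] AE_space
    by eventually_elim (simp add: V_def space_nu)
  moreover have "AE \<gamma> in \<kappa> x. P \<gamma>" if "x \<in> V" for x
  proof (rule AE_I)
    have x: "x \<in> units G" using that by (simp add: V_def)
    show "{\<gamma> \<in> space (\<kappa> x). \<not> P \<gamma>} \<subseteq> N" using N(1) space_kappa[OF x] by simp
    show "N \<in> sets (\<kappa> x)" using N(3) sets_kappa[OF x] by simp
    show "emeasure (\<kappa> x) N = 0" using that by (simp add: V_def)
  qed
  ultimately show ?thesis by blast
qed

text \<open>The converse direction. The exceptional set is assumed Borel because null sets in the
  single fibres need not combine to a Borel set of arrows.\<close>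

lemma AE_nu_I:
  assumes N: "{\<gamma> \<in> arrows G. \<not> P \<gamma>} \<in> sets (arr G)"
    and ae: "AE \<gamma> in \<nu>. AE \<eta> in \<kappa> (rng G \<gamma>). P \<eta>"
  shows "AE \<gamma> in \<nu>. P \<gamma>"
proof -
  have "AE \<gamma> in \<nu>. emeasure (\<kappa> (rng G \<gamma>)) {\<gamma> \<in> arrows G. \<not> P \<gamma>} = 0"
    using ae AE_space
  proof eventually_elim
    case (elim \<gamma>)
    then have x: "rng G \<gamma> \<in> units G" by (simp add: space_nu)
    have "{\<eta> \<in> space (\<kappa> (rng G \<gamma>)). \<not> P \<eta>} = {\<gamma> \<in> arrows G. \<not> P \<gamma>}"
      using space_kappa[OF x] by simp
    then show ?case using elim(1) N sets_kappa[OF x] by (simp add: AE_iff_measurable)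
  qed
  then have "emeasure \<nu> {\<gamma> \<in> arrows G. \<not> P \<gamma>} = 0" using null_nu_iff[OF N] by simp
  then show ?thesis using N sets_nu space_nu by (simp add: AE_iff_measurable)
qed

lemma AE_ginv:
  assumes "AE \<gamma> in \<nu>. P \<gamma>"
  shows "AE \<gamma> in \<nu>. P (ginv G \<gamma>)"
proof (rule AE_distrD[where f = "ginv G" and M' = "arr G"])
  show "ginv G \<in> \<nu> \<rightarrow>\<^sub>M arr G" using ginv_borel measurable_cong_sets[OF sets_nu refl] by blast
  show "AE \<gamma> in distr \<nu> (arr G) (ginv G). P \<gamma>"
    by (rule absolutely_continuous_AE[OF _ _ assms]) (use sym in \<open>simp_all add: measure_equiv_def\<close>)
qed

text \<open>Inversion preserves null sets and exchanges the range with the source.\<close>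

lemma AE_src_iff: "(AE \<gamma> in \<nu>. src G \<gamma> \<in> A) \<longleftrightarrow> (AE \<gamma> in \<nu>. rng G \<gamma> \<in> A)"
proof
  assume "AE \<gamma> in \<nu>. src G \<gamma> \<in> A"
  show "AE \<gamma> in \<nu>. rng G \<gamma> \<in> A"
    using AE_ginv[of "\<lambda>\<gamma>. src G \<gamma> \<in> A", OF \<open>AE \<gamma> in \<nu>. src G \<gamma> \<in> A\<close>] AE_space
    by eventually_elim (simp add: src_ginv space_nu)
next
  assume "AE \<gamma> in \<nu>. rng G \<gamma> \<in> A"
  show "AE \<gamma> in \<nu>. src G \<gamma> \<in> A"
    using AE_ginv[of "\<lambda>\<gamma>. rng G \<gamma> \<in> A", OF \<open>AE \<gamma> in \<nu>. rng G \<gamma> \<in> A\<close>] AE_space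
    by eventually_elim (simp add: rng_ginv space_nu)
qed

text \<open>Quasi-invariance read as a change of variables: when \<open>\<eta>\<close> is generic
  over \<open>src G \<gamma>\<close>, the product \<open>mul G \<gamma> \<eta>\<close> is generic
  over \<open>rng G \<gamma>\<close>.\<close>

lemma AE_translate:
  assumes \<gamma>: "\<gamma> \<in> reduction G U" and R: "AE \<eta> in \<kappa> (rng G \<gamma>). R \<eta>"
  shows "AE \<eta> in \<kappa> (src G \<gamma>). R (mul G \<gamma> \<eta>)"
proof -
  have \<gamma>A: "\<gamma> \<in> arrows G" using \<gamma> by (simp add: reduction_def)
  let ?s = "src G \<gamma>"
  have s: "?s \<in> units G" using \<gamma>A by simp
  have "AE \<eta> in translate G \<gamma> (\<kappa> ?s). R \<eta>"
    by (rule absolutely_continuous_AE[OF _ _ R])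
       (use quasi_invariant[OF \<gamma>] in \<open>simp_all add: measure_equiv_def\<close>)
  moreover have "mul G \<gamma> \<in> restrict_space (\<kappa> ?s) (fibre G ?s) \<rightarrow>\<^sub>M arr G"
    using mul_left_measurable[OF \<gamma>A]
      measurable_cong_sets[OF sets_restrict_space_cong[OF sets_kappa[OF s]] refl] by blast
  ultimately have "AE \<eta> in restrict_space (\<kappa> ?s) (fibre G ?s). R (mul G \<gamma> \<eta>)"
    unfolding translate_def by (rule AE_distrD[rotated])
  then have "AE \<eta> in \<kappa> ?s. \<eta> \<in> fibre G ?s \<longrightarrow> R (mul G \<gamma> \<eta>)"
    using fibre_sets[OF s] sets_kappa[OF s] by (subst (asm) AE_restrict_space_iff) auto
  then show ?thesis
    using AE_kappa_fibre[OF s] by eventually_elim (auto simp: fibre_def)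
qed

lemma ginv_reduction: "\<gamma> \<in> reduction G A \<Longrightarrow> ginv G \<gamma> \<in> reduction G A"
  by (simp add: reduction_def ginv_closed rng_ginv src_ginv)

lemma mul_ginv_mul:
  assumes \<gamma>: "\<gamma> \<in> arrows G" and \<eta>: "\<eta> \<in> arrows G" "rng G \<eta> = rng G \<gamma>"
  shows "(\<gamma>, mul G (ginv G \<gamma>) \<eta>) \<in> composable G"
    and "mul G \<gamma> (mul G (ginv G \<gamma>) \<eta>) = \<eta>"
    and "mul G (ginv G \<gamma>) \<eta> \<in> arrows G" "rng G (mul G (ginv G \<gamma>) \<eta>) = src G \<gamma>"
    "src G (mul G (ginv G \<gamma>) \<eta>) = src G \<eta>"
proof -
  have c: "(ginv G \<gamma>, \<eta>) \<in> composable G" "(\<gamma>, ginv G \<gamma>) \<in> composable G"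
    using assms ginv_closed rng_ginv src_ginv by (auto simp: composable_def)
  show "mul G (ginv G \<gamma>) \<eta> \<in> arrows G" "rng G (mul G (ginv G \<gamma>) \<eta>) = src G \<gamma>"
    "src G (mul G (ginv G \<gamma>) \<eta>) = src G \<eta>"
    using mul_closed[OF c(1)] rng_mul[OF c(1)] src_mul[OF c(1)] rng_ginv[OF \<gamma>] by simp_all
  then show "(\<gamma>, mul G (ginv G \<gamma>) \<eta>) \<in> composable G" using \<gamma> by (simp add: composable_def)
  show "mul G \<gamma> (mul G (ginv G \<gamma>) \<eta>) = \<eta>"
    using mul_assoc[OF c(2,1)] mul_ginv_right[OF \<gamma>] unit_left[OF \<eta>(1)] \<eta>(2) by simp
qed

text \<open>The direction from right to left is the other one for the arrow
  \<open>ginv G \<gamma>\<close>, which lies in the same reduction.\<close>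

lemma AE_translate_iff:
  assumes \<gamma>: "\<gamma> \<in> reduction G U"
  shows "(AE \<eta> in \<kappa> (rng G \<gamma>). R \<eta>) \<longleftrightarrow> (AE \<eta> in \<kappa> (src G \<gamma>). R (mul G \<gamma> \<eta>))"
proof
  assume *: "AE \<eta> in \<kappa> (src G \<gamma>). R (mul G \<gamma> \<eta>)"
  have \<gamma>A: "\<gamma> \<in> arrows G" using \<gamma> by (simp add: reduction_def)
  have "AE \<eta> in \<kappa> (rng G \<gamma>). R (mul G \<gamma> (mul G (ginv G \<gamma>) \<eta>))"
    using AE_translate[OF ginv_reduction[OF \<gamma>], of "\<lambda>\<eta>. R (mul G \<gamma> \<eta>)"] *
    unfolding rng_ginv[OF \<gamma>A] src_ginv[OF \<gamma>A] by blast
  then show "AE \<eta> in \<kappa> (rng G \<gamma>). R \<eta>"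
    using AE_kappa_fibre[OF rng_arrows[OF \<gamma>A]]
    by eventually_elim (simp add: mul_ginv_mul(2)[OF \<gamma>A])
qed (rule AE_translate[OF \<gamma>])

end

text \<open>All members of \<open>C\<close> have the same null sets, so the quantification over
  \<open>range_class G C\<close> in the notions null, conull and positive comes down to the one
  measure that has the quasi-invariant disintegration.\<close>

lemma (in measured_groupoid) ex_quasi_invariant_system:
  "\<exists>\<nu> \<kappa> U. \<nu> \<in> C \<and> quasi_invariant_system G \<nu> \<kappa> U \<and>
     (\<forall>A. conull_units G C A \<longleftrightarrow> A \<in> sets (unit_space G) \<and> (AE \<gamma> in \<nu>. rng G \<gamma> \<in> A)) \<and>
     (\<forall>A. positive_units G C A \<longleftrightarrow> A \<in> sets (unit_space G) \<and> \<not> (AE \<gamma> in \<nu>. rng G \<gamma> \<notin> A)) \<and>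
     (\<forall>\<nu>'\<in>C. \<forall>P. (AE \<gamma> in \<nu>. P \<gamma>) \<longrightarrow> (AE \<gamma> in \<nu>'. P \<gamma>))"
proof -
  obtain \<nu> \<kappa> U where \<nu>: "\<nu> \<in> C" "prob_space \<nu>" and dis: "disintegration_along_rng G \<nu> \<kappa>"
    and U: "conull_units G C U"
    and qi: "\<And>\<gamma>. \<gamma> \<in> reduction G U \<Longrightarrow> measure_equiv (translate G \<gamma> (\<kappa> (src G \<gamma>))) (\<kappa> (rng G \<gamma>))"
    using invariant unfolding invariant_class_def by blast
  obtain \<nu>1 where \<nu>1: "sets \<nu>1 = sets (arr G)" "C = measure_class_of \<nu>1"
    using measure_class unfolding measure_class_on_def by blast
  have setsC: "sets \<nu>' = sets (arr G)" if "\<nu>' \<in> C" for \<nu>'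
    using that \<nu>1 by (auto simp: measure_class_of_def measure_equiv_def)
  have AE_C: "AE \<gamma> in \<nu>''. P \<gamma>" if "\<nu>' \<in> C" "\<nu>'' \<in> C" "AE \<gamma> in \<nu>'. P \<gamma>" for \<nu>' \<nu>'' P
  proof -
    have "AE \<gamma> in \<nu>1. P \<gamma>"
      by (rule absolutely_continuous_AE[OF _ _ that(3)])
         (use that(1) \<nu>1(2) in \<open>simp_all add: measure_class_of_def measure_equiv_def\<close>)
    then show ?thesis
      by (rule absolutely_continuous_AE[rotated 2])
         (use that(2) \<nu>1(2) in \<open>simp_all add: measure_class_of_def measure_equiv_def\<close>)
  qed
  have rngC: "rng G \<in> \<nu>' \<rightarrow>\<^sub>M unit_space G" if "\<nu>' \<in> C" for \<nu>'
    using rng_unit_space measurable_cong_sets[OF setsC[OF that] refl] by blast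
  have spaceC: "space \<nu>' = arrows G" if "\<nu>' \<in> C" for \<nu>'
    using sets_eq_imp_space_eq[OF setsC[OF that]] by (simp add: arrows_def)
  have distr_null: "emeasure (distr \<nu>' (unit_space G) (rng G)) A = 0 \<longleftrightarrow> (AE \<gamma> in \<nu>'. rng G \<gamma> \<notin> A)"
    if "\<nu>' \<in> C" "A \<in> sets (unit_space G)" for \<nu>' A
  proof -
    have "emeasure (distr \<nu>' (unit_space G) (rng G)) A = emeasure \<nu>' {\<gamma> \<in> space \<nu>'. \<not> rng G \<gamma> \<notin> A}"
      using emeasure_distr[OF rngC[OF that(1)] that(2)] by (simp add: vimage_def Int_def conj_commute)
    moreover have "{\<gamma> \<in> space \<nu>'. \<not> rng G \<gamma> \<notin> A} \<in> sets \<nu>'"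
      using rng_vimage_sets[OF that(2)] setsC[OF that(1)] spaceC[OF that(1)] by simp
    ultimately show ?thesis using AE_iff_measurable[OF _ refl, of \<nu>' "\<lambda>\<gamma>. rng G \<gamma> \<notin> A"] by simp
  qed
  have null: "null_units G C A \<longleftrightarrow> A \<in> sets (unit_space G) \<and> (AE \<gamma> in \<nu>. rng G \<gamma> \<notin> A)" for A
  proof (cases "A \<in> sets (unit_space G)")
    case A: True
    show ?thesis
    proof
      assume *: "null_units G C A"
      \<comment> \<open>The image of \<open>\<nu>\<close> is sigma-finite, hence itself a member of
        the range class on which nullity can be tested.\<close>
      interpret d: prob_space "distr \<nu> (unit_space G) (rng G)"
        by (rule prob_space.prob_space_distr[OF \<nu>(2) rngC[OF \<nu>(1)]])
      have "distr \<nu> (unit_space G) (rng G) \<in> measure_class_of (distr \<nu> (unit_space G) (rng G))"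
        by (simp add: measure_class_of_def measure_equiv_def absolutely_continuous_def d.sigma_finite_measure_axioms)
      then have "distr \<nu> (unit_space G) (rng G) \<in> range_class G C"
        using \<nu> unfolding range_class_def by blast
      then show "A \<in> sets (unit_space G) \<and> (AE \<gamma> in \<nu>. rng G \<gamma> \<notin> A)"
        using * distr_null[OF \<nu>(1) A] A unfolding null_units_def by blast
    next
      assume *: "A \<in> sets (unit_space G) \<and> (AE \<gamma> in \<nu>. rng G \<gamma> \<notin> A)"
      have "emeasure \<mu> A = 0" if "\<mu> \<in> range_class G C" for \<mu>
      proof -
        obtain \<nu>' where \<nu>': "\<nu>' \<in> C" "\<mu> \<in> measure_class_of (distr \<nu>' (unit_space G) (rng G))"
          using \<open>\<mu> \<in> range_class G C\<close> unfolding range_class_def by blast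
        have "AE \<gamma> in \<nu>'. rng G \<gamma> \<notin> A" using AE_C[OF \<nu>(1) \<nu>'(1)] * by blast
        then have "A \<in> null_sets (distr \<nu>' (unit_space G) (rng G))"
          using distr_null[OF \<nu>'(1) A] A by (simp add: null_sets_def)
        then have "A \<in> null_sets \<mu>"
          using \<nu>'(2) unfolding measure_class_of_def measure_equiv_def absolutely_continuous_def by blast
        then show ?thesis by blast
      qed
      then show "null_units G C A" using A by (simp add: null_units_def)
    qed
  qed (auto simp: null_units_def)
  have conull: "conull_units G C A \<longleftrightarrow> A \<in> sets (unit_space G) \<and> (AE \<gamma> in \<nu>. rng G \<gamma> \<in> A)" for A
  proof -
    have "(AE \<gamma> in \<nu>. rng G \<gamma> \<notin> units G - A) \<longleftrightarrow> (AE \<gamma> in \<nu>. rng G \<gamma> \<in> A)"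
      by (intro AE_cong) (simp add: spaceC[OF \<nu>(1)])
    moreover have "units G - A \<in> sets (unit_space G)" if "A \<in> sets (unit_space G)"
      using sets.compl_sets[OF that] by simp
    ultimately show ?thesis unfolding conull_units_def null by blast
  qed
  have "quasi_invariant_system G \<nu> \<kappa> U"
  proof (intro quasi_invariant_system.intro quasi_invariant_system_axioms.intro)
    show "borel_groupoid G" by (rule borel_groupoid_axioms)
    show "measure_equiv \<nu> (distr \<nu> (arr G) (ginv G))"
      using symmetric \<nu>(1) by (simp add: symmetric_class_def)
    show "U \<in> sets (unit_space G)" "AE \<gamma> in \<nu>. rng G \<gamma> \<in> U" using U conull by simp_all
  qed (fact \<nu>(2) setsC[OF \<nu>(1)] dis qi)+
  then show ?thesis
    using \<nu>(1) conull null AE_C[OF \<nu>(1)] unfolding positive_units_def by blast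
qed

section \<open>Cocycles as affine isometric actions\<close>

context hilbert_space
begin

lemma diff_add_cancel:
  assumes "v \<in> carrier V" "w \<in> carrier V"
  shows "(v \<ominus>\<^bsub>V\<^esub> w) \<oplus>\<^bsub>V\<^esub> w = v" "w \<oplus>\<^bsub>V\<^esub> (v \<ominus>\<^bsub>V\<^esub> w) = v"
proof -
  show "(v \<ominus>\<^bsub>V\<^esub> w) \<oplus>\<^bsub>V\<^esub> w = v" using assms by (simp add: a_minus_def M.a_assoc M.l_neg)
  then show "w \<oplus>\<^bsub>V\<^esub> (v \<ominus>\<^bsub>V\<^esub> w) = v" using assms by (simp add: M.a_comm)
qed

lemma add_diff_cancel:
  assumes "v \<in> carrier V" "w \<in> carrier V"
  shows "(v \<oplus>\<^bsub>V\<^esub> w) \<ominus>\<^bsub>V\<^esub> w = v"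
  using assms by (simp add: a_minus_def M.a_assoc M.r_neg)

lemma add_diff_add:
  assumes "u \<in> carrier V" "v \<in> carrier V" "w \<in> carrier V"
  shows "(u \<oplus>\<^bsub>V\<^esub> v) \<ominus>\<^bsub>V\<^esub> (u \<oplus>\<^bsub>V\<^esub> w) = v \<ominus>\<^bsub>V\<^esub> w"
proof -
  have "(v \<ominus>\<^bsub>V\<^esub> w) \<oplus>\<^bsub>V\<^esub> (u \<oplus>\<^bsub>V\<^esub> w) = u \<oplus>\<^bsub>V\<^esub> ((v \<ominus>\<^bsub>V\<^esub> w) \<oplus>\<^bsub>V\<^esub> w)"
    using assms by (simp add: M.a_lcomm)
  then have "(v \<ominus>\<^bsub>V\<^esub> w) \<oplus>\<^bsub>V\<^esub> (u \<oplus>\<^bsub>V\<^esub> w) = u \<oplus>\<^bsub>V\<^esub> v" using assms by (simp add: diff_add_cancel)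
  then show ?thesis using add_diff_cancel[of "v \<ominus>\<^bsub>V\<^esub> w" "u \<oplus>\<^bsub>V\<^esub> w"] assms by simp
qed

end

lemma hilbert_iso_facts:
  assumes V: "hilbert_space K V" and W: "hilbert_space K W" and T: "hilbert_iso K V W T"
  shows hilbert_iso_closed: "v \<in> carrier V \<Longrightarrow> T v \<in> carrier W"
    and hilbert_iso_hnorm: "v \<in> carrier V \<Longrightarrow> hnorm W (T v) = hnorm V v"
    and hilbert_iso_diff: "v \<in> carrier V \<Longrightarrow> w \<in> carrier V \<Longrightarrow> T (v \<ominus>\<^bsub>V\<^esub> w) = T v \<ominus>\<^bsub>W\<^esub> T w"
    and hilbert_iso_surj: "T ` carrier V = carrier W"
proof -
  interpret V: hilbert_space K V by fact
  interpret W: hilbert_space K W by fact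
  show surj: "T ` carrier V = carrier W" using T by (simp add: hilbert_iso_def bij_betw_def)
  then show closed: "T v \<in> carrier W" if "v \<in> carrier V" for v using that by blast
  show "hnorm W (T v) = hnorm V v" if "v \<in> carrier V"
    using T that by (simp add: hilbert_iso_def hnorm_def)
  show "T (v \<ominus>\<^bsub>V\<^esub> w) = T v \<ominus>\<^bsub>W\<^esub> T w" if v: "v \<in> carrier V" "w \<in> carrier V"
  proof -
    have "T ((v \<ominus>\<^bsub>V\<^esub> w) \<oplus>\<^bsub>V\<^esub> w) = T (v \<ominus>\<^bsub>V\<^esub> w) \<oplus>\<^bsub>W\<^esub> T w"
      using T v V.M.minus_closed unfolding hilbert_iso_def by blast
    then have "T v = T (v \<ominus>\<^bsub>V\<^esub> w) \<oplus>\<^bsub>W\<^esub> T w" using v by (simp add: V.diff_add_cancel)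
    then show ?thesis using W.add_diff_cancel[of "T (v \<ominus>\<^bsub>V\<^esub> w)" "T w"] v closed by simp
  qed
qed

text \<open>The maps \<open>v \<mapsto> b \<gamma> + L \<gamma> v\<close> form an action of the groupoid by affine isometries, and \<open>b\<close> is the
  coboundary of \<open>\<xi>\<close> iff \<open>\<xi>\<close> is an equivariant section.\<close>

locale affine_action =
  quasi_invariant_system G \<nu> \<kappa> U + hilbert_bundle K "unit_space G" H e
  for G :: "'g groupoid" and \<nu> \<kappa> U K and H :: "'g \<Rightarrow> 'h hilbert" and e +
  fixes L :: "'g \<Rightarrow> 'h \<Rightarrow> 'h" and b :: "'g \<Rightarrow> 'h"
  assumes iso: "\<gamma> \<in> arrows G \<Longrightarrow> hilbert_iso K (H (src G \<gamma>)) (H (rng G \<gamma>)) (L \<gamma>)"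
    and L_mul: "\<gamma> \<in> reduction G U \<Longrightarrow> \<eta> \<in> reduction G U \<Longrightarrow> src G \<gamma> = rng G \<eta> \<Longrightarrow>
      v \<in> carrier (H (src G \<eta>)) \<Longrightarrow> L (mul G \<gamma> \<eta>) v = L \<gamma> (L \<eta> v)"
    and b_section: "borel_section (arr G) (H \<circ> rng G) (\<lambda>n. e n \<circ> rng G) b"
    and b_mul: "\<gamma> \<in> reduction G U \<Longrightarrow> \<eta> \<in> reduction G U \<Longrightarrow> src G \<gamma> = rng G \<eta> \<Longrightarrow>
      b (mul G \<gamma> \<eta>) = b \<gamma> \<oplus>\<^bsub>H (rng G \<gamma>)\<^esub> L \<gamma> (b \<eta>)"
begin

lemma hilbert_H: "x \<in> units G \<Longrightarrow> hilbert_space K (H x)"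
  using fibre_hilbert by simp

lemma b_closed: "\<gamma> \<in> arrows G \<Longrightarrow> b \<gamma> \<in> carrier (H (rng G \<gamma>))"
  using b_section by (simp add: borel_section_def arrows_def)

lemma L_facts:
  assumes "\<gamma> \<in> arrows G"
  shows L_closed: "v \<in> carrier (H (src G \<gamma>)) \<Longrightarrow> L \<gamma> v \<in> carrier (H (rng G \<gamma>))"
    and L_hnorm: "v \<in> carrier (H (src G \<gamma>)) \<Longrightarrow> hnorm (H (rng G \<gamma>)) (L \<gamma> v) = hnorm (H (src G \<gamma>)) v"
    and L_diff: "v \<in> carrier (H (src G \<gamma>)) \<Longrightarrow> w \<in> carrier (H (src G \<gamma>)) \<Longrightarrow>
      L \<gamma> (v \<ominus>\<^bsub>H (src G \<gamma>)\<^esub> w) = L \<gamma> v \<ominus>\<^bsub>H (rng G \<gamma>)\<^esub> L \<gamma> w"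
    and L_surj: "L \<gamma> ` carrier (H (src G \<gamma>)) = carrier (H (rng G \<gamma>))"
  using hilbert_iso_facts[OF hilbert_H[OF src_arrows[OF assms]] hilbert_H[OF rng_arrows[OF assms]] iso[OF assms]]
  by blast+

text \<open>At such units almost every arrow of the fibre has both ends in \<open>U\<close>, so that
  the identities for \<open>L\<close> and \<open>b\<close> apply to it.\<close>

lemma ex_regular_units:
  "\<exists>V\<in>sets (unit_space G). V \<subseteq> U \<and> (AE \<gamma> in \<nu>. rng G \<gamma> \<in> V) \<and> (\<forall>x\<in>V. AE \<gamma> in \<kappa> x. src G \<gamma> \<in> U)"
proof -
  have "AE \<gamma> in \<nu>. src G \<gamma> \<in> U" using AE_U by (simp add: AE_src_iff)
  then obtain V where V: "V \<in> sets (unit_space G)" "AE \<gamma> in \<nu>. rng G \<gamma> \<in> V"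
      "\<forall>x\<in>V. AE \<gamma> in \<kappa> x. src G \<gamma> \<in> U"
    using AE_disintegration by blast
  moreover have "AE \<gamma> in \<nu>. rng G \<gamma> \<in> V \<inter> U" using V(2) AE_U by eventually_elim simp
  ultimately show ?thesis using U_sets by (intro bexI[of _ "V \<inter> U"]) auto
qed

text \<open>An almost everywhere coboundary is a coboundary on a conull reduction: \<open>b \<gamma>\<close> is determined by
  \<open>b \<eta>\<close> and \<open>b (\<gamma> \<eta>)\<close> for a generic \<open>\<eta>\<close>.\<close>

lemma coboundary_on_reduction:
  assumes \<xi>: "borel_section (unit_space G) H e \<xi>"
    and ae: "AE \<gamma> in \<nu>. b \<gamma> = \<xi> (rng G \<gamma>) \<ominus>\<^bsub>H (rng G \<gamma>)\<^esub> L \<gamma> (\<xi> (src G \<gamma>))"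
  shows "\<exists>V\<in>sets (unit_space G). (AE \<gamma> in \<nu>. rng G \<gamma> \<in> V) \<and>
    (\<forall>\<gamma>\<in>reduction G V. b \<gamma> = \<xi> (rng G \<gamma>) \<ominus>\<^bsub>H (rng G \<gamma>)\<^esub> L \<gamma> (\<xi> (src G \<gamma>)))"
proof -
  have \<xi>c: "\<xi> x \<in> carrier (H x)" if "x \<in> units G" for x
    using \<xi> that by (simp add: borel_section_def)
  define P where "P \<gamma> \<longleftrightarrow> b \<gamma> = \<xi> (rng G \<gamma>) \<ominus>\<^bsub>H (rng G \<gamma>)\<^esub> L \<gamma> (\<xi> (src G \<gamma>))" for \<gamma>
  obtain V1 where V1: "V1 \<in> sets (unit_space G)" "AE \<gamma> in \<nu>. rng G \<gamma> \<in> V1"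
      "\<forall>x\<in>V1. AE \<gamma> in \<kappa> x. P \<gamma>"
    using AE_disintegration[OF ae] unfolding P_def by blast
  obtain V2 where V2: "V2 \<in> sets (unit_space G)" "V2 \<subseteq> U" "AE \<gamma> in \<nu>. rng G \<gamma> \<in> V2"
      "\<forall>x\<in>V2. AE \<gamma> in \<kappa> x. src G \<gamma> \<in> U"
    using ex_regular_units by blast
  have "P \<gamma>" if \<gamma>: "\<gamma> \<in> reduction G (V1 \<inter> V2)" for \<gamma>
  proof -
    have \<gamma>A: "\<gamma> \<in> arrows G" and \<gamma>U: "\<gamma> \<in> reduction G U"
      and rV: "rng G \<gamma> \<in> V1" and sV: "src G \<gamma> \<in> V1" "src G \<gamma> \<in> V2" "src G \<gamma> \<in> U"
      using \<gamma> V2(2) by (auto simp: reduction_def)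
    have s: "src G \<gamma> \<in> units G" and r: "rng G \<gamma> \<in> units G" using \<gamma>A by simp_all
    interpret k: prob_space "\<kappa> (src G \<gamma>)" by (rule prob_kappa[OF s])
    \<comment> \<open>Quasi-invariance makes the coboundary equation hold at
      \<open>mul G \<gamma> \<eta>\<close> and at \<open>\<eta>\<close> for the same generic
      \<open>\<eta>\<close>.\<close>
    have "AE \<eta> in \<kappa> (src G \<gamma>). P (mul G \<gamma> \<eta>)" using V1(3) rV by (intro AE_translate[OF \<gamma>U]) blast
    moreover have "AE \<eta> in \<kappa> (src G \<gamma>). P \<eta>" using V1(3) sV by blast
    moreover have "AE \<eta> in \<kappa> (src G \<gamma>). src G \<eta> \<in> U" using V2(4) sV by blast
    ultimately have "AE \<eta> in \<kappa> (src G \<gamma>). P (mul G \<gamma> \<eta>) \<and> P \<eta> \<and> src G \<eta> \<in> U \<and>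
        \<eta> \<in> arrows G \<and> rng G \<eta> = src G \<gamma>"
      using AE_kappa_fibre[OF s] by eventually_elim simp
    then obtain \<eta> where \<eta>: "P (mul G \<gamma> \<eta>)" "P \<eta>" "src G \<eta> \<in> U" "\<eta> \<in> arrows G" "rng G \<eta> = src G \<gamma>"
      using eventually_happens'[OF k.ae_filter_bot] by blast
    have \<eta>U: "\<eta> \<in> reduction G U" using \<eta> sV by (simp add: reduction_def)
    have c: "(\<gamma>, \<eta>) \<in> composable G" using \<gamma>A \<eta> by (simp add: composable_def)
    interpret hilbert_space K "H (rng G \<gamma>)" by (rule hilbert_H[OF r])
    define y where "y = L \<eta> (\<xi> (src G \<eta>))"
    have y: "y \<in> carrier (H (src G \<gamma>))"
      using L_closed[OF \<eta>(4)] \<xi>c \<eta> unfolding y_def by simp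
    have Ly: "L \<gamma> y \<in> carrier (H (rng G \<gamma>))" "L \<gamma> (\<xi> (src G \<gamma>)) \<in> carrier (H (rng G \<gamma>))"
      using L_closed[OF \<gamma>A] y \<xi>c s by blast+
    have "b (mul G \<gamma> \<eta>) = \<xi> (rng G \<gamma>) \<ominus>\<^bsub>H (rng G \<gamma>)\<^esub> L \<gamma> y"
      using \<eta>(1) L_mul[OF \<gamma>U \<eta>U, of "\<xi> (src G \<eta>)"] \<xi>c \<eta> unfolding P_def rng_mul[OF c] src_mul[OF c] y_def
      by simp
    moreover have "L \<gamma> (b \<eta>) = L \<gamma> (\<xi> (src G \<gamma>)) \<ominus>\<^bsub>H (rng G \<gamma>)\<^esub> L \<gamma> y"
      using \<eta>(2,5) L_diff[OF \<gamma>A \<xi>c[OF s] y] unfolding P_def y_def by simp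
    ultimately have eq: "\<xi> (rng G \<gamma>) \<ominus>\<^bsub>H (rng G \<gamma>)\<^esub> L \<gamma> y =
        b \<gamma> \<oplus>\<^bsub>H (rng G \<gamma>)\<^esub> (L \<gamma> (\<xi> (src G \<gamma>)) \<ominus>\<^bsub>H (rng G \<gamma>)\<^esub> L \<gamma> y)"
      using b_mul[OF \<gamma>U \<eta>U] \<eta>(5) by simp
    \<comment> \<open>Adding \<open>L \<gamma> y\<close> to both sides of \<open>eq\<close> removes
      the dependence on \<open>\<eta>\<close>.\<close>
    have "\<xi> (rng G \<gamma>) = (b \<gamma> \<oplus>\<^bsub>H (rng G \<gamma>)\<^esub> (L \<gamma> (\<xi> (src G \<gamma>)) \<ominus>\<^bsub>H (rng G \<gamma>)\<^esub> L \<gamma> y)) \<oplus>\<^bsub>H (rng G \<gamma>)\<^esub> L \<gamma> y"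
      using diff_add_cancel(1)[OF \<xi>c[OF r] Ly(1)] eq by simp
    also have "\<dots> = b \<gamma> \<oplus>\<^bsub>H (rng G \<gamma>)\<^esub> L \<gamma> (\<xi> (src G \<gamma>))"
      using b_closed[OF \<gamma>A] Ly by (simp add: M.a_assoc diff_add_cancel)
    finally show "P \<gamma>"
      unfolding P_def using add_diff_cancel[OF b_closed[OF \<gamma>A] Ly(2)] by simp
  qed
  moreover have "AE \<gamma> in \<nu>. rng G \<gamma> \<in> V1 \<inter> V2" using V1(2) V2(3) by eventually_elim simp
  ultimately show ?thesis using V1(1) V2(1) unfolding P_def by (intro bexI[of _ "V1 \<inter> V2"]) auto
qed

theorem coboundary_bounded:
  assumes \<xi>: "borel_section (unit_space G) H e \<xi>"
    and ae: "AE \<gamma> in \<nu>. b \<gamma> = \<xi> (rng G \<gamma>) \<ominus>\<^bsub>H (rng G \<gamma>)\<^esub> L \<gamma> (\<xi> (src G \<gamma>))"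
  shows "\<exists>E\<in>sets (unit_space G). \<not> (AE \<gamma> in \<nu>. rng G \<gamma> \<notin> E) \<and>
    bdd_above ((\<lambda>\<gamma>. hnorm (H (rng G \<gamma>)) (b \<gamma>)) ` reduction G E)"
proof -
  have \<xi>c: "\<xi> x \<in> carrier (H x)" if "x \<in> units G" for x
    using \<xi> that by (simp add: borel_section_def)
  obtain V where V: "V \<in> sets (unit_space G)" "AE \<gamma> in \<nu>. rng G \<gamma> \<in> V"
      "\<And>\<gamma>. \<gamma> \<in> reduction G V \<Longrightarrow> b \<gamma> = \<xi> (rng G \<gamma>) \<ominus>\<^bsub>H (rng G \<gamma>)\<^esub> L \<gamma> (\<xi> (src G \<gamma>))"
    using coboundary_on_reduction[OF assms] by blast
  define E where "E n = V \<inter> {x \<in> space (unit_space G). hnorm (H x) (\<xi> x) \<le> real n}" for n :: nat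
  have E: "E n \<in> sets (unit_space G)" for n
    unfolding E_def using V(1) borel_measurable_hnorm[OF \<xi>]
    by (intro sets.Int) (simp_all only: borel_measurable_iff_le)
  \<comment> \<open>The sets \<open>E n\<close> exhaust the conull set \<open>V\<close>, so they
    cannot all be null.\<close>
  have "\<exists>n. \<not> (AE \<gamma> in \<nu>. rng G \<gamma> \<notin> E n)"
  proof (rule ccontr)
    assume "\<not> ?thesis"
    then have "AE \<gamma> in \<nu>. \<forall>n. rng G \<gamma> \<notin> E n" by (simp add: AE_all_countable)
    then have "AE \<gamma> in \<nu>. False"
      using V(2) AE_space
    proof eventually_elim
      case (elim \<gamma>)
      obtain n where "hnorm (H (rng G \<gamma>)) (\<xi> (rng G \<gamma>)) \<le> real n" using real_arch_simple by blast
      then show ?case using elim by (auto simp: E_def space_nu)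
    qed
    then show False by simp
  qed
  then obtain n where n: "\<not> (AE \<gamma> in \<nu>. rng G \<gamma> \<notin> E n)" by blast
  have "hnorm (H (rng G \<gamma>)) (b \<gamma>) \<le> 2 * real n" if \<gamma>: "\<gamma> \<in> reduction G (E n)" for \<gamma>
  proof -
    have \<gamma>A: "\<gamma> \<in> arrows G" and \<gamma>V: "\<gamma> \<in> reduction G V"
      and le: "hnorm (H (rng G \<gamma>)) (\<xi> (rng G \<gamma>)) \<le> real n" "hnorm (H (src G \<gamma>)) (\<xi> (src G \<gamma>)) \<le> real n"
      using \<gamma> by (auto simp: reduction_def E_def)
    have s: "src G \<gamma> \<in> units G" and r: "rng G \<gamma> \<in> units G" using \<gamma>A by simp_all
    interpret hilbert_space K "H (rng G \<gamma>)" by (rule hilbert_H[OF r])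
    show ?thesis
      using hnorm_diff_le[OF \<xi>c[OF r] L_closed[OF \<gamma>A \<xi>c[OF s]]] le V(3)[OF \<gamma>V] L_hnorm[OF \<gamma>A \<xi>c[OF s]]
      by simp
  qed
  then have "bdd_above ((\<lambda>\<gamma>. hnorm (H (rng G \<gamma>)) (b \<gamma>)) ` reduction G (E n))"
    by (intro bdd_aboveI2)
  then show ?thesis using E n by blast
qed

text \<open>The center of \<open>b (G\<^sup>x\<^sub>E)\<close> is taken with respect to the null sets of \<open>\<kappa> x\<close>: these are
  transported to each other by the arrows, and they make the radius a Borel function of \<open>x\<close>.\<close>

definition into_filter :: "'g set \<Rightarrow> 'g \<Rightarrow> 'g filter" where
  "into_filter E x = inf (ae_filter (\<kappa> x)) (principal {\<gamma>. src G \<gamma> \<in> E})"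

lemma eventually_into_filter:
  "eventually P (into_filter E x) \<longleftrightarrow> (AE \<gamma> in \<kappa> x. src G \<gamma> \<in> E \<longrightarrow> P \<gamma>)"
  by (simp add: into_filter_def eventually_inf_principal)

lemma into_filter_eq_bot: "into_filter E x = bot \<longleftrightarrow> (AE \<gamma> in \<kappa> x. src G \<gamma> \<notin> E)"
  using eventually_into_filter[of "\<lambda>_. False" E x] by (simp add: trivial_limit_def)

text \<open>\<open>mul G \<gamma> \<eta>\<close> and \<open>\<eta>\<close> have the same source, so
  translation by \<open>\<gamma>\<close> does not change whether the arrows coming from
  \<open>E\<close> are negligible.\<close>

lemma into_filter_bot_iff:
  assumes \<gamma>: "\<gamma> \<in> reduction G U"
  shows "into_filter E (rng G \<gamma>) = bot \<longleftrightarrow> into_filter E (src G \<gamma>) = bot"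
proof -
  have \<gamma>A: "\<gamma> \<in> arrows G" using \<gamma> by (simp add: reduction_def)
  have "(AE \<eta> in \<kappa> (src G \<gamma>). src G (mul G \<gamma> \<eta>) \<notin> E) \<longleftrightarrow> (AE \<eta> in \<kappa> (src G \<gamma>). src G \<eta> \<notin> E)"
  proof (rule eventually_cong)
    show "AE \<eta> in \<kappa> (src G \<gamma>). src G (mul G \<gamma> \<eta>) = src G \<eta>"
      using AE_kappa_fibre[OF src_arrows[OF \<gamma>A]]
      by eventually_elim (simp add: src_mul composable_def \<gamma>A)
  qed simp
  then show ?thesis unfolding into_filter_eq_bot AE_translate_iff[OF \<gamma>] .
qed

lemma eventually_b_closed:
  assumes "x \<in> units G"
  shows "\<forall>\<^sub>F \<gamma> in into_filter E x. b \<gamma> \<in> carrier (H x)"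
  unfolding eventually_into_filter using AE_kappa_fibre[OF assms]
  by eventually_elim (use b_closed in blast)

lemma kappa_measurable_AE:
  assumes N: "{\<gamma> \<in> arrows G. \<not> P \<gamma>} \<in> sets (arr G)"
  shows "{x \<in> units G. AE \<gamma> in \<kappa> x. P \<gamma>} \<in> sets (unit_space G)"
proof -
  have "(AE \<gamma> in \<kappa> x. P \<gamma>) \<longleftrightarrow> emeasure (\<kappa> x) {\<gamma> \<in> arrows G. \<not> P \<gamma>} = 0" if x: "x \<in> units G" for x
    using N sets_kappa[OF x] space_kappa[OF x] by (intro AE_iff_measurable) auto
  then have "{x \<in> units G. AE \<gamma> in \<kappa> x. P \<gamma>} =
      {x \<in> space (unit_space G). emeasure (\<kappa> x) {\<gamma> \<in> arrows G. \<not> P \<gamma>} = 0}" by auto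
  also have "\<dots> \<in> sets (unit_space G)" using emeasure_kappa_measurable[OF N] by measurable
  finally show ?thesis .
qed

text \<open>The distance from \<open>b\<close> to \<open>d\<close>, taken at the range of the arrow,
  is a Borel function of the arrow. Enclosure thus means that \<open>\<kappa> x\<close> vanishes on
  a Borel set of arrows, which is a Borel condition on \<open>x\<close>, as
  \<open>borel_section_chebyshev_center\<close> demands.\<close>

lemma enclosed_measurable:
  assumes E: "E \<in> sets (unit_space G)" and d: "borel_section (unit_space G) H e d"
  shows "{x \<in> units G. enclosed (H x) (into_filter E x) b (d x) c} \<in> sets (unit_space G)"
proof -
  interpret pull: hilbert_bundle K "arr G" "H \<circ> rng G" "\<lambda>n. e n \<circ> rng G"
    by (rule hilbert_bundle_pullback[OF hilbert_bundle_axioms rng_unit_space])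
  define g where "g \<gamma> = hnorm (H (rng G \<gamma>)) (b \<gamma> \<ominus>\<^bsub>H (rng G \<gamma>)\<^esub> d (rng G \<gamma>))" for \<gamma>
  have "(\<lambda>\<gamma>. hnorm ((H \<circ> rng G) \<gamma>) (b \<gamma> \<ominus>\<^bsub>(H \<circ> rng G) \<gamma>\<^esub> d (rng G \<gamma>))) \<in> borel_measurable (arr G)"
    by (intro pull.borel_measurable_hnorm pull.borel_section_diff b_section
        borel_section_pullback[OF d rng_unit_space])
  then have g: "g \<in> borel_measurable (arr G)" by (simp add: g_def[abs_def])
  have "{\<gamma> \<in> space (arr G). g \<gamma> > c} \<in> sets (arr G)" using g by measurable
  moreover have "{\<gamma> \<in> arrows G. \<not> (src G \<gamma> \<in> E \<longrightarrow> g \<gamma> \<le> c)} =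
      {\<gamma> \<in> arrows G. src G \<gamma> \<in> E} \<inter> {\<gamma> \<in> space (arr G). g \<gamma> > c}"
    by (auto simp: arrows_def)
  ultimately have "{\<gamma> \<in> arrows G. \<not> (src G \<gamma> \<in> E \<longrightarrow> g \<gamma> \<le> c)} \<in> sets (arr G)"
    using src_vimage_sets[OF E] by simp
  then have "{x \<in> units G. AE \<gamma> in \<kappa> x. src G \<gamma> \<in> E \<longrightarrow> g \<gamma> \<le> c} \<in> sets (unit_space G)"
    by (rule kappa_measurable_AE)
  \<comment> \<open>Almost every arrow for \<open>\<kappa> x\<close> has range \<open>x\<close>, and
    there \<open>g\<close> measures distances in \<open>H x\<close>.\<close>
  also have "{x \<in> units G. AE \<gamma> in \<kappa> x. src G \<gamma> \<in> E \<longrightarrow> g \<gamma> \<le> c} =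
      {x \<in> units G. enclosed (H x) (into_filter E x) b (d x) c}"
  proof (rule Collect_cong, rule conj_cong[OF refl])
    fix x assume x: "x \<in> units G"
    show "(AE \<gamma> in \<kappa> x. src G \<gamma> \<in> E \<longrightarrow> g \<gamma> \<le> c) \<longleftrightarrow> enclosed (H x) (into_filter E x) b (d x) c"
      unfolding enclosed_def eventually_into_filter
    proof (rule eventually_cong[OF AE_kappa_fibre[OF x]])
    qed (simp add: g_def)
  qed
  finally show ?thesis .
qed

text \<open>\<open>b (\<gamma> \<eta>) - (b \<gamma> + L \<gamma> v) = L \<gamma> (b \<eta> -
  v)\<close>, and \<open>L \<gamma>\<close> is isometric. The assumption \<open>reg\<close> makes a
  generic \<open>\<eta>\<close> an arrow of the reduction, where the cocycle identity holds.\<close>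

lemma enclosed_translate:
  assumes \<gamma>: "\<gamma> \<in> reduction G U" and reg: "AE \<eta> in \<kappa> (src G \<gamma>). src G \<eta> \<in> U"
    and v: "v \<in> carrier (H (src G \<gamma>))"
  shows "enclosed (H (rng G \<gamma>)) (into_filter E (rng G \<gamma>)) b (b \<gamma> \<oplus>\<^bsub>H (rng G \<gamma>)\<^esub> L \<gamma> v) c \<longleftrightarrow>
    enclosed (H (src G \<gamma>)) (into_filter E (src G \<gamma>)) b v c"
proof -
  have \<gamma>A: "\<gamma> \<in> arrows G" and sU: "src G \<gamma> \<in> U" using \<gamma> by (simp_all add: reduction_def)
  have s: "src G \<gamma> \<in> units G" and r: "rng G \<gamma> \<in> units G" using \<gamma>A by simp_all
  interpret s: hilbert_space K "H (src G \<gamma>)" by (rule hilbert_H[OF s])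
  interpret r: hilbert_space K "H (rng G \<gamma>)" by (rule hilbert_H[OF r])
  have "AE \<eta> in \<kappa> (src G \<gamma>). src G (mul G \<gamma> \<eta>) = src G \<eta> \<and>
      hnorm (H (rng G \<gamma>)) (b (mul G \<gamma> \<eta>) \<ominus>\<^bsub>H (rng G \<gamma>)\<^esub> (b \<gamma> \<oplus>\<^bsub>H (rng G \<gamma>)\<^esub> L \<gamma> v)) =
      hnorm (H (src G \<gamma>)) (b \<eta> \<ominus>\<^bsub>H (src G \<gamma>)\<^esub> v)"
    using reg AE_kappa_fibre[OF s]
  proof eventually_elim
    case (elim \<eta>)
    then have \<eta>: "\<eta> \<in> reduction G U" "\<eta> \<in> arrows G" "src G \<gamma> = rng G \<eta>" using sU by (auto simp: reduction_def)
    have b\<eta>: "b \<eta> \<in> carrier (H (src G \<gamma>))" using b_closed \<eta> by simp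
    have "b (mul G \<gamma> \<eta>) \<ominus>\<^bsub>H (rng G \<gamma>)\<^esub> (b \<gamma> \<oplus>\<^bsub>H (rng G \<gamma>)\<^esub> L \<gamma> v) = L \<gamma> (b \<eta> \<ominus>\<^bsub>H (src G \<gamma>)\<^esub> v)"
      unfolding b_mul[OF \<gamma> \<eta>(1,3)] L_diff[OF \<gamma>A b\<eta> v]
      by (intro r.add_diff_add b_closed L_closed \<gamma>A b\<eta> v)
    moreover have "b \<eta> \<ominus>\<^bsub>H (src G \<gamma>)\<^esub> v \<in> carrier (H (src G \<gamma>))" using b\<eta> v by simp
    moreover have "src G (mul G \<gamma> \<eta>) = src G \<eta>" using src_mul composableI \<gamma>A \<eta> by blast
    ultimately show ?case using L_hnorm[OF \<gamma>A] by metis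
  qed
  then show ?thesis
    unfolding enclosed_def eventually_into_filter AE_translate_iff[OF \<gamma>]
    by (rule eventually_cong) auto
qed

lemma center_equivariant:
  assumes \<gamma>: "\<gamma> \<in> reduction G U" and reg: "AE \<eta> in \<kappa> (src G \<gamma>). src G \<eta> \<in> U"
    and v: "chebyshev_center (H (src G \<gamma>)) (into_filter E (src G \<gamma>)) b v"
  shows "chebyshev_center (H (rng G \<gamma>)) (into_filter E (rng G \<gamma>)) b (b \<gamma> \<oplus>\<^bsub>H (rng G \<gamma>)\<^esub> L \<gamma> v)"
proof (rule chebyshev_center_transport[OF _ _ enclosed_translate[OF \<gamma> reg] v])
  have \<gamma>A: "\<gamma> \<in> arrows G" using \<gamma> by (simp add: reduction_def)
  have s: "src G \<gamma> \<in> units G" and r: "rng G \<gamma> \<in> units G" using \<gamma>A by simp_all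
  interpret s: hilbert_space K "H (src G \<gamma>)" by (rule hilbert_H[OF s])
  interpret r: hilbert_space K "H (rng G \<gamma>)" by (rule hilbert_H[OF r])
  show "(\<lambda>v. b \<gamma> \<oplus>\<^bsub>H (rng G \<gamma>)\<^esub> L \<gamma> v) ` carrier (H (src G \<gamma>)) = carrier (H (rng G \<gamma>))"
  proof (intro subset_antisym subsetI)
    fix w assume w: "w \<in> carrier (H (rng G \<gamma>))"
    then have "w \<ominus>\<^bsub>H (rng G \<gamma>)\<^esub> b \<gamma> \<in> L \<gamma> ` carrier (H (src G \<gamma>))"
      using L_surj[OF \<gamma>A] b_closed[OF \<gamma>A] by simp
    then obtain v where "v \<in> carrier (H (src G \<gamma>))" "L \<gamma> v = w \<ominus>\<^bsub>H (rng G \<gamma>)\<^esub> b \<gamma>" by force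
    then show "w \<in> (\<lambda>v. b \<gamma> \<oplus>\<^bsub>H (rng G \<gamma>)\<^esub> L \<gamma> v) ` carrier (H (src G \<gamma>))"
      using r.diff_add_cancel(2)[OF w b_closed[OF \<gamma>A]] by (intro image_eqI[of _ _ v]) auto
  qed (use L_closed[OF \<gamma>A] b_closed[OF \<gamma>A] in auto)
  fix v w assume vw: "v \<in> carrier (H (src G \<gamma>))" "w \<in> carrier (H (src G \<gamma>))"
  show "hnorm (H (rng G \<gamma>)) ((b \<gamma> \<oplus>\<^bsub>H (rng G \<gamma>)\<^esub> L \<gamma> v) \<ominus>\<^bsub>H (rng G \<gamma>)\<^esub> (b \<gamma> \<oplus>\<^bsub>H (rng G \<gamma>)\<^esub> L \<gamma> w)) =
      hnorm (H (src G \<gamma>)) (v \<ominus>\<^bsub>H (src G \<gamma>)\<^esub> w)"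
    using r.add_diff_add[OF b_closed[OF \<gamma>A] L_closed[OF \<gamma>A vw(1)] L_closed[OF \<gamma>A vw(2)]]
      L_diff[OF \<gamma>A vw] L_hnorm[OF \<gamma>A, of "v \<ominus>\<^bsub>H (src G \<gamma>)\<^esub> w"] vw by simp
qed

theorem bounded_coboundary:
  assumes erg: "\<And>A. A \<in> sets (unit_space G) \<Longrightarrow> invariant_set G A \<Longrightarrow>
      (AE \<gamma> in \<nu>. rng G \<gamma> \<notin> A) \<or> (AE \<gamma> in \<nu>. rng G \<gamma> \<in> A)"
    and E: "E \<in> sets (unit_space G)" and pos: "\<not> (AE \<gamma> in \<nu>. rng G \<gamma> \<notin> E)"
    and bdd: "\<And>x. x \<in> E \<Longrightarrow> bdd_above ((\<lambda>\<gamma>. hnorm (H (rng G \<gamma>)) (b \<gamma>)) ` fibre_into G x E)"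
  shows "\<exists>\<xi>. borel_section (unit_space G) H e \<xi> \<and>
    (AE \<gamma> in \<nu>. b \<gamma> = \<xi> (rng G \<gamma>) \<ominus>\<^bsub>H (rng G \<gamma>)\<^esub> L \<gamma> (\<xi> (src G \<gamma>)))"
proof -
  let ?F = "into_filter E"
  obtain V where V: "V \<in> sets (unit_space G)" "V \<subseteq> U" "AE \<gamma> in \<nu>. rng G \<gamma> \<in> V"
      "\<And>x. x \<in> V \<Longrightarrow> AE \<gamma> in \<kappa> x. src G \<gamma> \<in> U"
    using ex_regular_units by blast
  have Uu: "U \<subseteq> units G" using U_sets by (rule sets_unit_space_subset)
  \<comment> \<open>At these units \<open>?F x\<close> is improper, and there is nothing to take a
    center of.\<close>
  define N where "N = {x \<in> units G. AE \<gamma> in \<kappa> x. src G \<gamma> \<notin> E}"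
  have N: "N \<in> sets (unit_space G)"
    unfolding N_def using src_vimage_sets[OF E] by (intro kappa_measurable_AE) simp
  define A where "A = U - N"
  have A: "A \<in> sets (unit_space G)" and B: "U \<inter> N \<in> sets (unit_space G)"
    using U_sets N by (auto simp: A_def)
  have A_iff: "x \<in> A \<longleftrightarrow> x \<in> U \<and> ?F x \<noteq> bot" for x
    using Uu by (auto simp: A_def N_def into_filter_eq_bot)
  \<comment> \<open>Such an arrow would have both ends in \<open>U\<close>, and then the filters at
    its two ends are improper simultaneously.\<close>
  have noarrow: "src G \<gamma> \<notin> U \<inter> N" if "\<gamma> \<in> arrows G" "rng G \<gamma> \<in> A" for \<gamma>
    using that into_filter_bot_iff[of \<gamma> E] by (auto simp: A_iff reduction_def N_def into_filter_eq_bot)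
  obtain A' where A': "A' \<in> sets (unit_space G)" "invariant_set G A'" "A \<subseteq> A'" "A' \<inter> (U \<inter> N) = {}"
    using invariant_separation[OF A B noarrow] by blast
  \<comment> \<open>If \<open>A\<close> were null, almost every arrow would have its source outside
    \<open>E\<close>; by symmetry of the measure class the same would hold for the range, against
    \<open>pos\<close>.\<close>
  have A_pos: "\<not> (AE \<gamma> in \<nu>. rng G \<gamma> \<notin> A)"
  proof
    assume "AE \<gamma> in \<nu>. rng G \<gamma> \<notin> A"
    then have "AE \<gamma> in \<nu>. AE \<eta> in \<kappa> (rng G \<gamma>). src G \<eta> \<notin> E"
      using AE_U by eventually_elim (auto simp: A_def N_def)
    then have "AE \<gamma> in \<nu>. src G \<gamma> \<notin> E"
      using src_vimage_sets[OF E] by (intro AE_nu_I[where P = "\<lambda>\<gamma>. src G \<gamma> \<notin> E"]) simp_all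
    then show False using pos AE_src_iff[of "- E"] by simp
  qed
  then have "\<not> (AE \<gamma> in \<nu>. rng G \<gamma> \<notin> A')" using A'(3) by (auto elim!: contrapos_nn eventually_mono)
  then have "AE \<gamma> in \<nu>. rng G \<gamma> \<in> A'" using erg A' by blast
  \<comment> \<open>Within the conull set \<open>U\<close>, the set \<open>A'\<close> does not
    exceed \<open>A\<close>, as it misses \<open>U \<inter> N\<close>.\<close>
  then have A_conull: "AE \<gamma> in \<nu>. rng G \<gamma> \<in> A"
    using AE_U by eventually_elim (use A'(4) in \<open>auto simp: A_def\<close>)
  define S where "S = A \<inter> V"
  have S: "S \<in> sets (unit_space G)" using A V(1) by (simp add: S_def)
  have SU: "x \<in> U" "x \<in> units G" "x \<in> V" "?F x \<noteq> bot" if "x \<in> S" for x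
    using that Uu A_iff by (auto simp: S_def)
  \<comment> \<open>\<open>x\<close> itself need not lie in \<open>E\<close>. One arrow
    \<open>\<gamma>\<close> from a unit of \<open>E\<close> to \<open>x\<close> suffices: almost
    every arrow \<open>\<zeta>\<close> from \<open>E\<close> to \<open>x\<close> is
    \<open>mul G \<gamma> \<eta>\<close> with \<open>\<eta>\<close> in the fibre over
    \<open>src G \<gamma>\<close>, where \<open>bdd\<close> applies.\<close>
  have enclosed: "\<exists>v\<in>carrier (H x). \<exists>c. enclosed (H x) (?F x) b v c" if x: "x \<in> S" for x
  proof -
    interpret x: hilbert_space K "H x" by (rule hilbert_H[OF SU(2)[OF x]])
    have "\<not> (AE \<gamma> in \<kappa> x. src G \<gamma> \<notin> E)" using SU(4)[OF x] by (simp add: into_filter_eq_bot)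
    then have "\<not> (AE \<gamma> in \<kappa> x. \<not> (src G \<gamma> \<in> E \<and> src G \<gamma> \<in> U \<and> \<gamma> \<in> arrows G \<and> rng G \<gamma> = x))"
    proof (rule contrapos_nn)
      assume "AE \<gamma> in \<kappa> x. \<not> (src G \<gamma> \<in> E \<and> src G \<gamma> \<in> U \<and> \<gamma> \<in> arrows G \<and> rng G \<gamma> = x)"
      then show "AE \<gamma> in \<kappa> x. src G \<gamma> \<notin> E"
        using V(4)[OF SU(3)[OF x]] AE_kappa_fibre[OF SU(2)[OF x]] by eventually_elim blast
    qed
    then obtain \<gamma> where \<gamma>: "src G \<gamma> \<in> E" "src G \<gamma> \<in> U" "\<gamma> \<in> arrows G" "rng G \<gamma> = x"
      using always_eventually by blast
    have \<gamma>U: "\<gamma> \<in> reduction G U" using \<gamma> SU(1)[OF x] by (simp add: reduction_def)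
    obtain M where M: "\<And>\<eta>. \<eta> \<in> fibre_into G (src G \<gamma>) E \<Longrightarrow> hnorm (H (rng G \<eta>)) (b \<eta>) \<le> M"
      using bdd[OF \<gamma>(1)] unfolding bdd_above_def by blast
    have "AE \<zeta> in \<kappa> x. src G \<zeta> \<in> E \<longrightarrow> hnorm (H x) (b \<zeta> \<ominus>\<^bsub>H x\<^esub> \<zero>\<^bsub>H x\<^esub>) \<le> hnorm (H x) (b \<gamma>) + M"
      using V(4)[OF SU(3)[OF x]] AE_kappa_fibre[OF SU(2)[OF x]]
    proof eventually_elim
      case (elim \<zeta>)
      define \<eta> where "\<eta> = mul G (ginv G \<gamma>) \<zeta>"
      have r: "rng G \<zeta> = rng G \<gamma>" using elim \<gamma> by simp
      have \<eta>: "mul G \<gamma> \<eta> = \<zeta>" "\<eta> \<in> arrows G" "rng G \<eta> = src G \<gamma>" "src G \<eta> = src G \<zeta>"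
        using mul_ginv_mul[OF \<gamma>(3) _ r] elim unfolding \<eta>_def by blast+
      have \<eta>U: "\<eta> \<in> reduction G U" using \<eta> \<gamma>(2) elim by (simp add: reduction_def)
      have b\<eta>: "b \<eta> \<in> carrier (H (src G \<gamma>))" using b_closed[OF \<eta>(2)] \<eta>(3) by simp
      have cl: "b \<gamma> \<in> carrier (H x)" "L \<gamma> (b \<eta>) \<in> carrier (H x)" "b \<zeta> \<in> carrier (H x)"
        using b_closed[OF \<gamma>(3)] L_closed[OF \<gamma>(3) b\<eta>] b_closed[of \<zeta>] elim \<gamma>(4) by auto
      have "b \<zeta> = b \<gamma> \<oplus>\<^bsub>H x\<^esub> L \<gamma> (b \<eta>)" using b_mul[OF \<gamma>U \<eta>U] \<eta> \<gamma>(4) by simp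
      then have "hnorm (H x) (b \<zeta>) \<le> hnorm (H x) (b \<gamma>) + hnorm (H x) (L \<gamma> (b \<eta>))"
        using x.hnorm_triangle[OF cl(1,2)] by simp
      also have "hnorm (H x) (L \<gamma> (b \<eta>)) = hnorm (H (rng G \<eta>)) (b \<eta>)"
        using L_hnorm[OF \<gamma>(3) b\<eta>] \<gamma>(4) \<eta>(3) by simp
      finally have *: "hnorm (H x) (b \<zeta>) \<le> hnorm (H x) (b \<gamma>) + hnorm (H (rng G \<eta>)) (b \<eta>)" .
      have z: "b \<zeta> \<ominus>\<^bsub>H x\<^esub> \<zero>\<^bsub>H x\<^esub> = b \<zeta>" using cl(3) by (simp add: a_minus_def)
      show ?case
      proof
        assume "src G \<zeta> \<in> E"
        then have "\<eta> \<in> fibre_into G (src G \<gamma>) E" using \<eta> by (simp add: fibre_into_def)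
        then show "hnorm (H x) (b \<zeta> \<ominus>\<^bsub>H x\<^esub> \<zero>\<^bsub>H x\<^esub>) \<le> hnorm (H x) (b \<gamma>) + M"
          using M * unfolding z by fastforce
      qed
    qed
    then have "enclosed (H x) (?F x) b \<zero>\<^bsub>H x\<^esub> (hnorm (H x) (b \<gamma>) + M)"
      by (simp add: enclosed_def eventually_into_filter)
    then show ?thesis by blast
  qed
  define \<xi> where "\<xi> x = (if x \<in> S then THE v. chebyshev_center (H x) (?F x) b v else \<zero>\<^bsub>H x\<^esub>)" for x
  have "borel_section (unit_space G) H e \<xi>"
    unfolding \<xi>_def[abs_def]
  proof (rule borel_section_chebyshev_center[OF S])
    fix d c assume d: "borel_section (unit_space G) H e d"
    have "{x \<in> S. enclosed (H x) (?F x) b (d x) c} =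
        S \<inter> {x \<in> units G. enclosed (H x) (?F x) b (d x) c}" using SU by auto
    then show "{x \<in> S. enclosed (H x) (?F x) b (d x) c} \<in> sets (unit_space G)"
      using S enclosed_measurable[OF E d] by simp
  qed (use SU eventually_b_closed enclosed in auto)
  \<comment> \<open>In this form the equivariance of centers turns directly into an equation for
    \<open>\<xi>\<close>.\<close>
  moreover have center: "chebyshev_center (H x) (?F x) b v \<longleftrightarrow> v = \<xi> x" if x: "x \<in> S" for x v
  proof -
    interpret x: hilbert_space K "H x" by (rule hilbert_H[OF SU(2)[OF x]])
    obtain v0 c where v0: "v0 \<in> carrier (H x)" "enclosed (H x) (?F x) b v0 c" using enclosed[OF x] by blast
    note f = eventually_b_closed[OF SU(2)[OF x], of E] SU(4)[OF x]
    have ex1: "\<exists>!u. chebyshev_center (H x) (?F x) b u"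
      using x.ex_chebyshev_center[OF v0 f] x.chebyshev_center_unique[OF _ _ v0 f] by blast
    have "\<xi> x = (THE v. chebyshev_center (H x) (?F x) b v)" using x by (simp add: \<xi>_def)
    then have "chebyshev_center (H x) (?F x) b (\<xi> x)" using theI'[OF ex1] by metis
    then show ?thesis using ex1 by blast
  qed
  moreover have "AE \<gamma> in \<nu>. b \<gamma> = \<xi> (rng G \<gamma>) \<ominus>\<^bsub>H (rng G \<gamma>)\<^esub> L \<gamma> (\<xi> (src G \<gamma>))"
  proof -
    have AE_S: "AE \<gamma> in \<nu>. rng G \<gamma> \<in> S" using A_conull V(3) by eventually_elim (simp add: S_def)
    then have "AE \<gamma> in \<nu>. src G \<gamma> \<in> S" by (simp add: AE_src_iff)
    then show ?thesis
      using AE_S AE_space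
    proof eventually_elim
      case (elim \<gamma>)
      then have \<gamma>A: "\<gamma> \<in> arrows G" by (simp add: space_nu)
      have \<gamma>U: "\<gamma> \<in> reduction G U" using elim SU(1) \<gamma>A by (simp add: reduction_def)
      interpret r: hilbert_space K "H (rng G \<gamma>)" by (rule hilbert_H[OF rng_arrows[OF \<gamma>A]])
      have c: "chebyshev_center (H (src G \<gamma>)) (?F (src G \<gamma>)) b (\<xi> (src G \<gamma>))"
        using center[OF elim(1)] by blast
      then have \<xi>s: "\<xi> (src G \<gamma>) \<in> carrier (H (src G \<gamma>))" by (simp add: chebyshev_center_def)
      have "b \<gamma> \<oplus>\<^bsub>H (rng G \<gamma>)\<^esub> L \<gamma> (\<xi> (src G \<gamma>)) = \<xi> (rng G \<gamma>)"
        using center_equivariant[OF \<gamma>U V(4)[OF SU(3)[OF elim(1)]] c] center[OF elim(2)] by blast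
      then show ?case
        using r.add_diff_cancel[OF b_closed[OF \<gamma>A] L_closed[OF \<gamma>A \<xi>s]] by simp
    qed
  qed
  ultimately show ?thesis by blast
qed

end

section \<open>The three conditions for cocycles of a measured groupoid\<close>

theorem theorem3p19:
  fixes K :: "complex set"
    and G :: "'g groupoid" and C :: "'g measure set"
    and H :: "'g \<Rightarrow> 'h hilbert" and e :: "nat \<Rightarrow> 'g \<Rightarrow> 'h"
    and L :: "'g \<Rightarrow> 'h \<Rightarrow> 'h" and b :: "'g \<Rightarrow> 'h"
    and cond_i cond_ii cond_iii :: bool
  assumes "K = \<real> \<or> K = UNIV"
    and "measured_groupoid G C"
    and "hilbert_bundle K (unit_space G) H e"
    and "groupoid_representation K G C H e L"
    and "cocycle G C H e L b"
  defines "cond_i \<equiv> coboundary G C H e L b"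
    and "cond_ii \<equiv> \<exists>E. positive_units G C E \<and>
           bdd_above ((\<lambda>\<gamma>. hnorm (H (rng G \<gamma>)) (b \<gamma>)) ` reduction G E)"
    and "cond_iii \<equiv> \<exists>E. positive_units G C E \<and>
           (\<forall>x\<in>E. bdd_above ((\<lambda>\<gamma>. hnorm (H (rng G \<gamma>)) (b \<gamma>)) ` fibre_into G x E))"
  shows "(cond_i \<longrightarrow> cond_ii) \<and> (cond_ii \<longrightarrow> cond_iii) \<and>
         (ergodic_groupoid G C \<and> r_discrete G C \<longrightarrow>
            (cond_i \<longleftrightarrow> cond_ii) \<and> (cond_ii \<longleftrightarrow> cond_iii))"
proof -
  interpret measured_groupoid G C by fact
  obtain \<nu> \<kappa> U where sys: "quasi_invariant_system G \<nu> \<kappa> U"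
    and conull: "\<And>A. conull_units G C A \<longleftrightarrow> A \<in> sets (unit_space G) \<and> (AE \<gamma> in \<nu>. rng G \<gamma> \<in> A)"
    and positive: "\<And>A. positive_units G C A \<longleftrightarrow> A \<in> sets (unit_space G) \<and> \<not> (AE \<gamma> in \<nu>. rng G \<gamma> \<notin> A)"
    and AE_C: "\<And>\<nu>' P. \<nu>' \<in> C \<Longrightarrow> (AE \<gamma> in \<nu>. P \<gamma>) \<Longrightarrow> (AE \<gamma> in \<nu>'. P \<gamma>)"
    and nu_C: "\<nu> \<in> C"
    using ex_quasi_invariant_system by (elim exE conjE) (rule that, assumption, blast+)
  interpret sys: quasi_invariant_system G \<nu> \<kappa> U by fact
  obtain U1 where U1: "conull_units G C U1" "\<forall>\<gamma>1\<in>reduction G U1. \<forall>\<gamma>2\<in>reduction G U1.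
      src G \<gamma>1 = rng G \<gamma>2 \<longrightarrow> (\<forall>v\<in>carrier (H (src G \<gamma>2)). L (mul G \<gamma>1 \<gamma>2) v = L \<gamma>1 (L \<gamma>2 v))"
    using assms(4) unfolding groupoid_representation_def by blast
  obtain U2 where U2: "conull_units G C U2" "\<forall>\<gamma>1\<in>reduction G U2. \<forall>\<gamma>2\<in>reduction G U2.
      src G \<gamma>1 = rng G \<gamma>2 \<longrightarrow> b (mul G \<gamma>1 \<gamma>2) = b \<gamma>1 \<oplus>\<^bsub>H (rng G \<gamma>1)\<^esub> L \<gamma>1 (b \<gamma>2)"
    using assms(5) unfolding cocycle_def by blast
  \<comment> \<open>One conull set on which quasi-invariance, multiplicativity of \<open>L\<close>
    and the cocycle identity hold together.\<close>
  define W where "W = U \<inter> U1 \<inter> U2"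
  have W: "reduction G W \<subseteq> reduction G U" "reduction G W \<subseteq> reduction G U1" "reduction G W \<subseteq> reduction G U2"
    by (auto simp: W_def reduction_def)
  interpret act: affine_action G \<nu> \<kappa> W K H e L b
  proof (intro affine_action.intro affine_action_axioms.intro quasi_invariant_system.intro
      quasi_invariant_system_axioms.intro)
    show "W \<in> sets (unit_space G)" using sys.U_sets U1(1) U2(1) conull by (auto simp: W_def)
    have "AE \<gamma> in \<nu>. rng G \<gamma> \<in> U1" "AE \<gamma> in \<nu>. rng G \<gamma> \<in> U2" using U1(1) U2(1) conull by auto
    then show "AE \<gamma> in \<nu>. rng G \<gamma> \<in> W" using sys.AE_U by eventually_elim (simp add: W_def)
    show "measure_equiv (translate G \<gamma> (\<kappa> (src G \<gamma>))) (\<kappa> (rng G \<gamma>))" if "\<gamma> \<in> reduction G W" for \<gamma>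
      using sys.quasi_invariant that W(1) by blast
    show "hilbert_iso K (H (src G \<gamma>)) (H (rng G \<gamma>)) (L \<gamma>)" if "\<gamma> \<in> arrows G" for \<gamma>
      using assms(4) that by (simp add: groupoid_representation_def)
    show "L (mul G \<gamma> \<eta>) v = L \<gamma> (L \<eta> v)"
      if "\<gamma> \<in> reduction G W" "\<eta> \<in> reduction G W" "src G \<gamma> = rng G \<eta>" "v \<in> carrier (H (src G \<eta>))" for \<gamma> \<eta> v
      using U1(2) that W(2) by blast
    show "b (mul G \<gamma> \<eta>) = b \<gamma> \<oplus>\<^bsub>H (rng G \<gamma>)\<^esub> L \<gamma> (b \<eta>)"
      if "\<gamma> \<in> reduction G W" "\<eta> \<in> reduction G W" "src G \<gamma> = rng G \<eta>" for \<gamma> \<eta>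
      using U2(2) that W(3) by blast
    show "borel_section (arr G) (H \<circ> rng G) (\<lambda>n. e n \<circ> rng G) b"
      using assms(5) by (simp add: cocycle_def)
  qed (fact borel_groupoid_axioms sys.prob sys.sets_nu sys.sym sys.dis assms(3))+
  have i_ii: cond_ii if "cond_i"
  proof -
    obtain \<xi> where "borel_section (unit_space G) H e \<xi>"
        "AE \<gamma> in \<nu>. b \<gamma> = \<xi> (rng G \<gamma>) \<ominus>\<^bsub>H (rng G \<gamma>)\<^esub> L \<gamma> (\<xi> (src G \<gamma>))"
      using \<open>cond_i\<close> nu_C unfolding cond_i_def coboundary_def by blast
    from act.coboundary_bounded[OF this] show ?thesis
      unfolding cond_ii_def positive by (elim bexE conjE) (intro exI conjI)
  qed
  have ii_iii: cond_iii if "cond_ii"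
  proof -
    obtain E where E: "positive_units G C E"
        "bdd_above ((\<lambda>\<gamma>. hnorm (H (rng G \<gamma>)) (b \<gamma>)) ` reduction G E)"
      using \<open>cond_ii\<close> unfolding cond_ii_def by blast
    have "fibre_into G x E \<subseteq> reduction G E" if "x \<in> E" for x
      using that by (auto simp: fibre_into_def reduction_def)
    then have "bdd_above ((\<lambda>\<gamma>. hnorm (H (rng G \<gamma>)) (b \<gamma>)) ` fibre_into G x E)" if "x \<in> E" for x
      using that by (intro bdd_above_mono[OF E(2)] image_mono) blast
    then show ?thesis using E(1) unfolding cond_iii_def by (intro exI[of _ E]) simp
  qed
  have iii_i: cond_i if erg: "ergodic_groupoid G C" and "cond_iii"
  proof -
    have null: "null_units G C A \<Longrightarrow> AE \<gamma> in \<nu>. rng G \<gamma> \<notin> A" for A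
      using positive[of A] by (auto simp: positive_units_def null_units_def)
    have zero_one: "(AE \<gamma> in \<nu>. rng G \<gamma> \<notin> A) \<or> (AE \<gamma> in \<nu>. rng G \<gamma> \<in> A)"
      if "A \<in> sets (unit_space G)" "invariant_set G A" for A
      using erg that null conull unfolding ergodic_groupoid_def by blast
    obtain E where E: "positive_units G C E"
        "\<And>x. x \<in> E \<Longrightarrow> bdd_above ((\<lambda>\<gamma>. hnorm (H (rng G \<gamma>)) (b \<gamma>)) ` fibre_into G x E)"
      using \<open>cond_iii\<close> unfolding cond_iii_def by (elim exE conjE) (rule that, assumption, rule bspec)
    have "E \<in> sets (unit_space G)" "\<not> (AE \<gamma> in \<nu>. rng G \<gamma> \<notin> E)" using E(1) positive by blast+
    from act.bounded_coboundary[OF zero_one this E(2)]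
    obtain \<xi> where "borel_section (unit_space G) H e \<xi>"
        "AE \<gamma> in \<nu>. b \<gamma> = \<xi> (rng G \<gamma>) \<ominus>\<^bsub>H (rng G \<gamma>)\<^esub> L \<gamma> (\<xi> (src G \<gamma>))"
      by blast
    then show ?thesis using AE_C unfolding cond_i_def coboundary_def by blast
  qed
  show ?thesis using i_ii ii_iii iii_i by blast
qed

end
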